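(* Let $k\ge2$, $q\ge0$ and $1\le t\le2^q$ be integers. Let $\mathbf a=(a_1,\ldots,a_k)\in\mathbb{N}^k$ satisfy (i) $a_1\le a_2\le\cdots\le a_k$, (ii) $a_2\le2a_1+t$, and (iii) $0\le a_{k-1}\le2^q-t$. Let $\mathbf m=(m_1,\ldots,m_k)$ be given by $$m_1=2^{q+1}-t-a_1\quad\text{and}\quad m_i=2^q\cdot[2^{i-2}-1]+t+2a_{i-1}-a_i\ \text{ for all } 2\le i\le k,$$ and assume $m_k\ge0$ (so that $\mathbf m\in\mathbb{N}^k$). Then $$\Delta(\mathbf m,\mathbf a;k)=2^q\cdot[2^{k-1}+1]-t\quad\text{and}\quad k\,\Delta(\mathbf m,\mathbf a;k)=C(\mathbf m,\mathbf a;k).$$ Thus $\Delta(\mathbf m,\mathbf a;k)=U(m_1;k)$ whenever $a_1=0$, and in particular (taking $\mathbf a=\mathbf 0$) $$\Delta((2^{q+1}-t,\ t,\ 2^q+t,\ 3\cdot2^q+t,\ \ldots,\ 2^q\cdot[2^{k-2}-1]+t);k)=U(2^{q+1}-t;k).$$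
   Context: $\mathbb{N}$ includes $0$. A mass distribution (or mass) on $\mathbb{R}^d$ is a positive, finite Borel measure $\mu$ such that every hyperplane has $\mu$-measure zero. Given hyperplanes $H_1,\ldots,H_\ell$ in $\mathbb{R}^d$ with closed half-spaces $H_i^0,H_i^1$ bounded by $H_i$, they equipartition $\mu$ if $\mu(H_1^{g_1}\cap\cdots\cap H_\ell^{g_\ell})=\frac{1}{2^\ell}\mu(\mathbb{R}^d)$ for all $(g_1,\ldots,g_\ell)\in\{0,1\}^\ell$. For $\mathbf m,\mathbf a\in\mathbb{N}^k$ with $m_1\ge1$, $\Delta(\mathbf m,\mathbf a;k)$ denotes the minimum dimension $d$ (with $d\ge a_i$ for all $i$) such that, for any family of masses $\{\mu_{i,j}\}_{1\le i\le k,\,1\le j\le m_i}$ on $\mathbb{R}^d$ and any $k$ affine subspaces $A_1,\ldots,A_k$ of $\mathbb{R}^d$ with $\dim A_i=a_i-1$ (where $\dim A_i=-1$ means $A_i=\emptyset$), there exist $k$ hyperplanes $H_1,\ldots,H_k$ in $\mathbb{R}^d$ such that $A_i\subseteq H_i$ for all $1\le i\le k$ and, for each $1\le i\le k$, the hyperplanes $H_i,\ldots,H_k$ equipartition each of $\mu_{i,1},\ldots,\mu_{i,m_i}$. Write $\Delta(\mathbf m;k):=\Delta(\mathbf m,\mathbf 0;k)$ and $$C(\mathbf m,\mathbf a;k)=\sum_{i=1}^k\left[m_i(2^{k-i+1}-1)+a_i\right].$$ For $m\ge1$ written as $m=2^p+r$ with $0\le r<2^p$, $U(m;k):=2^{p+k-1}+r$;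 equivalently $U(2^{q+1}-t;k)=2^q\cdot[2^{k-1}+1]-t$ for $q\ge0$ and $1\le t\le2^q$. *)

theory Defs
  imports
    "HOL-Analysis.Analysis"
    "HOL-Library.Function_Algebras"
    "HOL-Library.Discrete_Functions"
begin

text \<open>
  The dimension has to be quantified over, so real \<open>d\<close>-space is the carrier of
  \<^const>\<open>Euclidean_space\<close>: the sequences \<open>x :: nat \<Rightarrow> real\<close> with \<open>x i = 0\<close> for \<open>i \<ge> d\<close>, in the
  product topology. The pointwise vector space structure on functions makes \<^const>\<open>hull\<close>,
  \<^const>\<open>affine\<close> and \<^const>\<open>affine_dependent\<close> available there.
\<close>

instantiation "fun" :: (type, real_vector) real_vector
begin

definition scaleR_fun :: "real \<Rightarrow> ('a \<Rightarrow> 'b) \<Rightarrow> 'a \<Rightarrow> 'b"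
  where "scaleR_fun c f = (\<lambda>x. c *\<^sub>R f x)"

instance
  by standard (simp_all add: scaleR_fun_def plus_fun_def scaleR_add_right scaleR_add_left)

end

abbreviation Rspace :: "nat \<Rightarrow> (nat \<Rightarrow> real) set"
  where "Rspace d \<equiv> topspace (Euclidean_space d)"

definition normal_vector :: "nat \<Rightarrow> (nat \<Rightarrow> real) \<Rightarrow> bool"
  where "normal_vector d u \<longleftrightarrow> u \<in> Rspace d \<and> u \<noteq> 0"

definition hyperplane :: "nat \<Rightarrow> (nat \<Rightarrow> real) \<Rightarrow> real \<Rightarrow> (nat \<Rightarrow> real) set"
  where "hyperplane d u c = {x \<in> Rspace d. (\<Sum>l<d. u l * x l) = c}"

definition halfspace :: "nat \<Rightarrow> (nat \<Rightarrow> real) \<Rightarrow> real \<Rightarrow> bool \<Rightarrow> (nat \<Rightarrow> real) set"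
  where "halfspace d u c g =
    (if g then {x \<in> Rspace d. (\<Sum>l<d. u l * x l) \<ge> c}
     else {x \<in> Rspace d. (\<Sum>l<d. u l * x l) \<le> c})"

text \<open>
  The zero measure also counts as a mass; it is equipartitioned by any hyperplanes, so
  admitting it does not affect \<open>Delta\<close>.
\<close>

definition mass :: "nat \<Rightarrow> (nat \<Rightarrow> real) measure \<Rightarrow> bool"
  where "mass d \<mu> \<longleftrightarrow>
    sets \<mu> = sets (restrict_space borel (Rspace d)) \<and>
    finite_measure \<mu> \<and>
    (\<forall>u c. normal_vector d u \<longrightarrow> emeasure \<mu> (hyperplane d u c) = 0)"

definition equipartition ::
    "nat \<Rightarrow> nat set \<Rightarrow> (nat \<Rightarrow> nat \<Rightarrow> real) \<Rightarrow> (nat \<Rightarrow> real) \<Rightarrow> (nat \<Rightarrow> real) measure \<Rightarrow> bool"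
  where "equipartition d I u c \<mu> \<longleftrightarrow>
    (\<forall>g :: nat \<Rightarrow> bool.
      measure \<mu> (\<Inter>i\<in>I. halfspace d (u i) (c i) (g i)) = measure \<mu> (Rspace d) / 2 ^ card I)"

text \<open>
  The library's \<^const>\<open>aff_dim\<close> is confined to the class \<^class>\<open>euclidean_space\<close>; this is its
  definition via affine bases. Dimension \<open>-1\<close> corresponds to \<open>B = {}\<close>, that is \<open>A = {}\<close>.
\<close>

definition affine_subspace :: "nat \<Rightarrow> int \<Rightarrow> (nat \<Rightarrow> real) set \<Rightarrow> bool"
  where "affine_subspace d e A \<longleftrightarrow>
    A \<subseteq> Rspace d \<and>
    (\<exists>B. finite B \<and> \<not> affine_dependent B \<and> int (card B) = e + 1 \<and> A = affine hull B)"

text \<open>Tuples are indexed from \<open>1\<close>; only the values at \<open>1, \<dots>, k\<close> matter.\<close>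

definition admissible_dim :: "(nat \<Rightarrow> nat) \<Rightarrow> (nat \<Rightarrow> nat) \<Rightarrow> nat \<Rightarrow> nat \<Rightarrow> bool"
  where "admissible_dim m a k d \<longleftrightarrow>
    (\<forall>i\<in>{1..k}. a i \<le> d) \<and>
    (\<forall>\<mu> A.
      (\<forall>i\<in>{1..k}. \<forall>j\<in>{1..m i}. mass d (\<mu> i j)) \<longrightarrow>
      (\<forall>i\<in>{1..k}. affine_subspace d (int (a i) - 1) (A i)) \<longrightarrow>
      (\<exists>u c.
        (\<forall>i\<in>{1..k}. normal_vector d (u i) \<and> A i \<subseteq> hyperplane d (u i) (c i)) \<and>
        (\<forall>i\<in>{1..k}. \<forall>j\<in>{1..m i}. equipartition d {i..k} u c (\<mu> i j))))"

text \<open>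
  The infimum is taken in \<^typ>\<open>enat\<close>, so an equation \<open>Delta m a k = enat n\<close> asserts that the
  minimum exists.
\<close>

definition Delta :: "(nat \<Rightarrow> nat) \<Rightarrow> (nat \<Rightarrow> nat) \<Rightarrow> nat \<Rightarrow> enat"
  where "Delta m a k = (INF d \<in> {d. admissible_dim m a k d}. enat d)"

definition C_bound :: "(nat \<Rightarrow> nat) \<Rightarrow> (nat \<Rightarrow> nat) \<Rightarrow> nat \<Rightarrow> nat"
  where "C_bound m a k = (\<Sum>i=1..k. m i * (2 ^ (k - i + 1) - 1) + a i)"

text \<open>For \<open>n = 2 ^ p + r\<close> with \<open>0 \<le> r < 2 ^ p\<close> one has \<open>p = floor_log n\<close>.\<close>

definition U_bound :: "nat \<Rightarrow> nat \<Rightarrow> nat"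
  where "U_bound n k = 2 ^ (floor_log n + k - 1) + (n - 2 ^ floor_log n)"

end

(*
  Upper bound. A hyperplane with an ordering of its two sides is a point of a d-sphere, and the
  equipartition and incidence conditions on the k hyperplanes say that d * k real functions on the
  k-fold product of spheres vanish, where each function changes its sign according to a character of
  the group of sign changes (Z/2)^k. Such functions have a common zero as soon as the coefficient of
  u_1^d ... u_k^d in the product of the corresponding linear forms over Z/2 is nonzero: otherwise the
  signs of the functions on a fine cubical grid are cochains whose cup product is zero, whereas its
  value on the fundamental class is that coefficient. For the theorem the product of linear forms is a
  product of Dickson polynomials, and the coefficient is computed by splitting off one variable at a
  time, which turns (q, t) into (q + 1, 2^q + t).

  Lower bound. If the masses are segments of the moment curve and the affine subspaces are spanned by
  other points of it, then the k hyperplanes have at least C(m, a; k) intersections with the curve,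
  but each of them has at most d.
*)

theory Submission
  imports Defs "HOL-Library.Z2" "HOL-Library.Poly_Mapping" "HOL-Library.Nat_Bijection"
    "HOL-Computational_Algebra.Polynomial"
begin

text \<open>A mass to be equipartitioned by \<open>H_i, ..., H_k\<close> imposes one condition for
  each nonempty subset of \<open>{i..k}\<close>. This makes C(m, a; k) conditions in all, the very
  number of crossings that the moment curve forces, so both bounds meet at d = C / k once the
  coefficient is odd. The coefficient is computed by congruences in which every u_i^(d+1) vanishes,
  as in the cohomology of a product of projective spaces; the ideal is left abstract because the
  induction step passes to another one. The value d = 2^(q+k-1) + 2^q - t is unchanged when k drops
  by one and (q, t) becomes (q + 1, 2^q + t), and so are the formulas for the m_i with i \<ge> 3;
  this stability explains their shape. Two degeneracies need care. A function has no sign at a zero,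
  so a fixed equivariant sign breaks ties there. A point of the sphere may have a vanishing normal
  vector, which describes no hyperplane; the sign integrals of one nonzero mass exclude it
  afterwards.\<close>

section \<open>Dickson polynomials\<close>

text \<open>In characteristic two, \<open>x\<close> and \<open>y\<close> are congruent modulo \<open>J\<close> iff \<open>x + y \<in> J\<close>.\<close>

locale char2_ideal =
  fixes J :: "'a::comm_ring_1 set"
  assumes two: "(1 :: 'a) + 1 = 0"
    and zero_J: "0 \<in> J"
    and add_J: "x \<in> J \<Longrightarrow> y \<in> J \<Longrightarrow> x + y \<in> J"
    and mult_J: "x \<in> J \<Longrightarrow> r * x \<in> J"
begin

lemma add_self: "x + x = (0 :: 'a)"
proof -
  have "x + x = x * (1 + 1)" by (simp only: distrib_left mult_1_right)
  then show ?thesis by (simp only: two mult_zero_right)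
qed

lemma add_self2: "x + (x + y) = (y :: 'a)"
  by (simp add: add.assoc[symmetric] add_self)

lemma sum_J: "(\<And>i. i \<in> I \<Longrightarrow> h i \<in> J) \<Longrightarrow> sum h I \<in> J"
  by (induction I rule: infinite_finite_induct) (auto simp: zero_J add_J)

lemma sq_add: "(x + y)\<^sup>2 = x\<^sup>2 + (y :: 'a)\<^sup>2"
proof -
  have "(x + y)\<^sup>2 = x\<^sup>2 + y\<^sup>2 + (x * y + x * y)" by (simp add: power2_eq_square algebra_simps)
  then show ?thesis by (simp add: add_self)
qed

lemma sq_sum: "(sum h I)\<^sup>2 = (\<Sum>i\<in>I. (h i :: 'a)\<^sup>2)"
  by (induction I rule: infinite_finite_induct) (auto simp: sq_add)

lemma frob_add: "(x + y) ^ (2 ^ q) = x ^ (2 ^ q) + (y :: 'a) ^ (2 ^ q)"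
  by (induction q) (simp_all add: power_mult mult.commute[of 2] sq_add)

end

text \<open>The product of \<open>x + w\<close> over all subset sums \<open>w\<close> of
  \<open>v 0, ..., v (n - 1)\<close>, see \<open>lin_eq_prod\<close>. The recursive form makes its
  additivity and its divisibility properties short inductions.\<close>

fun lin :: "(nat \<Rightarrow> 'a::comm_ring_1) \<Rightarrow> nat \<Rightarrow> 'a \<Rightarrow> 'a" where
  "lin v 0 x = x"
| "lin v (Suc n) x = lin v n x * (lin v n x + lin v n (v n))"

text \<open>The top Dickson invariant: the product of all nonempty subset sums of
  \<open>v 0, ..., v (n - 1)\<close>, see \<open>dick_eq_prod\<close>. The factors here are the
  diagonal entries of a triangular system.\<close>

definition dick :: "(nat \<Rightarrow> 'a::comm_ring_1) \<Rightarrow> nat \<Rightarrow> 'a" where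
  "dick v n = (\<Prod>i<n. lin v i (v i))"

lemma dick_Suc: "dick v (Suc n) = dick v n * lin v n (v n)"
  by (simp add: dick_def)

lemma dick_dvd: "l < n \<Longrightarrow> v l dvd dick v n"
proof -
  assume "l < n"
  have "x dvd lin v i x" for i x by (induction i) auto
  then have "v l dvd lin v l (v l)" by blast
  also have "lin v l (v l) dvd dick v n" unfolding dick_def by (rule dvd_prodI) (use \<open>l < n\<close> in auto)
  finally show ?thesis .
qed

context char2_ideal
begin

text \<open>Squaring is additive in characteristic two, so the recursion turns an additive map f
  into f^2 + c * f, which is additive again.\<close>

lemma lin_add: "lin v n (x + y) = lin v n x + lin v n (y :: 'a)"
proof (induction n arbitrary: x y)
  case (Suc n)
  have "lin v (Suc n) z = (lin v n z)\<^sup>2 + lin v n (v n) * lin v n z" for z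
    by (simp add: power2_eq_square algebra_simps)
  then show ?case by (simp only: Suc sq_add) (simp add: algebra_simps)
qed simp

lemma lin_Suc: "lin v (Suc n) x = (lin v n x)\<^sup>2 + lin v n (v n) * lin v n (x :: 'a)"
  by (simp add: power2_eq_square algebra_simps)

lemma lin_vanish: "l < n \<Longrightarrow> lin v n (v l) = (0 :: 'a)"
  by (induction n) (auto simp: less_Suc_eq add_self)

text \<open>The subsets containing \<open>n\<close> contribute \<open>lin v n (x + v n)\<close>,
  which additivity turns into the second factor of the recursion.\<close>

lemma lin_eq_prod: "lin v n x = (\<Prod>\<alpha>\<in>Pow {..<n}. x + (\<Sum>i\<in>\<alpha>. v i :: 'a))"
proof (induction n arbitrary: x)
  case (Suc n)
  have inj: "inj_on (insert n) (Pow {..<n})"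
    by (rule inj_onI) (metis Diff_insert_absorb PowD lessThan_iff less_irrefl subset_eq)
  have "(\<Prod>\<alpha>\<in>Pow {..<Suc n}. x + (\<Sum>i\<in>\<alpha>. v i)) =
      (\<Prod>\<alpha>\<in>Pow {..<n}. x + (\<Sum>i\<in>\<alpha>. v i)) * (\<Prod>\<alpha>\<in>insert n ` Pow {..<n}. x + (\<Sum>i\<in>\<alpha>. v i))"
    unfolding lessThan_Suc Pow_insert by (rule prod.union_disjoint) auto
  also have "(\<Prod>\<alpha>\<in>insert n ` Pow {..<n}. x + (\<Sum>i\<in>\<alpha>. v i)) = (\<Prod>\<alpha>\<in>Pow {..<n}. (x + v n) + (\<Sum>i\<in>\<alpha>. v i))"
  proof (subst prod.reindex[OF inj], rule prod.cong[OF refl])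
    fix \<alpha> assume "\<alpha> \<in> Pow {..<n}"
    then have "finite \<alpha>" "n \<notin> \<alpha>" using finite_subset by auto
    then show "((\<lambda>\<alpha>. x + (\<Sum>i\<in>\<alpha>. v i)) \<circ> insert n) \<alpha> = x + v n + (\<Sum>i\<in>\<alpha>. v i)" by (simp add: add_ac)
  qed
  also have "(\<Prod>\<alpha>\<in>Pow {..<n}. x + (\<Sum>i\<in>\<alpha>. v i)) * \<dots> = lin v (Suc n) x"
    by (simp add: Suc[symmetric] lin_add)
  finally show ?case by simp
qed simp

lemma dick_eq_prod:
  "dick v n = (\<Prod>\<alpha>\<in>Pow {..<n} - {{}}. \<Sum>i\<in>\<alpha>. v i :: 'a)"
proof (induction n)
  case (Suc n)
  have inj: "inj_on (insert n) (Pow {..<n})"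
    by (rule inj_onI) (metis Diff_insert_absorb PowD lessThan_iff less_irrefl subset_eq)
  have "Pow {..<Suc n} - {{}} = (Pow {..<n} - {{}}) \<union> insert n ` Pow {..<n}"
    unfolding lessThan_Suc Pow_insert by blast
  then have "(\<Prod>\<alpha>\<in>Pow {..<Suc n} - {{}}. \<Sum>i\<in>\<alpha>. v i) =
      (\<Prod>\<alpha>\<in>Pow {..<n} - {{}}. \<Sum>i\<in>\<alpha>. v i) * (\<Prod>\<alpha>\<in>insert n ` Pow {..<n}. \<Sum>i\<in>\<alpha>. v i)"
    by (simp only:) (rule prod.union_disjoint, auto)
  also have "(\<Prod>\<alpha>\<in>insert n ` Pow {..<n}. \<Sum>i\<in>\<alpha>. v i) = (\<Prod>\<alpha>\<in>Pow {..<n}. v n + (\<Sum>i\<in>\<alpha>. v i))"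
  proof (subst prod.reindex[OF inj], rule prod.cong[OF refl])
    fix \<alpha> assume "\<alpha> \<in> Pow {..<n}"
    then have "finite \<alpha>" "n \<notin> \<alpha>" using finite_subset by auto
    then show "((\<lambda>\<alpha>. \<Sum>i\<in>\<alpha>. v i) \<circ> insert n) \<alpha> = v n + (\<Sum>i\<in>\<alpha>. v i)" by simp
  qed
  also have "\<dots> = lin v n (v n)" by (rule lin_eq_prod[symmetric])
  finally show ?case by (simp add: Suc dick_Suc)
qed (simp add: dick_def)

text \<open>In \<open>x\<close>, each \<open>lin v j\<close> is monic of degree 2^j and additive, so
  x^(2^n) expands in them. The coefficients \<open>g j\<close> do not depend on \<open>x\<close>;
  hence \<open>x\<close> may later be specialised to the \<open>v l\<close>.\<close>

lemma power_eq_lin_sum: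
  "\<exists>g. \<forall>x. x ^ (2 ^ n) = lin v n x + (\<Sum>j<n. g j * lin v j (x :: 'a))"
proof (induction n)
  case (Suc n)
  then obtain g where g: "\<And>x. x ^ (2 ^ n) = lin v n x + (\<Sum>j<n. g j * lin v j x)" by blast
  \<comment> \<open>The square of \<open>lin v j\<close> is \<open>lin v (Suc j)\<close> plus a
    multiple of \<open>lin v j\<close>: the first part shifts the squared coefficients by one, the
    second keeps their index. The branch \<open>j = n\<close> comes from the leading term, whose
    coefficient is 1.\<close>
  define g' where "g' j = (if j = 0 then 0 else (g (j - 1))\<^sup>2) +
    (if j = n then lin v n (v n) else (g j)\<^sup>2 * lin v j (v j))" for j
  have sq: "(lin v j x)\<^sup>2 = lin v (Suc j) x + lin v j (v j) * lin v j x" for j x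
    by (simp add: lin_Suc add.assoc add_self del: lin.simps)
  have "x ^ (2 ^ Suc n) = lin v (Suc n) x + (\<Sum>j<Suc n. g' j * lin v j x)" for x
  proof -
    have "x ^ (2 ^ Suc n) = (x ^ (2 ^ n))\<^sup>2" by (simp only: power_Suc power_even_eq)
    also have "\<dots> = (lin v n x)\<^sup>2 + (\<Sum>j<n. (g j)\<^sup>2 * (lin v j x)\<^sup>2)"
      by (simp add: g sq_add sq_sum power_mult_distrib del: lin.simps)
    also have "(\<Sum>j<n. (g j)\<^sup>2 * (lin v j x)\<^sup>2) =
        (\<Sum>j<n. (g j)\<^sup>2 * lin v (Suc j) x) + (\<Sum>j<n. (g j)\<^sup>2 * lin v j (v j) * lin v j x)"
      by (simp add: sq distrib_left sum.distrib mult.assoc del: lin.simps)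
    also have "(\<Sum>j<n. (g j)\<^sup>2 * lin v (Suc j) x) = (\<Sum>j<Suc n. (if j = 0 then 0 else (g (j - 1))\<^sup>2) * lin v j x)"
      by (subst sum.lessThan_Suc_shift) (simp del: lin.simps)
    also have "(lin v n x)\<^sup>2 + ((\<Sum>j<Suc n. (if j = 0 then 0 else (g (j - 1))\<^sup>2) * lin v j x) +
        (\<Sum>j<n. (g j)\<^sup>2 * lin v j (v j) * lin v j x)) =
        lin v (Suc n) x + ((\<Sum>j<Suc n. (if j = 0 then 0 else (g (j - 1))\<^sup>2) * lin v j x) +
        (\<Sum>j<Suc n. (if j = n then lin v n (v n) else (g j)\<^sup>2 * lin v j (v j)) * lin v j x))"
      by (simp add: sq add_ac del: lin.simps)
    also have "\<dots> = lin v (Suc n) x + (\<Sum>j<Suc n. g' j * lin v j x)"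
      by (simp only: sum.distrib[symmetric] distrib_right[symmetric] g'_def)
    finally show ?thesis .
  qed
  then show ?case by blast
qed simp

text \<open>
  The coefficients \<open>g j\<close> of \<open>lin v n x + x ^ 2 ^ n\<close> solve a triangular system with diagonal entries
  \<open>lin v j (v j)\<close> and right-hand sides \<open>v l ^ 2 ^ n \<in> J\<close>; so \<open>dick v n\<close>, the product of the diagonal
  entries, kills them modulo \<open>J\<close>.
\<close>

lemma dick_lin_power:
  assumes "\<And>l. l < n \<Longrightarrow> v l ^ (2 ^ n) \<in> J"
  shows "dick v n * (lin v n x + x ^ (2 ^ n)) \<in> J"
proof -
  obtain g where g: "\<And>x. x ^ (2 ^ n) = lin v n x + (\<Sum>j<n. g j * lin v j x)"
    using power_eq_lin_sum by metis
  have "dick v (Suc j) * g j \<in> J" if "j < n" for j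
    using that
  proof (induction j rule: less_induct)
    case (less j)
    \<comment> \<open>At \<open>x = v j\<close> the leading \<open>lin v n\<close> vanishes, and
      \<open>lin_vanish\<close> cuts the sum off after index \<open>j\<close>, so only
      \<open>g 0, ..., g j\<close> remain.\<close>
    have "(\<Sum>i<n. g i * lin v i (v j)) \<in> J"
      using g[of "v j"] assms[OF less.prems] lin_vanish[OF less.prems] by simp
    also have "(\<Sum>i<n. g i * lin v i (v j)) = (\<Sum>i<Suc j. g i * lin v i (v j))"
      by (rule sum.mono_neutral_right) (use less.prems lin_vanish in \<open>auto simp: not_less\<close>)
    finally have "dick v j * (\<Sum>i<Suc j. g i * lin v i (v j)) \<in> J" by (rule mult_J)
    then have "(\<Sum>i<j. dick v j * g i * lin v i (v j)) + dick v (Suc j) * g j \<in> J"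
      by (simp add: dick_Suc distrib_left sum_distrib_left mult_ac)
    moreover have "(\<Sum>i<j. dick v j * g i * lin v i (v j)) \<in> J"
    proof (rule sum_J)
      fix i assume "i \<in> {..<j}"
      then have i: "i < j" by simp
      then have "dick v (Suc i) dvd dick v j" unfolding dick_def by (intro prod_dvd_prod_subset) auto
      then obtain c where "dick v j = dick v (Suc i) * c" by (elim dvdE)
      moreover have "dick v (Suc i) * g i \<in> J" using less i by simp
      ultimately show "dick v j * g i * lin v i (v j) \<in> J"
        using mult_J[of "dick v (Suc i) * g i" "c * lin v i (v j)"] by (simp add: mult_ac)
    qed
    ultimately show ?case using add_J by (metis add_self2)
  qed
  have "dick v n * (g j * lin v j x) \<in> J" if "j < n" for j
  proof -
    have "dick v (Suc j) dvd dick v n" unfolding dick_def by (intro prod_dvd_prod_subset) (use that in auto)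
    then obtain c where "dick v n = dick v (Suc j) * c" by (elim dvdE)
    then show ?thesis
      using mult_J[OF \<open>\<And>j. j < n \<Longrightarrow> dick v (Suc j) * g j \<in> J\<close>[OF that], of "c * lin v j x"] by (simp add: mult_ac)
  qed
  then have "(\<Sum>j<n. dick v n * (g j * lin v j x)) \<in> J" by (intro sum_J) auto
  moreover have "lin v n x + x ^ (2 ^ n) = (\<Sum>j<n. g j * lin v j x)"
    by (simp add: g add_self2)
  ultimately show ?thesis by (simp add: sum_distrib_left)
qed

text \<open>In \<open>lin_eq_prod\<close> the empty subset gives the factor \<open>x\<close>, and
  the other factors multiply to \<open>dick v n\<close> at \<open>x = 0\<close>.\<close>

lemma lin_factor: "\<exists>c. lin v n x = x * (dick v n + x * c)"
proof (induction n)
  case 0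
  show ?case by (rule exI[of _ 0]) (simp add: dick_def)
next
  case (Suc n)
  then obtain c where c: "lin v n x = x * (dick v n + x * c)" by blast
  show ?case
    unfolding lin.simps dick_Suc c
    by (rule exI[of _ "c * lin v n (v n) + (dick v n + x * c)\<^sup>2"]) (simp add: power2_eq_square algebra_simps)
qed

lemma power_factor: "\<exists>c'. (y + x * c) ^ r = y ^ r + x * (c' :: 'a)"
proof (induction r)
  case (Suc r)
  then obtain c' where c': "(y + x * c) ^ r = y ^ r + x * c'" by blast
  show ?case
    by (rule exI[of _ "c * y ^ r + y * c' + x * c * c'"]) (simp only: power_Suc c', simp add: algebra_simps)
qed (rule exI[of _ 0], simp)

lemma J_power_le: "x ^ e \<in> J \<Longrightarrow> e \<le> e' \<Longrightarrow> x ^ e' * y \<in> J"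
  by (metis le_add_diff_inverse2 mult_J mult.commute power_add)

lemma J_trans: "x + y \<in> J \<Longrightarrow> y + z \<in> J \<Longrightarrow> x + z \<in> J"
  using add_J[of "x + y" "y + z"] by (simp add: add_ac add_self2 add.assoc)

text \<open>Induction splits off the last variable \<open>v n\<close>, which occurs only in its own
  power and in \<open>dick v (Suc n)\<close>, whose exponent is \<open>2 ^ q + r\<close>. In the
  \<open>2 ^ q\<close> part, Frobenius and \<open>dick_lin_power\<close> replace
  \<open>lin v n (v n)\<close> by \<open>v n ^ (2 ^ n)\<close>; in the \<open>r\<close> part each
  factor contributes one \<open>v n\<close>. Together with \<open>b n\<close> this already makes
  \<open>v n ^ d\<close>, so all further multiples of \<open>v n\<close> die. What is left is a
  power of \<open>dick v n\<close>, which joins the factor before it.\<close>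

lemma dick_prod_cong:
  assumes "n > 0" "1 \<le> t"
    and top: "\<mu> (n - 1) + b (n - 1) + t = 2 ^ Suc q"
    and rest: "\<And>j. j < n - 1 \<Longrightarrow> \<mu> j + b j + 2 ^ q = 2 ^ q * 2 ^ (n - j - 2) + t + 2 * b (Suc j)"
    and mono: "\<And>i j. i \<le> j \<Longrightarrow> j < n \<Longrightarrow> b j \<le> b i"
    and small: "\<And>j. 0 < j \<Longrightarrow> j < n \<Longrightarrow> b j + t \<le> 2 ^ q"
    and d: "d + t = 2 ^ (q + n - 1) + 2 ^ q"
    and J: "\<And>l. l < n \<Longrightarrow> v l ^ Suc d \<in> J"
  shows "(\<Prod>j<n. v j ^ b j * dick v (Suc j) ^ \<mu> j) + (\<Prod>j<n. v j ^ d) \<in> J"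
  using assms
proof (induction n arbitrary: q t \<mu> rule: nat_induct_non_zero)
  case 1
  have "b 0 + \<mu> 0 = d" using 1 by simp
  then show ?case by (simp add: dick_def power_add[symmetric] add_self zero_J)
next
  case (Suc n)
  have top: "\<mu> n + b n + t = 2 ^ Suc q" using Suc.prems(2) by simp
  have rest: "\<mu> j + b j + 2 ^ q = 2 ^ q * 2 ^ (n - j - 1) + t + 2 * b (Suc j)" if "j < n" for j
    using Suc.prems(3)[of j] that by simp
  have bt: "b n + t \<le> 2 ^ q" using Suc.prems(5)[of n] Suc.hyps by simp
  define r where "r = 2 ^ q - t - b n"
  have r: "r + t + b n = 2 ^ q" using bt by (simp add: r_def)
  have \<mu>n: "\<mu> n = 2 ^ q + r" using top r by simp
  have d: "d + t = 2 ^ (q + n) + 2 ^ q" using Suc.prems(6) by simp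
  have d': "2 ^ n * 2 ^ q + r + b n = d" using d r by (simp add: power_add mult.commute[of "2 ^ q"])
  define Q where "Q = (\<Prod>j<n. v j ^ b j * dick v (Suc j) ^ \<mu> j)"
  define R where "R = v n ^ b n * dick v (Suc n) ^ r * Q"
  have P: "(\<Prod>j<Suc n. v j ^ b j * dick v (Suc j) ^ \<mu> j) = dick v (Suc n) ^ (2 ^ q) * R"
    by (simp add: Q_def R_def \<mu>n power_add mult_ac)
  \<comment> \<open>An ideal because taking 2^q-th powers is additive. It allows
    \<open>dick_lin_power\<close> to act on the base of a 2^q-th power in the presence of the
    cofactor \<open>R\<close>.\<close>
  interpret J1: char2_ideal "{y. y ^ (2 ^ q) * R \<in> J}"
  proof
    show "(1 :: 'a) + 1 = 0" by (rule two)
    show "0 \<in> {y. y ^ (2 ^ q) * R \<in> J}" by (simp add: zero_J power_0_left)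
    fix x y r
    assume x: "x \<in> {y. y ^ (2 ^ q) * R \<in> J}"
    then show "r * x \<in> {y. y ^ (2 ^ q) * R \<in> J}"
      using mult_J[of "x ^ (2 ^ q) * R" "r ^ (2 ^ q)"] by (simp add: power_mult_distrib mult_ac)
    assume "y \<in> {y. y ^ (2 ^ q) * R \<in> J}"
    with x show "x + y \<in> {y. y ^ (2 ^ q) * R \<in> J}"
      by (simp add: frob_add distrib_right add_J)
  qed
  have "dick v n * (lin v n (v n) + v n ^ (2 ^ n)) \<in> {y. y ^ (2 ^ q) * R \<in> J}"
  proof (rule J1.dick_lin_power)
    fix l assume l: "l < n"
    have "v l ^ r dvd dick v (Suc n) ^ r" using dick_dvd[of l "Suc n" v] l by (simp add: dvd_power_same)
    moreover have "v l ^ (b l + \<mu> l) dvd Q"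
    proof -
      have "v l ^ \<mu> l dvd dick v (Suc l) ^ \<mu> l" using dick_dvd[of l "Suc l" v] by (simp add: dvd_power_same)
      then have "v l ^ (b l + \<mu> l) dvd v l ^ b l * dick v (Suc l) ^ \<mu> l"
        unfolding power_add by (rule mult_dvd_mono[OF dvd_refl])
      also have "\<dots> dvd Q" unfolding Q_def by (rule dvd_prodI) (use l in auto)
      finally show ?thesis .
    qed
    ultimately have "v l ^ r * v l ^ (b l + \<mu> l) dvd R"
      unfolding R_def mult.assoc by (intro dvd_mult mult_dvd_mono)
    then obtain c where c: "R = v l ^ (r + (b l + \<mu> l)) * c" unfolding power_add by (elim dvdE)
    \<comment> \<open>This makes the exponent of \<open>v l\<close> in \<open>R\<close> at least
      2^q. As \<open>t \<ge> 1\<close>, the total 2^(q+n) + 2^q exceeds \<open>d\<close>.\<close>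
    have "b n \<le> b (Suc l)" using Suc.prems(4)[of "Suc l" n] l by simp
    moreover have "(2::nat) ^ q * 2 ^ (n - l - 1) \<ge> 2 ^ q" by simp
    ultimately have "2 ^ q \<le> r + (b l + \<mu> l)"
      using rest[OF l] r by linarith
    then have "Suc d \<le> 2 ^ n * 2 ^ q + (r + (b l + \<mu> l))"
      using d Suc.prems(1) by (simp add: power_add mult.commute)
    then have "v l ^ (2 ^ n * 2 ^ q + (r + (b l + \<mu> l))) * c \<in> J"
      using J_power_le[OF Suc.prems(7)[of l]] l by simp
    then show "v l ^ (2 ^ n) \<in> {y. y ^ (2 ^ q) * R \<in> J}"
      by (simp add: c power_add mult.assoc flip: power_mult)
  qed
  then have "(dick v (Suc n) + dick v n * v n ^ (2 ^ n)) ^ (2 ^ q) * R \<in> J"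
    by (simp add: dick_Suc distrib_left)
  then have s1: "dick v (Suc n) ^ (2 ^ q) * R + (dick v n * v n ^ (2 ^ n)) ^ (2 ^ q) * R \<in> J"
    by (simp add: frob_add distrib_right)
  obtain c where c: "lin v n (v n) = v n * (dick v n + v n * c)" using lin_factor by blast
  obtain c' where c': "(dick v n + v n * c) ^ r = dick v n ^ r + v n * c'" using power_factor by blast
  have "dick v (Suc n) ^ r = dick v n ^ r * v n ^ r * (dick v n ^ r + v n * c')"
    by (simp add: dick_Suc c power_mult_distrib c'[symmetric] mult.assoc)
  then have "(dick v n * v n ^ (2 ^ n)) ^ (2 ^ q) * R =
      dick v n ^ (2 ^ q + r) * v n ^ (2 ^ n * 2 ^ q + r + b n) * (dick v n ^ r + v n * c') * Q"
    by (simp add: R_def power_mult_distrib power_add mult_ac flip: power_mult)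
  also have "\<dots> = dick v n ^ (2 ^ q + 2 * r) * Q * v n ^ d + v n ^ Suc d * (dick v n ^ (2 ^ q + r) * c' * Q)"
    unfolding d' mult_2 by (simp add: algebra_simps power_add)
  finally have "(dick v n * v n ^ (2 ^ n)) ^ (2 ^ q) * R + dick v n ^ (2 ^ q + 2 * r) * Q * v n ^ d \<in> J"
    using J_power_le[OF Suc.prems(7)[of n] order_refl] by (simp add: add_ac add_self2)
  then have s2: "(\<Prod>j<Suc n. v j ^ b j * dick v (Suc j) ^ \<mu> j) + dick v n ^ (2 ^ q + 2 * r) * Q * v n ^ d \<in> J"
    unfolding P using s1 J_trans by blast
  \<comment> \<open>The leftover exponent of \<open>dick v n\<close> is just what turns the
    \<open>rest\<close> equation at \<open>n - 1\<close> into the \<open>top\<close> equation for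
    \<open>Suc q\<close> and \<open>t + 2 ^ q\<close>.\<close>
  define \<mu>' where "\<mu>' = \<mu>(n - 1 := \<mu> (n - 1) + (2 ^ q + 2 * r))"
  obtain n' where n': "n = Suc n'" using Suc.hyps by (cases n) auto
  have Q': "dick v n ^ (2 ^ q + 2 * r) * Q = (\<Prod>j<n. v j ^ b j * dick v (Suc j) ^ \<mu>' j)"
    unfolding Q_def n' by (simp add: \<mu>'_def n' power_add mult_ac)
  have "(\<Prod>j<n. v j ^ b j * dick v (Suc j) ^ \<mu>' j) + (\<Prod>j<n. v j ^ d) \<in> J"
  proof (rule Suc.IH[of "t + 2 ^ q" _ "Suc q"])
    show "1 \<le> t + 2 ^ q" using Suc.prems(1) by simp
    show "\<mu>' (n - 1) + b (n - 1) + (t + 2 ^ q) = 2 ^ Suc (Suc q)"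
      using rest[of "n - 1"] r Suc.hyps by (simp add: \<mu>'_def)
    show "\<mu>' j + b j + 2 ^ Suc q = 2 ^ Suc q * 2 ^ (n - j - 2) + (t + 2 ^ q) + 2 * b (Suc j)"
      if "j < n - 1" for j
    proof -
      have "n - j - 1 = Suc (n - j - 2)" using that by simp
      then show ?thesis using rest[of j] that by (simp add: \<mu>'_def mult_ac add_ac)
    qed
    show "b j \<le> b i" if "i \<le> j" "j < n" for i j using Suc.prems(4) that by simp
    show "b j + (t + 2 ^ q) \<le> 2 ^ Suc q" if "0 < j" "j < n" for j using Suc.prems(5)[of j] that by simp
    show "d + (t + 2 ^ q) = 2 ^ (Suc q + n - 1) + 2 ^ Suc q" using d n' by simp
    show "v l ^ Suc d \<in> J" if "l < n" for l using Suc.prems(7) that by simp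
  qed
  then have "v n ^ d * (dick v n ^ (2 ^ q + 2 * r) * Q + (\<Prod>j<n. v j ^ d)) \<in> J"
    unfolding Q' by (rule mult_J)
  then have "dick v n ^ (2 ^ q + 2 * r) * Q * v n ^ d + (\<Prod>j<Suc n. v j ^ d) \<in> J"
    by (simp add: algebra_simps)
  with s2 show ?case using J_trans by blast
qed

end

section \<open>Cup products on a cubical grid\<close>

text \<open>By default the simplifier unfolds the field operations of \<^typ>\<open>bit\<close> into bit operations.\<close>

declare add_bit_eq_xor [simp del] mult_bit_eq_and [simp del] power_bit_unfold [simp del]
  minus_bit_def [simp del] uminus_bit_def [simp del] bit_not_zero_iff [simp del] bit_not_one_iff [simp del]

section \<open>Parity and counting of occurrences\<close>

lemma even_card_fixpoint_free_involution:
  assumes "finite S" and "\<And>x. x \<in> S \<Longrightarrow> \<iota> x \<in> S" and "\<And>x. x \<in> S \<Longrightarrow> \<iota> (\<iota> x) = x"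
    and "\<And>x. x \<in> S \<Longrightarrow> \<iota> x \<noteq> x"
  shows "even (card S)"
  using assms
proof (induction S rule: finite_psubset_induct)
  case (psubset S)
  show ?case
  proof (cases "S = {}")
    case False
    then obtain x where x: "x \<in> S" by blast
    let ?R = "S - {x, \<iota> x}"
    have "even (card ?R)"
    proof (rule psubset.IH)
      show "?R \<subset> S" using x by blast
      fix y assume y: "y \<in> ?R"
      have "\<iota> y \<noteq> x" "\<iota> y \<noteq> \<iota> x" using y psubset.prems(2) x by (metis Diff_iff insertCI)+
      then show "\<iota> y \<in> ?R" using y psubset.prems(1) by blast
    qed (use psubset.prems in auto)
    moreover have "card S = card ?R + 2"
    proof -
      have "card {x, \<iota> x} = 2" using psubset.prems(3)[OF x] by auto
      moreover have "{x, \<iota> x} \<subseteq> S" using x psubset.prems(1) by blast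
      ultimately show ?thesis using psubset.hyps by (metis card_Diff_subset card_mono finite_subset le_add_diff_inverse2)
    qed
    ultimately show ?thesis by simp
  qed simp
qed

lemma of_nat_bit_even: "even m \<Longrightarrow> (of_nat m :: bit) = 0"
  by (auto elim!: evenE)

lemma bit_add_self [simp]: "(a :: bit) + a = 0"
  by (cases a) auto

text \<open>\<open>m\<close> is the place where the value \<open>i\<close> occurs for the (l + 1)-st
  time.\<close>

lemma card_fiber_hit:
  fixes \<phi> :: "nat \<Rightarrow> nat"
  shows "l < card {j. j < N \<and> \<phi> j = i} \<Longrightarrow> \<exists>m<N. \<phi> m = i \<and> card {j. j < m \<and> \<phi> j = i} = l"
proof (induction N)
  case (Suc N)
  have eq: "{j. j < Suc N \<and> \<phi> j = i} = (if \<phi> N = i then insert N {j. j < N \<and> \<phi> j = i} else {j. j < N \<and> \<phi> j = i})"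
    by (auto simp: less_Suc_eq)
  show ?case
  proof (cases "l < card {j. j < N \<and> \<phi> j = i}")
    case True
    then show ?thesis using Suc.IH less_SucI by blast
  next
    case False
    then have "\<phi> N = i \<and> l = card {j. j < N \<and> \<phi> j = i}" using Suc.prems by (auto simp: eq split: if_splits)
    then show ?thesis by blast
  qed
qed simp

lemma card_fiber_mono:
  fixes \<phi> :: "nat \<Rightarrow> nat"
  assumes "m < m'" "\<phi> m = i"
  shows "card {j. j < m \<and> \<phi> j = i} < card {j. j < m' \<and> \<phi> j = i}"
  proof (rule psubset_card_mono)
  have "m \<in> {j. j < m' \<and> \<phi> j = i}" "m \<notin> {j. j < m \<and> \<phi> j = i}" using assms by auto
  then show "{j. j < m \<and> \<phi> j = i} \<subset> {j. j < m' \<and> \<phi> j = i}" using assms(1) by fastforce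
qed simp

lemma sum_card_fiber:
  fixes \<phi> :: "nat \<Rightarrow> nat"
  assumes "\<And>j. j < N \<Longrightarrow> \<phi> j \<in> I" "finite I"
  shows "(\<Sum>i\<in>I. card {j. j < N \<and> \<phi> j = i}) = N"
proof -
  have "card (\<Union>i\<in>I. {j. j < N \<and> \<phi> j = i}) = (\<Sum>i\<in>I. card {j. j < N \<and> \<phi> j = i})"
    by (rule card_UN_disjoint) (use assms in auto)
  moreover have "(\<Union>i\<in>I. {j. j < N \<and> \<phi> j = i}) = {..<N}" using assms by auto
  ultimately show ?thesis by simp
qed

datatype idx = Ix (fac: nat) (pos: nat)

type_synonym pt = "idx \<Rightarrow> int"

text \<open>
  A finite model of the \<open>k\<close>-fold product of the boundary of a \<open>(d + 1)\<close>-dimensional cube, subdivided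
  into cubes: the even integers are the vertices and the odd ones the edges of a subdivided line, so
  that \<open>cov\<close> is the covering relation of the face poset and \<open>rank\<close> is the dimension of a face.
  The index \<open>Ix i l\<close> stands for coordinate \<open>l\<close> of factor \<open>i\<close>.
\<close>

locale cube_grid =
  fixes k d n :: nat
  assumes n_pos: "n > 0"
begin

definition E :: "idx set" where "E = {e. fac e \<in> {1..k} \<and> pos e \<le> d}"

definition X :: "pt set" where
  "X = {x. (\<forall>e. e \<notin> E \<longrightarrow> x e = 0) \<and> (\<forall>e\<in>E. \<bar>x e\<bar> \<le> 2 * int n) \<and>
           (\<forall>i\<in>{1..k}. \<exists>l\<le>d. \<bar>x (Ix i l)\<bar> = 2 * int n)}"

definition cov :: "pt \<Rightarrow> pt \<Rightarrow> bool" where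
  "cov x y \<longleftrightarrow> (\<exists>e\<in>E. even (x e) \<and> (y = x(e := x e + 1) \<or> y = x(e := x e - 1)))"

definition rank :: "pt \<Rightarrow> nat" where "rank x = card {e\<in>E. odd (x e)}"

definition low :: "pt \<Rightarrow> pt set" where "low y = {x\<in>X. cov x y}"
definition up :: "pt \<Rightarrow> pt set" where "up x = {y\<in>X. cov x y}"

definition flip :: "nat set \<Rightarrow> pt \<Rightarrow> pt" where
  "flip g x = (\<lambda>e. if fac e \<in> g then - x e else x e)"

text \<open>An everywhere defined sign that the negation of factor \<open>i\<close> switches, since
  the last nonzero coordinate keeps its position; the bit 1 stands for negative. Its coboundary
  represents the class u_i of the quotient.\<close>

definition sg :: "nat \<Rightarrow> pt \<Rightarrow> bit" where
  "sg i x = of_bool (x (Ix i (Max {l. l \<le> d \<and> x (Ix i l) \<noteq> 0})) < 0)"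

section \<open>Incidences between the faces of the grid\<close>

lemma E_eq: "E = (\<lambda>(i, l). Ix i l) ` ({1..k} \<times> {..d})"
proof -
  have "e \<in> (\<lambda>(i, l). Ix i l) ` ({1..k} \<times> {..d})" if "e \<in> E" for e
    by (rule image_eqI[of _ _ "(fac e, pos e)"]) (use that in \<open>auto simp: E_def\<close>)
  then show ?thesis by (auto simp: E_def)
qed

lemma finite_E [simp]: "finite E" by (simp add: E_eq)

lemma card_E: "card E = k * Suc d"
  unfolding E_eq by (subst card_image) (auto simp: inj_on_def card_cartesian_product)

lemma X_ext: "x \<in> X \<Longrightarrow> i \<in> {1..k} \<Longrightarrow> \<exists>l\<le>d. \<bar>x (Ix i l)\<bar> = 2 * int n"
  unfolding X_def by blast

lemma finite_X [simp]: "finite X"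
proof (rule finite_subset)
  show "X \<subseteq> {f. \<forall>e. (e \<in> E \<longrightarrow> f e \<in> {- 2 * int n..2 * int n}) \<and> (e \<notin> E \<longrightarrow> f e = 0)}"
    by (force simp: X_def abs_le_iff)
  show "finite \<dots>" by (rule finite_set_of_finite_funs) simp_all
qed

lemma finite_low [simp]: "finite (low x)" and finite_up [simp]: "finite (up x)"
  by (simp_all add: low_def up_def)

lemma low_up_iff: "x \<in> X \<Longrightarrow> y \<in> X \<Longrightarrow> x \<in> low y \<longleftrightarrow> y \<in> up x"
  by (simp add: low_def up_def)

lemma X_low: "x \<in> low y \<Longrightarrow> x \<in> X" and X_up: "y \<in> up x \<Longrightarrow> y \<in> X"
  by (simp_all add: low_def up_def)

lemma cov_rank: assumes "cov x y" shows "rank y = Suc (rank x)"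
proof -
  obtain e where e: "e \<in> E" "even (x e)" "y = x(e := x e + 1) \<or> y = x(e := x e - 1)"
    using assms by (auto simp: cov_def)
  have "{a\<in>E. odd (y a)} = insert e {a\<in>E. odd (x a)}" using e by (auto split: if_splits)
  then show ?thesis using e(2) by (simp add: rank_def)
qed

lemma X_odd_bound:
  assumes "y \<in> X" "odd (y e)" shows "\<bar>y e\<bar> < 2 * int n" "e \<in> E"
proof -
  show E: "e \<in> E" using assms by (metis (mono_tags, lifting) X_def even_zero mem_Collect_eq)
  have "\<bar>y e\<bar> \<noteq> 2 * int n" using assms(2) by (metis dvd_abs_iff dvd_triv_left)
  then show "\<bar>y e\<bar> < 2 * int n" using assms E by (force simp: X_def)
qed

text \<open>An odd coordinate is never extreme, so every factor keeps its extreme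
  coordinate.\<close>

lemma X_change_odd:
  assumes y: "y \<in> X" and e: "odd (y e)" and v: "\<bar>v - y e\<bar> \<le> 1"
  shows "y(e := v) \<in> X"
proof -
  note b = X_odd_bound[OF y e]
  have "\<exists>l\<le>d. \<bar>(y(e := v)) (Ix i l)\<bar> = 2 * int n" if i: "i \<in> {1..k}" for i
  proof -
    obtain l where l: "l \<le> d" "\<bar>y (Ix i l)\<bar> = 2 * int n" using X_ext[OF y i] by blast
    then have "(Ix i l) \<noteq> e" using b by auto
    then show ?thesis using l by auto
  qed
  moreover have "\<bar>v\<bar> \<le> 2 * int n" using b v by linarith
  ultimately show ?thesis using y b by (auto simp: X_def)
qed

lemma cov_down: assumes "y \<in> X" "cov x y" shows "x \<in> X"
proof -
  obtain e where e: "e \<in> E" "even (x e)" "y = x(e := x e + 1) \<or> y = x(e := x e - 1)"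
    using assms by (auto simp: cov_def)
  have "x = y(e := x e)" using e(3) by auto
  moreover have "odd (y e)" "\<bar>x e - y e\<bar> \<le> 1" using e by auto
  ultimately show ?thesis using X_change_odd[OF assms(1)] by metis
qed

lemma low_eq: "y \<in> X \<Longrightarrow> low y = {x. cov x y}"
  using cov_down by (auto simp: low_def)

text \<open>The facets of a cube come in opposite pairs, exchanged by the reflection in its centre
  \<open>y\<close>.\<close>

lemma even_card_low:
  assumes "y \<in> X" shows "even (card (low y))"
proof (rule even_card_fixpoint_free_involution[where \<iota> = "\<lambda>x e. 2 * y e - x e"])
  fix x assume "x \<in> low y"
  then have "cov x y" by (simp add: low_def)
  then obtain e where e: "e \<in> E" "even (x e)" "y = x(e := x e + 1) \<or> y = x(e := x e - 1)"
    by (auto simp: cov_def)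
  have "cov (\<lambda>e. 2 * y e - x e) y"
    unfolding cov_def by (rule bexI[of _ e]) (use e in \<open>auto simp: fun_eq_iff\<close>)
  then show "(\<lambda>e. 2 * y e - x e) \<in> low y" using low_eq[OF assms] by simp
  show "(\<lambda>e. 2 * y e - x e) \<noteq> x"
  proof
    assume "(\<lambda>e. 2 * y e - x e) = x"
    from fun_cong[OF this, of e] have "2 * y e - x e = x e" by simp
    then show False using e(3) by (auto split: if_splits)
  qed
qed simp_all

text \<open>Two covering steps change two different coordinates, and the involution exchanges their
  order. Hence the boundary of a boundary vanishes mod 2.\<close>

lemma even_card_diamond:
  assumes "y \<in> X" shows "even (card {x. cov z x \<and> cov x y})"
proof (rule even_card_fixpoint_free_involution[where \<iota> = "\<lambda>x e. z e + y e - x e"])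
  show "finite {x. cov z x \<and> cov x y}"
    by (rule finite_subset[OF _ finite_low[of y]]) (use low_eq[OF assms] in auto)
  fix x assume "x \<in> {x. cov z x \<and> cov x y}"
  then obtain e e' where e: "e \<in> E" "even (z e)" "x = z(e := z e + 1) \<or> x = z(e := z e - 1)"
    and e': "e' \<in> E" "even (x e')" "y = x(e' := x e' + 1) \<or> y = x(e' := x e' - 1)"
    by (auto simp: cov_def)
  have ne: "e' \<noteq> e" using e e' by auto
  have "cov z (\<lambda>e. z e + y e - x e)"
    unfolding cov_def by (rule bexI[of _ e']) (use e e' ne in \<open>auto simp: fun_eq_iff\<close>)
  moreover have "cov (\<lambda>e. z e + y e - x e) y"
    unfolding cov_def by (rule bexI[of _ e]) (use e e' ne in \<open>auto simp: fun_eq_iff\<close>)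
  ultimately show "(\<lambda>e. z e + y e - x e) \<in> {x. cov z x \<and> cov x y}" by simp
  show "(\<lambda>e. z e + y e - x e) \<noteq> x"
  proof
    assume "(\<lambda>e. z e + y e - x e) = x"
    from fun_cong[OF this, of e] have "z e + y e - x e = x e" by simp
    then show False using e(3) e'(3) ne by (auto split: if_splits)
  qed
qed simp

text \<open>A face of codimension one lies in exactly two top faces. It has k + 1 even coordinates
  and each factor has an extreme one, so one factor \<open>i0\<close> has two even coordinates and
  every other factor one. If both are extreme, two facets of the boundary cube meet, and each of the
  two coordinates can only move inwards; otherwise only the coordinate that is not extreme can move,
  in both directions.\<close>

lemma even_card_up:
  assumes x: "x \<in> X" and r: "Suc (rank x) = k * d"
  shows "even (card (up x))"
proof -
  define V where "V i = {l. l \<le> d \<and> even (x (Ix i l))}" for i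
  define ext where "ext i l \<longleftrightarrow> \<bar>x (Ix i l)\<bar> = 2 * int n" for i l
  have finV [simp]: "finite (V i)" for i by (simp add: V_def)
  have extV: "\<exists>l\<in>V i. ext i l" if "i \<in> {1..k}" for i
  proof -
    obtain l where l: "l \<le> d" "\<bar>x (Ix i l)\<bar> = 2 * int n" using X_ext[OF x \<open>i \<in> {1..k}\<close>] by blast
    then have "even (x (Ix i l))" by (metis dvd_abs_iff dvd_triv_left)
    then show ?thesis using l by (auto simp: V_def ext_def)
  qed
  have V1: "1 \<le> card (V i)" if "i \<in> {1..k}" for i
    using extV[OF that] finV[of i] by (metis card_0_eq empty_iff less_one linorder_not_le)
  have "{e\<in>E. odd (x e)} \<union> (\<lambda>(i, l). Ix i l) ` Sigma {1..k} V = E" "{e\<in>E. odd (x e)} \<inter> (\<lambda>(i, l). Ix i l) ` Sigma {1..k} V = {}"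
    by (auto simp: E_eq V_def)
  then have "card E = rank x + card ((\<lambda>(i, l). Ix i l) ` Sigma {1..k} V)"
    unfolding rank_def by (metis card_Un_disjoint finite_E finite_Un)
  also have "card ((\<lambda>(i, l). Ix i l) ` Sigma {1..k} V) = card (Sigma {1..k} V)"
    by (rule card_image) (auto simp: inj_on_def)
  finally have "card E = rank x + card (Sigma {1..k} V)" .
  then have sumV: "(\<Sum>i\<in>{1..k}. card (V i)) = k + 1"
    using r by (simp add: card_E algebra_simps)
  have "\<exists>i0\<in>{1..k}. card (V i0) \<noteq> 1"
  proof (rule ccontr)
    assume "\<not> ?thesis"
    then have "(\<Sum>i\<in>{1..k}. card (V i)) = (\<Sum>i\<in>{1..k}. 1)" by (intro sum.cong) auto
    then show False using sumV by simp
  qed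
  then obtain i0 where i0: "i0 \<in> {1..k}" "card (V i0) \<noteq> 1" by blast
  have sum2: "card (V i0) + (\<Sum>i\<in>{1..k} - {i0}. card (V i)) = k + 1"
    using sumV i0 by (simp add: sum.remove)
  have "(\<Sum>i\<in>{1..k} - {i0}. 1) \<le> (\<Sum>i\<in>{1..k} - {i0}. card (V i))"
    by (rule sum_mono) (use V1 in auto)
  then have c2: "card (V i0) = 2" and rest: "(\<Sum>i\<in>{1..k} - {i0}. card (V i)) = k - 1"
    using sum2 i0 V1[OF i0(1)] by auto
  have c1: "card (V i) = 1" if i: "i \<in> {1..k}" "i \<noteq> i0" for i
  proof (rule ccontr)
    assume "card (V i) \<noteq> 1"
    then have "2 \<le> card (V i)" using V1[OF i(1)] by linarith
    moreover have "(\<Sum>j\<in>{1..k} - {i0} - {i}. 1) \<le> (\<Sum>j\<in>{1..k} - {i0} - {i}. card (V j))"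
      by (rule sum_mono) (use V1 in auto)
    moreover have "(\<Sum>j\<in>{1..k} - {i0}. card (V j)) = card (V i) + (\<Sum>j\<in>{1..k} - {i0} - {i}. card (V j))"
      by (rule sum.remove) (use i in auto)
    ultimately show False using rest i i0 by simp
  qed
  obtain l1 where l1: "l1 \<in> V i0" "ext i0 l1" using extV[OF i0(1)] by blast
  obtain l2 where l2: "V i0 = {l1, l2}" "l1 \<noteq> l2"
    using c2 l1(1) by (metis card_2_iff insert_iff empty_iff doubleton_eq_iff)
  have inE: "(Ix i0 l1) \<in> E" "(Ix i0 l2) \<in> E" "even (x (Ix i0 l1))" "even (x (Ix i0 l2))"
    using i0 l2 unfolding E_def V_def by auto
  have upD: "y = x((Ix i0 l1) := x (Ix i0 l1) + 1) \<or> y = x((Ix i0 l1) := x (Ix i0 l1) - 1) \<or>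
      y = x((Ix i0 l2) := x (Ix i0 l2) + 1) \<or> y = x((Ix i0 l2) := x (Ix i0 l2) - 1)" if "y \<in> up x" for y
  proof -
    have yX: "y \<in> X" using that by (simp add: up_def)
    from that obtain e0 where e0: "e0 \<in> E" "even (x e0)" "y = x(e0 := x e0 + 1) \<or> y = x(e0 := x e0 - 1)"
      by (auto simp: up_def cov_def)
    obtain i l where "e0 = Ix i l" by (cases e0)
    note e = e0(1,2)[unfolded this] and y = e0(3)[unfolded this]
    have "i = i0"
    proof (rule ccontr)
      assume ne: "i \<noteq> i0"
      have i: "i \<in> {1..k}" "l \<in> V i" using e by (auto simp: E_def V_def)
      then have Vi: "V i = {l}" using c1[OF i(1) ne] by (metis card_1_singletonE singletonD)
      obtain l' where l': "l' \<le> d" "\<bar>y (Ix i l')\<bar> = 2 * int n" using X_ext[OF yX i(1)] by blast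
      then have ev: "even (y (Ix i l'))" by (metis dvd_abs_iff dvd_triv_left)
      have "l' \<noteq> l" using ev y e by auto
      then have "l' \<in> V i" using ev y l' by (auto simp: V_def)
      then show False using Vi \<open>l' \<noteq> l\<close> by blast
    qed
    moreover have "l \<in> {l1, l2}" using e \<open>i = i0\<close> l2 by (auto simp: E_def V_def)
    ultimately show ?thesis using y by auto
  qed
  have upI: "x((Ix i0 l) := v) \<in> up x"
    if l: "l \<in> {l1, l2}" and v: "v = x (Ix i0 l) + 1 \<or> v = x (Ix i0 l) - 1" "\<bar>v\<bar> \<le> 2 * int n"
      and o: "ext i0 (if l = l1 then l2 else l1)" for l v
  proof -
    have "\<exists>l'\<le>d. \<bar>(x((Ix i0 l) := v)) (Ix i l')\<bar> = 2 * int n" if i: "i \<in> {1..k}" for i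
    proof (cases "i = i0")
      case True
      then show ?thesis using o l2 l unfolding ext_def V_def
        by (intro exI[of _ "if l = l1 then l2 else l1"]) auto
    next
      case False
      then show ?thesis using X_ext[OF x i] by auto
    qed
    then have "x((Ix i0 l) := v) \<in> X" using x v(2) inE l by (auto simp: X_def)
    moreover have "cov x (x((Ix i0 l) := v))" unfolding cov_def
      using inE l v by (intro bexI[of _ "(Ix i0 l)"]) auto
    ultimately show ?thesis by (simp add: up_def)
  qed
  have upB: "\<bar>y e\<bar> \<le> 2 * int n" if "y \<in> up x" for y e
    using that by (cases "e \<in> E") (auto simp: up_def X_def)
  define inw where "inw l = (if x (Ix i0 l) > 0 then x (Ix i0 l) - 1 else x (Ix i0 l) + 1)" for l
  have inw: "y = x((Ix i0 l) := inw l)"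
    if "y \<in> up x" "ext i0 l" "y = x((Ix i0 l) := x (Ix i0 l) + 1) \<or> y = x((Ix i0 l) := x (Ix i0 l) - 1)" for y l
    using upB[OF that(1), of "(Ix i0 l)"] that(2,3) n_pos by (auto simp: ext_def inw_def)
  have inwb: "\<bar>inw l\<bar> \<le> 2 * int n" if "ext i0 l" for l
    using that n_pos by (auto simp: ext_def inw_def)
  show ?thesis
  proof (cases "ext i0 l2")
    case True
    have "up x = {x((Ix i0 l1) := inw l1), x((Ix i0 l2) := inw l2)}" (is "_ = ?R")
    proof
      show "up x \<subseteq> ?R"
      proof
        fix y assume y: "y \<in> up x"
        show "y \<in> ?R" using upD[OF y] inw[OF y l1(2)] inw[OF y True] by blast
      qed
      show "?R \<subseteq> up x" using upI[of l1 "inw l1"] upI[of l2 "inw l2"] l1 l2 True inwb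
        by (auto simp: inw_def)
    qed
    moreover have "x((Ix i0 l1) := inw l1) \<noteq> x((Ix i0 l2) := inw l2)"
      using l2(2) by (auto simp: inw_def fun_eq_iff)
    ultimately show ?thesis by simp
  next
    case False
    have b: "\<bar>x (Ix i0 l2)\<bar> < 2 * int n" using False x inE by (force simp: ext_def X_def)
    have no: "y \<noteq> x((Ix i0 l1) := v)" if "y \<in> up x" "odd v" for y v
    proof
      assume y: "y = x((Ix i0 l1) := v)"
      have yX: "y \<in> X" using that by (simp add: up_def)
      then obtain l' where l': "l' \<le> d" "\<bar>y (Ix i0 l')\<bar> = 2 * int n" using X_ext[OF yX i0(1)] by blast
      then have ev: "even (y (Ix i0 l'))" by (metis dvd_abs_iff dvd_triv_left)
      then have ne: "l' \<noteq> l1" using y that by auto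
      then have "l' \<in> V i0" using ev y l' by (auto simp: V_def)
      then have "l' = l2" using ne l2 by blast
      then show False using l' y ne b by auto
    qed
    have "up x = {x((Ix i0 l2) := x (Ix i0 l2) + 1), x((Ix i0 l2) := x (Ix i0 l2) - 1)}" (is "_ = ?R")
    proof
      show "up x \<subseteq> ?R"
      proof
        fix y assume y: "y \<in> up x"
        show "y \<in> ?R" using upD[OF y] no[OF y] inE by auto
      qed
      show "?R \<subseteq> up x"
        using upI[of l2 "x (Ix i0 l2) + 1"] upI[of l2 "x (Ix i0 l2) - 1"] l1 l2 b by auto
    qed
    moreover have "x((Ix i0 l2) := x (Ix i0 l2) + 1) \<noteq> x((Ix i0 l2) := x (Ix i0 l2) - 1)"
      by (auto simp: fun_eq_iff)
    ultimately show ?thesis by simp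
  qed
qed

section \<open>The group of sign changes and a fundamental domain\<close>

lemma flip_flip [simp]: "flip g (flip g x) = x"
  by (auto simp: flip_def)

lemma flip_empty [simp]: "flip {} x = x"
  by (simp add: flip_def)

lemma flip_X: "x \<in> X \<Longrightarrow> flip g x \<in> X"
  by (auto simp: X_def flip_def)

lemma flip_X_iff [simp]: "flip g x \<in> X \<longleftrightarrow> x \<in> X"
  by (metis flip_X flip_flip)

lemma flip_cov: assumes "cov x y" shows "cov (flip g x) (flip g y)"
proof -
  obtain e where e: "e \<in> E" "even (x e)" "y = x(e := x e + 1) \<or> y = x(e := x e - 1)"
    using assms by (auto simp: cov_def)
  then show ?thesis
    unfolding cov_def by (intro bexI[of _ e]) (auto simp: flip_def fun_eq_iff)
qed

lemma flip_cov_iff [simp]: "cov (flip g x) (flip g y) \<longleftrightarrow> cov x y"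
  by (metis flip_cov flip_flip)

lemma flip_rank [simp]: "rank (flip g x) = rank x"
  by (auto simp: rank_def flip_def intro!: arg_cong[of _ _ card])

lemma flip_low [simp]: "flip g x \<in> low (flip g y) \<longleftrightarrow> x \<in> low y"
  and flip_up [simp]: "flip g x \<in> up (flip g y) \<longleftrightarrow> x \<in> up y"
  by (simp_all add: low_def up_def)

lemma sum_low_flip: "(\<Sum>z\<in>low (flip g x). h z) = (\<Sum>z\<in>low x. h (flip g z))"
  by (rule sum.reindex_bij_witness[of _ "flip g" "flip g"]) (auto, metis flip_flip flip_low)

lemma greatest_nonzero:
  assumes x: "x \<in> X" and i: "i \<in> {1..k}"
  defines "M \<equiv> Max {l. l \<le> d \<and> x (Ix i l) \<noteq> 0}"
  shows "M \<le> d" "x (Ix i M) \<noteq> 0" "\<And>l. l \<le> d \<Longrightarrow> x (Ix i l) \<noteq> 0 \<Longrightarrow> l \<le> M"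
proof -
  let ?S = "{l. l \<le> d \<and> x (Ix i l) \<noteq> 0}"
  have fin: "finite ?S" by simp
  obtain l where "l \<le> d" "\<bar>x (Ix i l)\<bar> = 2 * int n" using X_ext[OF x i] by blast
  then have "l \<in> ?S" using n_pos by auto
  then have "M \<in> ?S" unfolding M_def using Max_in[OF fin] by blast
  then show "M \<le> d" "x (Ix i M) \<noteq> 0" by auto
  show "\<And>l. l \<le> d \<Longrightarrow> x (Ix i l) \<noteq> 0 \<Longrightarrow> l \<le> M"
    unfolding M_def using Max_ge[OF fin] by blast
qed

lemma sg_flip:
  assumes "x \<in> X" "i \<in> {1..k}"
  shows "sg i (flip g x) = sg i x + of_bool (i \<in> g)"
proof -
  define M where "M = Max {l. l \<le> d \<and> x (Ix i l) \<noteq> 0}"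
  have "(flip g x (Ix i l) \<noteq> 0) = (x (Ix i l) \<noteq> 0)" for l by (simp add: flip_def)
  then have "sg i (flip g x) = of_bool (flip g x (Ix i M) < 0)" by (simp add: sg_def M_def)
  moreover have "x (Ix i M) \<noteq> 0" using greatest_nonzero(2)[OF assms] by (simp add: M_def)
  ultimately show ?thesis by (auto simp: sg_def M_def[symmetric] flip_def)
qed

text \<open>The sign vectors of the points are used to choose one point in each orbit.\<close>

definition nrm :: "pt \<Rightarrow> nat set" where "nrm x = {i\<in>{1..k}. sg i x \<noteq> 0}"

definition dom :: "nat \<Rightarrow> pt set" where "dom j = {x\<in>X. rank x = j \<and> nrm x = {}}"

lemma finite_dom [simp]: "finite (dom j)" by (simp add: dom_def)

lemma nrm_sub: "nrm x \<subseteq> {1..k}" by (auto simp: nrm_def)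

lemma nrm_flip: "x \<in> X \<Longrightarrow> g \<subseteq> {1..k} \<Longrightarrow> nrm x = {} \<Longrightarrow> nrm (flip g x) = g"
  by (auto simp: nrm_def sg_flip)

lemma nrm_flip_self: assumes "x \<in> X" shows "nrm (flip (nrm x) x) = {}"
proof -
  have "sg i (flip (nrm x) x) = 0" if "i \<in> {1..k}" for i
    using that by (cases "sg i x") (auto simp: sg_flip[OF assms] nrm_def)
  then show ?thesis by (auto simp: nrm_def)
qed

section \<open>Cochains on the quotient and their cup products\<close>

definition invar :: "(pt \<Rightarrow> bit) \<Rightarrow> bool" where
  "invar f \<longleftrightarrow> (\<forall>g\<subseteq>{1..k}. \<forall>x\<in>X. f (flip g x) = f x)"

definition invar2 :: "(pt \<Rightarrow> pt \<Rightarrow> bit) \<Rightarrow> bool" where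
  "invar2 f \<longleftrightarrow> (\<forall>g\<subseteq>{1..k}. \<forall>x\<in>X. \<forall>y\<in>X. f (flip g x) (flip g y) = f x y)"

lemma invarD: "invar f \<Longrightarrow> g \<subseteq> {1..k} \<Longrightarrow> x \<in> X \<Longrightarrow> f (flip g x) = f x"
  by (simp add: invar_def)

lemma invar2D:
  "invar2 f \<Longrightarrow> g \<subseteq> {1..k} \<Longrightarrow> x \<in> X \<Longrightarrow> y \<in> X \<Longrightarrow> f (flip g x) (flip g y) = f x y"
  by (simp add: invar2_def)

text \<open>Both sides sum over the orbits of covering pairs. The action is free, and an orbit can
  be represented by the pair whose upper member is normalised or by the one whose lower member
  is.\<close>

lemma sum_dom_swap:
  assumes F: "invar2 F"
  shows "(\<Sum>x\<in>dom (Suc j). \<Sum>z\<in>low x. F z x) = (\<Sum>z\<in>dom j. \<Sum>x\<in>up z. F z x)"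
proof -
  have "(\<Sum>x\<in>dom (Suc j). \<Sum>z\<in>low x. F z x) = (\<Sum>(x, z)\<in>Sigma (dom (Suc j)) low. F z x)"
    by (simp add: sum.Sigma)
  also have "\<dots> = (\<Sum>(z, x)\<in>Sigma (dom j) up. F z x)"
  proof (rule sum.reindex_bij_witness[of _ "\<lambda>(z, x). (flip (nrm x) x, flip (nrm x) z)"
        "\<lambda>(x, z). (flip (nrm z) z, flip (nrm z) x)"], goal_cases)
    case (1 a)
    then obtain x z where [simp]: "a = (x, z)" and x: "x \<in> dom (Suc j)" and z: "z \<in> low x" by auto
    have X: "x \<in> X" "z \<in> X" and n: "nrm x = {}" using x z by (auto simp: dom_def X_low)
    then show ?case using nrm_flip[OF X(1) nrm_sub n] by simp
  next
    case (2 a)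
    then obtain x z where [simp]: "a = (x, z)" and x: "x \<in> dom (Suc j)" and z: "z \<in> low x" by auto
    have X: "x \<in> X" "z \<in> X" using x z by (auto simp: dom_def X_low)
    have "rank x = Suc (rank z)" using z cov_rank by (simp add: low_def)
    then show ?case using x z X by (auto simp: dom_def nrm_flip_self low_up_iff)
  next
    case (3 b)
    then obtain x z where [simp]: "b = (z, x)" and z: "z \<in> dom j" and x: "x \<in> up z" by auto
    have X: "x \<in> X" "z \<in> X" and n: "nrm z = {}" using x z by (auto simp: dom_def X_up)
    then show ?case using nrm_flip[OF X(2) nrm_sub n] by simp
  next
    case (4 b)
    then obtain x z where [simp]: "b = (z, x)" and z: "z \<in> dom j" and x: "x \<in> up z" by auto
    have X: "x \<in> X" "z \<in> X" using x z by (auto simp: dom_def X_up)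
    have "rank x = Suc (rank z)" using x cov_rank by (simp add: up_def)
    then show ?case using x z X by (auto simp: dom_def nrm_flip_self low_up_iff)
  next
    case (5 a)
    then obtain x z where [simp]: "a = (x, z)" and x: "x \<in> dom (Suc j)" and z: "z \<in> low x" by auto
    have X: "x \<in> X" "z \<in> X" using x z by (auto simp: dom_def X_low)
    then show ?case using invar2D[OF F nrm_sub] by simp
  qed
  also have "\<dots> = (\<Sum>z\<in>dom j. \<Sum>x\<in>up z. F z x)"
    by (simp add: sum.Sigma)
  finally show ?thesis .
qed

text \<open>
  \<open>A w j x\<close> is the sum over all chains of \<open>j\<close> covering steps ending in \<open>x\<close> of the product of the
  values of the cochains \<open>w 0, \<dots>, w (j - 1)\<close> on the steps; \<open>B\<close> is its counterpart for the chains
  starting in \<open>x\<close>. Hence \<open>T w\<close> evaluates the cup product of the \<open>w j\<close> on the fundamental class of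
  the quotient by the sign changes.
\<close>

fun A :: "(nat \<Rightarrow> pt \<Rightarrow> pt \<Rightarrow> bit) \<Rightarrow> nat \<Rightarrow> pt \<Rightarrow> bit" where
  "A w 0 x = 1"
| "A w (Suc j) x = (\<Sum>z\<in>low x. A w j z * w j z x)"

fun B :: "(nat \<Rightarrow> pt \<Rightarrow> pt \<Rightarrow> bit) \<Rightarrow> nat \<Rightarrow> pt \<Rightarrow> bit" where
  "B w 0 x = 1"
| "B w (Suc m) x = (\<Sum>y\<in>up x. w (k * d - Suc m) x y * B w m y)"

definition T :: "(nat \<Rightarrow> pt \<Rightarrow> pt \<Rightarrow> bit) \<Rightarrow> bit" where
  "T w = (\<Sum>x\<in>dom (k * d). A w (k * d) x)"

definition cob :: "(pt \<Rightarrow> bit) \<Rightarrow> pt \<Rightarrow> pt \<Rightarrow> bit" where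
  "cob s x y = s x + s y"

lemma sum_up_flip: "(\<Sum>z\<in>up (flip g x). h z) = (\<Sum>z\<in>up x. h (flip g z))"
  by (rule sum.reindex_bij_witness[of _ "flip g" "flip g"]) (auto, metis flip_flip flip_up)

lemma A_flip:
  assumes "\<And>i. i < j \<Longrightarrow> invar2 (w i)" "g \<subseteq> {1..k}" "x \<in> X"
  shows "A w j (flip g x) = A w j x"
  using assms
proof (induction j arbitrary: x)
  case (Suc j)
  then show ?case by (auto simp: sum_low_flip X_low invar2D intro!: sum.cong)
qed simp

lemma B_flip:
  assumes "\<And>i. i < k * d \<Longrightarrow> invar2 (w i)" "g \<subseteq> {1..k}" "x \<in> X" "m \<le> k * d"
  shows "B w m (flip g x) = B w m x"
  using assms
proof (induction m arbitrary: x)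
  case (Suc m)
  then show ?case by (auto simp: sum_up_flip X_up invar2D intro!: sum.cong)
qed simp

lemma A_cong: "(\<And>i. i < j \<Longrightarrow> w i = w' i) \<Longrightarrow> A w j x = A w' j x"
  by (induction j arbitrary: x) auto

lemma B_cong:
  "(\<And>i. k * d - m \<le> i \<Longrightarrow> i < k * d \<Longrightarrow> w i = w' i) \<Longrightarrow> m \<le> k * d \<Longrightarrow> B w m x = B w' m x"
proof (induction m arbitrary: x)
  case (Suc m)
  have "w (k * d - Suc m) = w' (k * d - Suc m)" using Suc.prems by auto
  moreover have "B w m y = B w' m y" for y by (rule Suc.IH) (use Suc.prems in auto)
  ultimately show ?case by simp
qed simp

lemma sum_diamond_swap_low:
  assumes y: "y \<in> X"
  shows "(\<Sum>x\<in>low y. \<Sum>z\<in>low x. h z) = (0 :: bit)"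
proof -
  have "(\<Sum>x\<in>low y. \<Sum>z\<in>low x. h z) = (\<Sum>x\<in>low y. \<Sum>z | z \<in> X \<and> cov z x. h z)"
    by (simp add: low_def)
  also have "\<dots> = (\<Sum>z\<in>X. \<Sum>x | x \<in> low y \<and> cov z x. h z)"
    by (rule sum.swap_restrict) simp_all
  also have "\<dots> = (\<Sum>z\<in>X. of_nat (card {x. cov z x \<and> cov x y}) * h z)"
    using low_eq[OF y] by (auto intro!: sum.cong arg_cong[of _ _ card] simp: conj_commute)
  also have "\<dots> = 0"
    using even_card_diamond[OF y] by (simp add: of_nat_bit_even)
  finally show ?thesis .
qed

lemma sum_diamond_swap_up:
  assumes x: "x \<in> X"
  shows "(\<Sum>y\<in>up x. \<Sum>z\<in>up y. h z) = (0 :: bit)"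
proof -
  have "(\<Sum>y\<in>up x. \<Sum>z\<in>up y. h z) = (\<Sum>y\<in>up x. \<Sum>z | z \<in> X \<and> cov y z. h z)"
    by (simp add: up_def)
  also have "\<dots> = (\<Sum>z\<in>X. \<Sum>y | y \<in> up x \<and> cov y z. h z)"
    by (rule sum.swap_restrict) simp_all
  also have "\<dots> = (\<Sum>z\<in>X. of_nat (card {y. cov x y \<and> cov y z}) * h z)"
  proof (rule sum.cong)
    fix z assume "z \<in> X"
    then have "{y. y \<in> up x \<and> cov y z} = {y. cov x y \<and> cov y z}" using cov_down by (auto simp: up_def)
    then show "(\<Sum>y | y \<in> up x \<and> cov y z. h z) = of_nat (card {y. cov x y \<and> cov y z}) * h z" by simp
  qed simp
  also have "\<dots> = 0"
    using even_card_diamond by (simp add: of_nat_bit_even)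
  finally show ?thesis .
qed

text \<open>A product of cocycles is a cocycle. For \<open>w j = cob s\<close>, the part with
  \<open>s x\<close> vanishes by induction, and the part with \<open>s z\<close> is summed over the
  boundary of a boundary.\<close>

lemma A_cocycle:
  assumes "\<And>i. i < j \<Longrightarrow> \<exists>s. w i = cob s" "y \<in> X"
  shows "(\<Sum>x\<in>low y. A w j x) = 0"
  using assms
proof (induction j arbitrary: y)
  case 0
  then show ?case using even_card_low by (simp add: of_nat_bit_even)
next
  case (Suc j)
  obtain s where s: "w j = cob s" using Suc.prems(1) by blast
  have "(\<Sum>x\<in>low y. A w (Suc j) x) =
      (\<Sum>x\<in>low y. (\<Sum>z\<in>low x. A w j z * s z) + s x * (\<Sum>z\<in>low x. A w j z))"
    unfolding A.simps s cob_def sum_distrib_left sum.distrib[symmetric]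
    by (intro sum.cong refl) (simp add: algebra_simps)
  also have "\<dots> = (\<Sum>x\<in>low y. \<Sum>z\<in>low x. A w j z * s z)"
    by (rule sum.cong) (use Suc X_low in auto)
  also have "\<dots> = 0" by (rule sum_diamond_swap_low[OF Suc.prems(2)])
  finally show ?case .
qed

text \<open>The dual of \<open>A_cocycle\<close>. The rank is prescribed so that the induction ends
  at faces of codimension one, to which \<open>even_card_up\<close> applies.\<close>

lemma B_cocycle:
  assumes "\<And>i. k * d - m \<le> i \<Longrightarrow> i < k * d \<Longrightarrow> \<exists>s. w i = cob s" "x \<in> X" "Suc (rank x) = k * d - m" "m < k * d"
  shows "(\<Sum>y\<in>up x. B w m y) = 0"
  using assms
proof (induction m arbitrary: x)
  case 0
  then show ?case using even_card_up by (simp add: of_nat_bit_even)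
next
  case (Suc m)
  have "k * d - Suc m < k * d" using Suc.prems(4) by linarith
  then obtain s where s: "w (k * d - Suc m) = cob s" using Suc.prems(1)[of "k * d - Suc m"] by blast
  have "(\<Sum>y\<in>up x. B w (Suc m) y) =
      (\<Sum>y\<in>up x. s y * (\<Sum>z\<in>up y. B w m z) + (\<Sum>z\<in>up y. s z * B w m z))"
    by (simp add: s cob_def distrib_right sum.distrib sum_distrib_left)
  also have "\<dots> = (\<Sum>y\<in>up x. \<Sum>z\<in>up y. s z * B w m z)"
  proof (rule sum.cong)
    fix y assume y: "y \<in> up x"
    then have "rank y = Suc (rank x)" by (auto simp: up_def cov_rank)
    then have "(\<Sum>z\<in>up y. B w m z) = 0"
      using Suc.prems y by (intro Suc.IH) (auto simp: X_up)
    then show "s y * (\<Sum>z\<in>up y. B w m z) + (\<Sum>z\<in>up y. s z * B w m z) = (\<Sum>z\<in>up y. s z * B w m z)"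
      by simp
  qed simp
  also have "\<dots> = 0" by (rule sum_diamond_swap_up[OF Suc.prems(2)])
  finally show ?case .
qed

text \<open>The chains may be cut at any level; \<open>sum_dom_swap\<close> moves the cut down by
  one.\<close>

lemma T_split:
  assumes "\<And>i. i < k * d \<Longrightarrow> invar2 (w i)" and "j \<le> k * d"
  shows "T w = (\<Sum>x\<in>dom j. A w j x * B w (k * d - j) x)"
  using assms(2)
proof (induction j rule: inc_induct)
  case base
  show ?case by (simp add: T_def)
next
  case (step j)
  have "T w = (\<Sum>x\<in>dom (Suc j). \<Sum>z\<in>low x. A w j z * w j z x * B w (k * d - Suc j) x)"
    using step by (simp add: sum_distrib_right)
  also have "\<dots> = (\<Sum>z\<in>dom j. \<Sum>x\<in>up z. A w j z * w j z x * B w (k * d - Suc j) x)"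
    by (rule sum_dom_swap) (use assms step in \<open>auto simp: invar2_def A_flip B_flip\<close>)
  also have "\<dots> = (\<Sum>z\<in>dom j. A w j z * B w (k * d - j) z)"
  proof -
    have "k * d - j = Suc (k * d - Suc j)" "k * d - Suc (k * d - Suc j) = j" using step by auto
    then show ?thesis by (simp add: sum_distrib_left mult.assoc)
  qed
  finally show ?case .
qed

lemma T_step:
  assumes "\<And>i. i < k * d \<Longrightarrow> invar2 (w i)" and "j < k * d"
  shows "T w = (\<Sum>z\<in>dom j. \<Sum>x\<in>up z. A w j z * w j z x * B w (k * d - Suc j) x)"
proof -
  have "k * d - j = Suc (k * d - Suc j)" "k * d - Suc (k * d - Suc j) = j" using assms by auto
  then show ?thesis using T_split[where w = w and j = j, OF assms(1)] assms(2)
    by (simp add: sum_distrib_left mult.assoc)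
qed

text \<open>All \<open>w i\<close> are coboundaries on the grid, but \<open>w j\<close> is one on
  the quotient, since \<open>t\<close> is invariant. The parts with \<open>t\<close> at the lower
  and at the upper end of the step vanish by \<open>B_cocycle\<close> and
  \<open>A_cocycle\<close>.\<close>

lemma T_coboundary:
  assumes w: "\<And>i. i < k * d \<Longrightarrow> invar2 (w i)" "\<And>i. i < k * d \<Longrightarrow> \<exists>s. w i = cob s"
    and j: "j < k * d" and t: "invar t" "w j = cob t"
  shows "T w = 0"
proof -
  let ?B = "B w (k * d - Suc j)"
  have "T w = (\<Sum>z\<in>dom j. \<Sum>x\<in>up z. A w j z * (t z + t x) * ?B x)"
    using T_step[OF w(1) j] t by (simp add: cob_def)
  also have "\<dots> = (\<Sum>z\<in>dom j. A w j z * t z * (\<Sum>x\<in>up z. ?B x)) + (\<Sum>z\<in>dom j. \<Sum>x\<in>up z. A w j z * t x * ?B x)"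
    by (simp add: algebra_simps sum.distrib sum_distrib_left)
  also have "(\<Sum>z\<in>dom j. \<Sum>x\<in>up z. A w j z * t x * ?B x) = (\<Sum>x\<in>dom (Suc j). \<Sum>z\<in>low x. A w j z * t x * ?B x)"
    by (rule sum_dom_swap[symmetric]) (use w j t in \<open>auto simp: invar2_def A_flip B_flip invarD\<close>)
  also have "\<dots> = (\<Sum>x\<in>dom (Suc j). t x * ?B x * (\<Sum>z\<in>low x. A w j z))"
    unfolding sum_distrib_left by (simp add: mult_ac)
  also have "\<dots> = 0"
    by (rule sum.neutral) (use A_cocycle[of j w] w(2) j in \<open>auto simp: dom_def\<close>)
  also have "(\<Sum>z\<in>dom j. A w j z * t z * (\<Sum>x\<in>up z. ?B x)) = 0"
    by (rule sum.neutral) (use B_cocycle[of "k * d - Suc j" w] w(2) j in \<open>auto simp: dom_def\<close>)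
  finally show ?thesis by simp
qed

text \<open>\<open>s\<close> changes by the character of \<open>\<alpha>\<close>; thus
  \<open>cob s\<close> descends to the quotient, where it represents the sum of the u_i with i in
  \<open>\<alpha>\<close>.\<close>

definition equivariant :: "nat set \<Rightarrow> (pt \<Rightarrow> bit) \<Rightarrow> bool" where
  "equivariant \<alpha> s \<longleftrightarrow> (\<forall>g\<subseteq>{1..k}. \<forall>x\<in>X. s (flip g x) = s x + of_nat (card (g \<inter> \<alpha>)))"

lemma invar2_cob: "equivariant \<alpha> s \<Longrightarrow> invar2 (cob s)"
  by (auto simp: equivariant_def invar2_def cob_def algebra_simps)

text \<open>Two functions with the same character differ by an invariant \<open>t\<close>. As
  \<open>T\<close> is linear in the slot \<open>j\<close>, \<open>T_coboundary\<close> kills the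
  difference.\<close>

lemma T_independent_step:
  assumes s: "\<And>i. i < k * d \<Longrightarrow> equivariant (\<alpha> i) (s i)" and j: "j < k * d" and s': "equivariant (\<alpha> j) s'"
  shows "T (\<lambda>i. cob (s i)) = T (\<lambda>i. cob ((s(j := s')) i))"
proof -
  define t where "t x = s j x + s' x" for x
  define w where "w i = cob ((s(j := t)) i)" for i
  have t: "invar t" using s[OF j] s' by (auto simp: equivariant_def invar_def t_def algebra_simps)
  have inv: "invar2 (w i)" if "i < k * d" for i
    using invar2_cob[OF s[OF that]] t by (auto simp: w_def invar2_def cob_def invarD)
  have "T w = 0"
    by (rule T_coboundary[OF inv _ j t]) (auto simp: w_def)
  moreover have "T (\<lambda>i. cob ((s(j := s')) i)) = T (\<lambda>i. cob (s i)) + T w"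
  proof -
    have A: "A (\<lambda>i. cob ((s(j := s')) i)) j z = A (\<lambda>i. cob (s i)) j z" "A w j z = A (\<lambda>i. cob (s i)) j z" for z
      by (rule A_cong; simp add: w_def)+
    have B: "B (\<lambda>i. cob ((s(j := s')) i)) (k * d - Suc j) z = B (\<lambda>i. cob (s i)) (k * d - Suc j) z"
      "B w (k * d - Suc j) z = B (\<lambda>i. cob (s i)) (k * d - Suc j) z" for z
      by (rule B_cong; use j in \<open>simp add: w_def\<close>)+
    have inv': "invar2 (cob ((s(j := s')) i))" "invar2 (cob (s i))" if "i < k * d" for i
      using invar2_cob[OF s[OF that]] invar2_cob[OF s'] by auto
    have c: "cob s' z x = cob (s j) z x + cob t z x" for z x
      by (cases "s j z"; cases "s j x"; cases "s' x"; cases "s' z") (auto simp: cob_def t_def)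
    let ?A = "A (\<lambda>i. cob (s i)) j" and ?B = "B (\<lambda>i. cob (s i)) (k * d - Suc j)"
    have "T (\<lambda>i. cob ((s(j := s')) i)) = (\<Sum>z\<in>dom j. \<Sum>x\<in>up z. ?A z * cob s' z x * ?B x)"
      by (subst T_step[where j = j]) (use inv'(1) j in \<open>simp_all only: A B fun_upd_same\<close>)
    moreover have "T (\<lambda>i. cob (s i)) = (\<Sum>z\<in>dom j. \<Sum>x\<in>up z. ?A z * cob (s j) z x * ?B x)"
      by (subst T_step[where j = j]) (use inv'(2) j in simp_all)
    moreover have "T w = (\<Sum>z\<in>dom j. \<Sum>x\<in>up z. ?A z * cob t z x * ?B x)"
      by (subst T_step[where j = j]) (use inv j in \<open>simp_all only: A B\<close>, simp add: w_def)
    ultimately show ?thesis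
      by (simp only: c distrib_left distrib_right sum.distrib)
  qed
  ultimately show ?thesis by simp
qed

lemma T_cong: "(\<And>i. i < k * d \<Longrightarrow> w i = w' i) \<Longrightarrow> T w = T w'"
  unfolding T_def by (rule sum.cong) (auto intro: A_cong)

lemma T_independent:
  assumes "\<And>i. i < k * d \<Longrightarrow> equivariant (\<alpha> i) (s i)" and "\<And>i. i < k * d \<Longrightarrow> equivariant (\<alpha> i) (s' i)"
  shows "T (\<lambda>i. cob (s i)) = T (\<lambda>i. cob (s' i))"
proof -
  have "T (\<lambda>i. cob (s i)) = T (\<lambda>i. cob (if i < m then s' i else s i))" if "m \<le> k * d" for m
    using that
  proof (induction m)
    case (Suc m)
    let ?s = "\<lambda>i. if i < m then s' i else s i"
    have "T (\<lambda>i. cob (?s i)) = T (\<lambda>i. cob ((?s(m := s' m)) i))"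
      by (rule T_independent_step[where \<alpha> = \<alpha>]) (use assms Suc in auto)
    also have "?s(m := s' m) = (\<lambda>i. if i < Suc m then s' i else s i)" by auto
    finally show ?case using Suc by simp
  qed simp
  from this[of "k * d"] have "T (\<lambda>i. cob (s i)) = T (\<lambda>i. cob (if i < k * d then s' i else s i))" by simp
  also have "\<dots> = T (\<lambda>i. cob (s' i))" by (rule T_cong) simp
  finally show ?thesis .
qed

section \<open>Evaluation of the top cup product\<close>

definition sgl :: "nat \<Rightarrow> nat \<Rightarrow> pt \<Rightarrow> bit" where
  "sgl i l x = (if x (Ix i l) = 0 then sg i x else of_bool (x (Ix i l) < 0))"

lemma flip_apply: "flip g x e = (if fac e \<in> g then - x e else x e)"
  by (simp add: flip_def)

lemma equivariant_singleton:
  assumes "\<And>g x. x \<in> X \<Longrightarrow> s (flip g x) = s x + of_bool (i \<in> g)"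
  shows "equivariant {i} s"
  using assms by (auto simp: equivariant_def)

lemma equivariant_sg: "i \<in> {1..k} \<Longrightarrow> equivariant {i} (sg i)"
  by (rule equivariant_singleton) (rule sg_flip)

lemma equivariant_sgl: assumes "i \<in> {1..k}" shows "equivariant {i} (sgl i l)"
  proof (rule equivariant_singleton)
  fix g x assume x: "x \<in> X"
  show "sgl i l (flip g x) = sgl i l x + of_bool (i \<in> g)"
    unfolding sgl_def by (simp add: sg_flip[OF x assms] flip_apply)
qed

lemma equivariant_sum_sg:
  assumes "\<alpha> \<subseteq> {1..k}"
  shows "equivariant \<alpha> (\<lambda>x. \<Sum>i\<in>\<alpha>. sg i x)"
  unfolding equivariant_def
proof (intro allI impI ballI)
  fix g x assume "g \<subseteq> {1..k}" "x \<in> X"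
  have fin: "finite \<alpha>" using assms finite_subset by blast
  have "(\<Sum>i\<in>\<alpha>. sg i (flip g x)) = (\<Sum>i\<in>\<alpha>. sg i x + of_bool (i \<in> g))"
    by (rule sum.cong) (use assms sg_flip \<open>x \<in> X\<close> in auto)
  also have "\<dots> = (\<Sum>i\<in>\<alpha>. sg i x) + of_nat (card (g \<inter> \<alpha>))"
    using fin by (simp add: sum.distrib Int_commute)
  finally show "(\<Sum>i\<in>\<alpha>. sg i (flip g x)) = (\<Sum>i\<in>\<alpha>. sg i x) + of_nat (card (g \<inter> \<alpha>))" .
qed

text \<open>A nonzero sum over chains has a nonzero summand; this is how geometry is recovered from
  the value of \<open>T\<close>.\<close>

lemma A_chain:
  assumes "A w j x \<noteq> 0" "x \<in> X"
  shows "\<exists>c. c j = x \<and> (\<forall>m\<le>j. c m \<in> X) \<and>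
    (\<forall>m<j. cov (c m) (c (Suc m)) \<and> w m (c m) (c (Suc m)) \<noteq> 0)"
  using assms
proof (induction j arbitrary: x)
  case 0
  then show ?case by (intro exI[of _ "\<lambda>_. x"]) simp
next
  case (Suc j)
  have "\<exists>z\<in>low x. A w j z * w j z x \<noteq> 0"
  proof (rule ccontr)
    assume "\<not> ?thesis"
    then have "A w (Suc j) x = 0" unfolding A.simps by (intro sum.neutral) blast
    then show False using Suc.prems by simp
  qed
  then obtain z where z: "z \<in> low x" "A w j z * w j z x \<noteq> 0" by blast
  then have "A w j z \<noteq> 0" "w j z x \<noteq> 0" by auto
  then obtain c where c: "c j = z" "\<forall>m\<le>j. c m \<in> X"
    "\<forall>m<j. cov (c m) (c (Suc m)) \<and> w m (c m) (c (Suc m)) \<noteq> 0"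
    using Suc.IH z(1) X_low by blast
  have "cov z x" using z(1) by (simp add: low_def)
  then show ?case using c \<open>w j z x \<noteq> 0\<close> Suc.prems(2)
    by (intro exI[of _ "c(Suc j := x)"]) (auto simp: less_Suc_eq le_Suc_eq)
qed

lemma cov_even: assumes "cov x y" "even (y e)" shows "x e = y e"
  using assms by (auto simp: cov_def split: if_splits)

lemma cov_odd: assumes "cov x y" "odd (x e)" shows "y e = x e"
  using assms by (auto simp: cov_def split: if_splits)

lemma cov_dist: assumes "cov x y" shows "\<bar>y e - x e\<bar> \<le> 1"
  using assms by (auto simp: cov_def)

lemma chain_even:
  assumes "\<And>m. m < j \<Longrightarrow> cov (c m) (c (Suc m))" "even (c j e)" "m \<le> j"
  shows "c m e = c j e"
  using assms(3)
proof (induction m rule: inc_induct)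
  case (step m)
  then show ?case using cov_even[OF assms(1)[of m], of e] assms(2) by auto
qed simp

lemma chain_odd:
  assumes "\<And>m. m < j \<Longrightarrow> cov (c m) (c (Suc m))" "odd (c m e)" "m \<le> j"
  shows "c j e = c m e"
proof -
  have "m \<le> i \<Longrightarrow> i \<le> j \<Longrightarrow> c i e = c m e" for i
  proof (induction i)
    case (Suc i)
    then show ?case using cov_odd[OF assms(1)[of i], of e] assms(2) by (cases "m = Suc i") auto
  qed simp
  then show ?thesis using assms(3) by blast
qed

lemma chain_dist:
  assumes "\<And>m. m < j \<Longrightarrow> cov (c m) (c (Suc m))" "m \<le> j"
  shows "\<bar>c m e - c 0 e\<bar> \<le> int m"
  using assms(2)
proof (induction m)
  case (Suc m)
  then show ?case using cov_dist[OF assms(1)[of m], of e] by auto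
qed simp

lemma sg_top:
  assumes "x \<in> X" "i \<in> {1..k}" "x (Ix i d) \<noteq> 0"
  shows "sg i x = of_bool (x (Ix i d) < 0)"
proof -
  have "Max {l. l \<le> d \<and> x (Ix i l) \<noteq> 0} = d"
    by (rule antisym) (use greatest_nonzero[OF assms(1,2)] assms(3) in auto)
  then show ?thesis by (simp add: sg_def)
qed

text \<open>
  As \<open>T\<close> does not depend on the sign functions, the steps in factor \<open>i\<close> may use the signs of the
  coordinates \<open>0, 1, 2, \<dots>\<close> in turn. An extreme coordinate of the last face of a chain is constant
  along the chain, so the number of steps in each factor is at most, hence exactly, \<open>d\<close>.
\<close>

definition idx_of :: "(nat \<Rightarrow> nat) \<Rightarrow> nat \<Rightarrow> nat" where
  "idx_of \<phi> m = card {j. j < m \<and> \<phi> j = \<phi> m}"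

lemma T_support:
  assumes \<phi>: "\<And>j. j < k * d \<Longrightarrow> \<phi> j \<in> {1..k}"
    and x: "x \<in> X" and A: "A (\<lambda>j. cob (sgl (\<phi> j) (idx_of \<phi> j))) (k * d) x \<noteq> 0"
  shows "\<And>i. i \<in> {1..k} \<Longrightarrow> card {j. j < k * d \<and> \<phi> j = i} = d"
    and "\<And>i. i \<in> {1..k} \<Longrightarrow> \<bar>x (Ix i d)\<bar> = 2 * int n"
    and "(\<And>i. i \<in> {1..k} \<Longrightarrow> x (Ix i d) = 2 * int n) \<Longrightarrow> i \<in> {1..k} \<Longrightarrow> l < d \<Longrightarrow> x (Ix i l) = - 1"
proof -
  let ?cnt = "\<lambda>i. card {j. j < k * d \<and> \<phi> j = i}"
  obtain c where c: "c (k * d) = x" "\<And>m. m \<le> k * d \<Longrightarrow> c m \<in> X"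
    "\<And>m. m < k * d \<Longrightarrow> cov (c m) (c (Suc m))"
    "\<And>m. m < k * d \<Longrightarrow> cob (sgl (\<phi> m) (idx_of \<phi> m)) (c m) (c (Suc m)) \<noteq> 0"
    using A_chain[OF A x] by blast
  have hit: "\<exists>m<k*d. \<phi> m = i \<and> idx_of \<phi> m = l" if "l < ?cnt i" for i l
    using card_fiber_hit[OF that] by (auto simp: idx_of_def)
  have ev: "c m e = x e" if "m \<le> k * d" "even (x e)" for m e
    using chain_even[of "k * d" c e m] c that by auto
  have ext: "?cnt i \<le> l" if i: "i \<in> {1..k}" "\<bar>x (Ix i l)\<bar> = 2 * int n" for i l
  proof (rule ccontr)
    assume "\<not> ?thesis"
    then obtain m where m: "m < k * d" "\<phi> m = i" "idx_of \<phi> m = l" using hit[of l i] by auto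
    have "even (x (Ix i l))" using that by (metis dvd_abs_iff dvd_triv_left)
    then have "c m (Ix i l) = x (Ix i l)" "c (Suc m) (Ix i l) = x (Ix i l)" using ev m(1) by auto
    moreover have "x (Ix i l) \<noteq> 0" using that n_pos by auto
    ultimately have "cob (sgl (\<phi> m) (idx_of \<phi> m)) (c m) (c (Suc m)) = 0"
      unfolding m(2,3) by (simp add: cob_def sgl_def)
    then show False using c(4) m(1) by blast
  qed
  have le: "?cnt i \<le> d" if i: "i \<in> {1..k}" for i
    using X_ext[OF x i] ext[OF i] by (meson le_trans)
  have sum: "(\<Sum>i\<in>{1..k}. ?cnt i) = k * d"
    by (rule sum_card_fiber) (use \<phi> in auto)
  show cnt: "?cnt i = d" if i: "i \<in> {1..k}" for i
  proof (rule ccontr)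
    assume "?cnt i \<noteq> d"
    then have "(\<Sum>i\<in>{1..k}. ?cnt i) < (\<Sum>i\<in>{1..k}. d)"
      using le i by (intro sum_strict_mono_ex1) (auto intro!: bexI[of _ i] simp: less_le simp del: sum_constant)
    then show False using sum by simp
  qed
  show extd: "\<bar>x (Ix i d)\<bar> = 2 * int n" if i: "i \<in> {1..k}" for i
    using X_ext[OF x i] ext[OF i] cnt[OF i] by (metis le_antisym)
  show "x (Ix i l) = - 1" if p: "\<And>i. i \<in> {1..k} \<Longrightarrow> x (Ix i d) = 2 * int n" and i: "i \<in> {1..k}" and l: "l < d"
  proof -
    obtain m where m: "m < k * d" "\<phi> m = i" "idx_of \<phi> m = l" using hit[of l i] cnt[OF i] l by auto
    \<comment> \<open>With the last coordinate positive, a coordinate 0 counts as positive all along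
      the chain. A step starts at an even value of the coordinate that it changes, so the only sign
      change of coordinate \<open>l\<close> is from 0 to -1, and odd values persist.\<close>
    have "sg i (c j) = 0" if "j \<le> k * d" for j
    proof -
      have "c j (Ix i d) = 2 * int n" using ev[OF that] p[OF i] by simp
      then show ?thesis using sg_top[OF c(2)[OF that] i] n_pos by simp
    qed
    then have s: "sg i (c m) = 0" "sg i (c (Suc m)) = 0" using m(1) by auto
    have ne: "sgl i l (c m) + sgl i l (c (Suc m)) \<noteq> 0"
      using c(4)[OF m(1)] by (simp add: cob_def m)
    then have ne': "c m (Ix i l) \<noteq> c (Suc m) (Ix i l)" using s by (auto simp: sgl_def split: if_splits)
    have e: "even (c m (Ix i l))" using cov_odd[OF c(3)[OF m(1)], of "Ix i l"] ne' by auto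
    define a b where "a = c m (Ix i l)" and "b = c (Suc m) (Ix i l)"
    have dist: "\<bar>b - a\<bar> \<le> 1" using cov_dist[OF c(3)[OF m(1)]] by (simp add: a_def b_def)
    have a1: "\<bar>a\<bar> \<noteq> 1" using e by (auto simp: a_def abs_if split: if_splits)
    have b0: "b \<noteq> 0" using dist a1 ne' by (auto simp: a_def b_def)
    have "b = - 1"
    proof (cases "a = 0")
      case True
      then have "b < 0" using ne s b0 by (auto simp: sgl_def a_def b_def)
      then show ?thesis using dist True by simp
    next
      case False
      then have "(a < 0) = (b < 0)" using dist a1 by auto
      then have "sgl i l (c m) + sgl i l (c (Suc m)) = 0"
        using False b0 by (simp add: sgl_def a_def b_def)
      then show ?thesis using ne by blast
    qed
    then have "c (Suc m) (Ix i l) = - 1" by (simp add: b_def)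
    then show ?thesis using chain_odd[of "k * d" c "Suc m" "Ix i l"] c m(1) by auto
  qed
qed

text \<open>If all counts are \<open>d\<close>, exactly one chain contributes: it starts at the
  vertex with last coordinates 2n and all others 0, and each step lowers its own coordinate to -1.
  \<open>T_support\<close> excludes the other top faces.\<close>

lemma T_sgl:
  assumes \<phi>: "\<And>j. j < k * d \<Longrightarrow> \<phi> j \<in> {1..k}"
  shows "T (\<lambda>j. cob (sgl (\<phi> j) (idx_of \<phi> j))) = of_bool (\<forall>i\<in>{1..k}. card {j. j < k * d \<and> \<phi> j = i} = d)"
proof (cases "\<forall>i\<in>{1..k}. card {j. j < k * d \<and> \<phi> j = i} = d")
  case False
  have "A (\<lambda>j. cob (sgl (\<phi> j) (idx_of \<phi> j))) (k * d) x = 0" if "x \<in> dom (k * d)" for x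
  proof (rule ccontr)
    assume A: "A (\<lambda>j. cob (sgl (\<phi> j) (idx_of \<phi> j))) (k * d) x \<noteq> 0"
    have "x \<in> X" using that by (simp add: dom_def)
    then show False using T_support(1)[OF \<phi> _ A] False by blast
  qed
  then have "T (\<lambda>j. cob (sgl (\<phi> j) (idx_of \<phi> j))) = 0" unfolding T_def by (rule sum.neutral[rule_format])
  then show ?thesis using False by simp
next
  case True
  let ?w = "\<lambda>j. cob (sgl (\<phi> j) (idx_of \<phi> j))"
  define y :: "nat \<Rightarrow> pt" where "y j e = (if e \<notin> E then 0 else if pos e = d then 2 * int n else
    if \<exists>m<j. Ix (\<phi> m) (idx_of \<phi> m) = e then - 1 else 0)" for j e
  have yX: "y j \<in> X" for j
    using n_pos by (auto simp: X_def y_def E_def)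
  have ys: "sg i (y j) = 0" if "i \<in> {1..k}" for i j
    using sg_top[OF yX that, of j] that n_pos by (auto simp: y_def E_def)
  have idx: "idx_of \<phi> m < d" if "m < k * d" for m
    using card_fiber_mono[OF that, of \<phi> "\<phi> m"] True \<phi>[OF that] by (simp add: idx_of_def)
  have inj: "Ix (\<phi> m) (idx_of \<phi> m) \<noteq> Ix (\<phi> m') (idx_of \<phi> m')" if "m < m'" for m m'
    using card_fiber_mono[OF that, of \<phi> "\<phi> m"] by (auto simp: idx_of_def)
  have step: "y (Suc j) = (y j)(Ix (\<phi> j) (idx_of \<phi> j) := - 1)" "y j (Ix (\<phi> j) (idx_of \<phi> j)) = 0"
    if "j < k * d" for j
    using idx[OF that] \<phi>[OF that] inj by (auto simp: y_def E_def less_Suc_eq fun_eq_iff)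
  have inE: "Ix (\<phi> j) (idx_of \<phi> j) \<in> E" if "j < k * d" for j
    using idx[OF that] \<phi>[OF that] by (auto simp: E_def)
  have cov: "cov (y j) (y (Suc j))" if "j < k * d" for j
    unfolding cov_def using step[OF that] inE[OF that] by (intro bexI[of _ "Ix (\<phi> j) (idx_of \<phi> j)"]) auto
  have rank: "rank (y j) = j" if "j \<le> k * d" for j
    using that
  proof (induction j)
    case 0
    have "even (y 0 e)" for e by (simp add: y_def)
    then show ?case by (simp add: rank_def)
  next
    case (Suc j)
    then show ?case using cov_rank[OF cov[of j]] by simp
  qed
  have A1: "A ?w j (y j) = 1" if "j \<le> k * d" for j
    using that
  proof (induction j)
    case (Suc j)
    then have j: "j < k * d" by simp
    let ?e = "Ix (\<phi> j) (idx_of \<phi> j)"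
    \<comment> \<open>In every other facet of \<open>y (Suc j)\<close> the coordinate
      \<open>?e\<close> is negative already, so the step shows no sign change.\<close>
    have "A ?w j z * ?w j z (y (Suc j)) = 0" if z: "z \<in> low (y (Suc j))" "z \<noteq> y j" for z
    proof -
      have zX: "z \<in> X" and zc: "cov z (y (Suc j))" using z by (auto simp: low_def)
      have "even (y (Suc j) (Ix (\<phi> j) d))" by (simp add: y_def)
      then have "z (Ix (\<phi> j) d) = y (Suc j) (Ix (\<phi> j) d)" using cov_even[OF zc] by blast
      also have "\<dots> = 2 * int n" using \<phi>[OF j] by (simp add: y_def E_def)
      finally have sz: "sg (\<phi> j) z = 0" using sg_top[OF zX \<phi>[OF j]] n_pos by simp
      have y1: "y (Suc j) ?e = - 1" using step[OF j] by simp
      obtain e where e: "e \<in> E" "even (z e)" "y (Suc j) = z(e := z e + 1) \<or> y (Suc j) = z(e := z e - 1)"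
        using zc by (auto simp: cov_def)
      have "z ?e < 0"
      proof (cases "e = ?e")
        case False
        then have "z ?e = - 1" using e(3) y1 by auto
        then show ?thesis by simp
      next
        case True
        have "z ?e \<noteq> 0"
        proof
          assume "z ?e = 0"
          have "z a = y j a" for a
          proof (cases "a = ?e")
            case False
            then have "z a = y (Suc j) a" using e(3) True by auto
            then show ?thesis using False by (simp add: step(1)[OF j])
          qed (use \<open>z ?e = 0\<close> step(2)[OF j] in simp)
          then have "z = y j" by blast
          then show False using z by simp
        qed
        then show ?thesis using e(3) True y1 by auto
      qed
      then show ?thesis using y1 by (simp add: cob_def sgl_def)
    qed
    then have "A ?w (Suc j) (y (Suc j)) = (\<Sum>z\<in>{y j}. A ?w j z * ?w j z (y (Suc j)))"
      unfolding A.simps by (intro sum.mono_neutral_right) (use cov[OF j] yX in \<open>auto simp: low_def\<close>)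
    also have "\<dots> = ?w j (y j) (y (Suc j))" using Suc.IH j by simp
    also have "\<dots> = 1" using step[OF j] ys[OF \<phi>[OF j]] by (simp add: cob_def sgl_def)
    finally show ?case .
  qed simp
  have "nrm (y (k * d)) = {}" using ys by (simp add: nrm_def)
  then have ydom: "y (k * d) \<in> dom (k * d)" using yX rank by (simp add: dom_def)
  have "A ?w (k * d) x = 0" if x: "x \<in> dom (k * d)" "x \<noteq> y (k * d)" for x
  proof (rule ccontr)
    assume A: "A ?w (k * d) x \<noteq> 0"
    have xs: "sg i x = 0" if "i \<in> {1..k}" for i
      using x that by (auto simp: dom_def nrm_def)
    have xX: "x \<in> X" using x by (auto simp: dom_def)
    have xd: "x (Ix i d) = 2 * int n" if i: "i \<in> {1..k}" for i
    proof -
      have "\<bar>x (Ix i d)\<bar> = 2 * int n" by (rule T_support(2)[OF \<phi> xX A i])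
      moreover have "sg i x = 0" by (rule xs[OF i])
      ultimately show ?thesis using sg_top[OF xX i] n_pos by (cases "x (Ix i d) < 0") auto
    qed
    have "x e = y (k * d) e" for e
    proof (cases "e \<in> E")
      case False
      then show ?thesis using xX by (simp add: X_def y_def)
    next
      case eE: True
      obtain i l where [simp]: "e = Ix i l" by (cases e)
      have i: "i \<in> {1..k}" "l \<le> d" using eE by (auto simp: E_def)
      show ?thesis
      proof (cases "l = d")
        case True
        then show ?thesis using xd[OF i(1)] eE by (simp add: y_def)
      next
        case False
        then have l: "l < d" using i by simp
        obtain m where "m < k * d" "\<phi> m = i" "card {j. j < m \<and> \<phi> j = i} = l"
          using card_fiber_hit[of l "k * d" \<phi> i] True i l by auto
        then have "y (k * d) e = - 1" using eE l by (auto simp: y_def idx_of_def)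
        then show ?thesis using T_support(3)[OF \<phi> xX A xd i(1) l] by simp
      qed
    qed
    then show False using x(2) by blast
  qed
  then have "T ?w = (\<Sum>x\<in>{y (k * d)}. A ?w (k * d) x)"
    unfolding T_def by (intro sum.mono_neutral_right) (use ydom in auto)
  then show ?thesis using A1 True by simp
qed

lemma A_expand:
  assumes "\<And>j. j < m \<Longrightarrow> finite (\<alpha> j)"
  shows "A (\<lambda>j x y. \<Sum>i\<in>\<alpha> j. v j i x y) m x = (\<Sum>\<phi>\<in>PiE {..<m} \<alpha>. A (\<lambda>j. v j (\<phi> j)) m x)"
  using assms
proof (induction m arbitrary: x)
  case (Suc m)
  let ?P = "PiE {..<m} \<alpha>"
  have "A (\<lambda>j x y. \<Sum>i\<in>\<alpha> j. v j i x y) (Suc m) x =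
      (\<Sum>z\<in>low x. (\<Sum>\<phi>\<in>?P. A (\<lambda>j. v j (\<phi> j)) m z) * (\<Sum>i\<in>\<alpha> m. v m i z x))"
    using Suc by simp
  also have "\<dots> = (\<Sum>z\<in>low x. \<Sum>(i, \<phi>)\<in>\<alpha> m \<times> ?P. A (\<lambda>j. v j (\<phi> j)) m z * v m i z x)"
  proof (rule sum.cong[OF refl])
    fix z
    show "(\<Sum>\<phi>\<in>?P. A (\<lambda>j. v j (\<phi> j)) m z) * (\<Sum>i\<in>\<alpha> m. v m i z x) =
        (\<Sum>(i, \<phi>)\<in>\<alpha> m \<times> ?P. A (\<lambda>j. v j (\<phi> j)) m z * v m i z x)"
      unfolding sum_product by (subst sum.swap) (simp only: sum.cartesian_product)
  qed
  also have "\<dots> = (\<Sum>(i, \<phi>)\<in>\<alpha> m \<times> ?P. \<Sum>z\<in>low x. A (\<lambda>j. v j (\<phi> j)) m z * v m i z x)"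
    by (subst sum.swap) (simp add: case_prod_unfold)
  also have "\<dots> = (\<Sum>(i, \<phi>)\<in>\<alpha> m \<times> ?P. A (\<lambda>j. v j ((\<phi>(m := i)) j)) (Suc m) x)"
  proof (intro sum.cong refl, clarify)
    fix i \<phi>
    have "A (\<lambda>j. v j ((\<phi>(m := i)) j)) m z = A (\<lambda>j. v j (\<phi> j)) m z" for z
      by (rule A_cong) simp
    then show "(\<Sum>z\<in>low x. A (\<lambda>j. v j (\<phi> j)) m z * v m i z x) = A (\<lambda>j. v j ((\<phi>(m := i)) j)) (Suc m) x" by simp
  qed
  also have "\<dots> = (\<Sum>\<phi>\<in>PiE {..<Suc m} \<alpha>. A (\<lambda>j. v j (\<phi> j)) (Suc m) x)"
    unfolding lessThan_Suc PiE_insert_eq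
    by (subst sum.reindex[OF inj_combinator]) (simp, simp only: o_def case_prod_unfold)
  finally show ?case .
qed simp

text \<open>Since \<open>T\<close> depends only on the characters, it may be computed from the sums
  of the \<open>sg i\<close>. Multilinear expansion leaves characters of single factors, where
  \<open>sgl\<close> may replace \<open>sg\<close>. The right side counts mod 2 the ways to form
  u_1^d ... u_k^d in the product of the linear forms.\<close>

theorem T_eq_coefficient:
  assumes \<alpha>: "\<And>j. j < k * d \<Longrightarrow> \<alpha> j \<subseteq> {1..k}" and s: "\<And>j. j < k * d \<Longrightarrow> equivariant (\<alpha> j) (s j)"
  shows "T (\<lambda>j. cob (s j)) =
    (\<Sum>\<phi>\<in>PiE {..<k * d} \<alpha>. of_bool (\<forall>i\<in>{1..k}. card {j. j < k * d \<and> \<phi> j = i} = d))"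
proof -
  have "T (\<lambda>j. cob (s j)) = T (\<lambda>j. cob (\<lambda>x. \<Sum>i\<in>\<alpha> j. sg i x))"
    by (rule T_independent[where \<alpha> = \<alpha>]) (use s equivariant_sum_sg \<alpha> in auto)
  also have "\<dots> = T (\<lambda>j x y. \<Sum>i\<in>\<alpha> j. cob (sg i) x y)"
    by (intro arg_cong[of _ _ T] ext) (simp add: cob_def sum.distrib)
  also have "\<dots> = (\<Sum>\<phi>\<in>PiE {..<k * d} \<alpha>. T (\<lambda>j. cob (sg (\<phi> j))))"
    proof -
    have "T (\<lambda>j x y. \<Sum>i\<in>\<alpha> j. cob (sg i) x y) =
        (\<Sum>x\<in>dom (k * d). \<Sum>\<phi>\<in>PiE {..<k * d} \<alpha>. A (\<lambda>j. cob (sg (\<phi> j))) (k * d) x)"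
      unfolding T_def by (rule sum.cong[OF refl A_expand]) (use \<alpha> finite_subset in blast)
    then show ?thesis unfolding T_def by (subst sum.swap)
  qed
  also have "\<dots> = (\<Sum>\<phi>\<in>PiE {..<k * d} \<alpha>. of_bool (\<forall>i\<in>{1..k}. card {j. j < k * d \<and> \<phi> j = i} = d))"
  proof (rule sum.cong)
    fix \<phi> assume "\<phi> \<in> PiE {..<k * d} \<alpha>"
    then have \<phi>: "\<phi> j \<in> {1..k}" if "j < k * d" for j using \<alpha>[OF that] PiE_mem[of \<phi>] that by blast
    have "T (\<lambda>j. cob (sg (\<phi> j))) = T (\<lambda>j. cob (sgl (\<phi> j) (idx_of \<phi> j)))"
      by (rule T_independent[where \<alpha> = "\<lambda>j. {\<phi> j}"]) (use \<phi> equivariant_sg equivariant_sgl in auto)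
    then show "T (\<lambda>j. cob (sg (\<phi> j))) = of_bool (\<forall>i\<in>{1..k}. card {j. j < k * d \<and> \<phi> j = i} = d)"
      using T_sgl[OF \<phi>] by simp
  qed simp
  finally show ?thesis .
qed

end

section \<open>A Borsuk-Ulam theorem for products of spheres\<close>

type_synonym mpoly2 = "(nat \<Rightarrow>\<^sub>0 nat) \<Rightarrow>\<^sub>0 bit"

definition var :: "nat \<Rightarrow> mpoly2" where
  "var i = Poly_Mapping.single (Poly_Mapping.single i 1) 1"

definition top_exp :: "nat \<Rightarrow> nat \<Rightarrow> nat \<Rightarrow>\<^sub>0 nat" where
  "top_exp k d = (\<Sum>i\<in>{1..k}. Poly_Mapping.single i d)"

lemma lookup_sum: "Poly_Mapping.lookup (\<Sum>x\<in>A. h x) i = (\<Sum>x\<in>A. Poly_Mapping.lookup (h x) i)"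
  by (induction A rule: infinite_finite_induct) (auto simp: lookup_add)

lemma prod_single:
  "(\<Prod>j\<in>J. Poly_Mapping.single (h j) (1 :: bit)) = Poly_Mapping.single (\<Sum>j\<in>J. h j :: nat \<Rightarrow>\<^sub>0 nat) 1"
  by (induction J rule: infinite_finite_induct) (auto simp: mult_single)

lemma lookup_top_exp: "Poly_Mapping.lookup (top_exp k d) i = (if i \<in> {1..k} then d else 0)"
  by (simp add: top_exp_def lookup_sum lookup_single when_def)

lemma lookup_prod_var:
  fixes \<phi> :: "nat \<Rightarrow> nat"
  assumes \<phi>: "\<And>j. j < N \<Longrightarrow> \<phi> j \<in> {1..k}"
  shows "Poly_Mapping.lookup (\<Prod>j<N. var (\<phi> j)) (top_exp k d) =
    of_bool (\<forall>i\<in>{1..k}. card {j. j < N \<and> \<phi> j = i} = d)"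
proof -
  define E where "E = (\<Sum>j<N. Poly_Mapping.single (\<phi> j) (1 :: nat))"
  have E: "Poly_Mapping.lookup E i = card {j. j < N \<and> \<phi> j = i}" for i
  proof -
    have "{..<N} \<inter> {j. \<phi> j = i} = {j. j < N \<and> \<phi> j = i}" by auto
    then show ?thesis by (simp add: E_def lookup_sum lookup_single when_def sum.If_cases)
  qed
  have "E = top_exp k d \<longleftrightarrow> (\<forall>i. card {j. j < N \<and> \<phi> j = i} = (if i \<in> {1..k} then d else 0))"
    by (simp add: poly_mapping_eq_iff fun_eq_iff E lookup_top_exp)
  also have "\<dots> \<longleftrightarrow> (\<forall>i\<in>{1..k}. card {j. j < N \<and> \<phi> j = i} = d)"
  proof -
    have "{j. j < N \<and> \<phi> j = i} = {}" if "i \<notin> {1..k}" for i using \<phi> that by blast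
    then show ?thesis by (metis card.empty)
  qed
  finally have eq: "E = top_exp k d \<longleftrightarrow> (\<forall>i\<in>{1..k}. card {j. j < N \<and> \<phi> j = i} = d)" .
  have "(\<Prod>j<N. var (\<phi> j)) = Poly_Mapping.single E 1"
    unfolding var_def E_def by (rule prod_single)
  then show ?thesis by (simp add: lookup_single when_def eq)
qed

text \<open>Nonzero vectors stand in for points of the spheres, so the rescaled grid points belong
  to it without normalisation.\<close>

definition config :: "nat \<Rightarrow> nat \<Rightarrow> (idx \<Rightarrow> real) set" where
  "config k d = {p. \<forall>i\<in>{1..k}. \<exists>l\<le>d. p (Ix i l) \<noteq> 0}"

definition rflip :: "nat set \<Rightarrow> (idx \<Rightarrow> real) \<Rightarrow> idx \<Rightarrow> real" where
  "rflip g p = (\<lambda>e. if fac e \<in> g then - p e else p e)"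

lemma bounded_finite_subseq:
  fixes x :: "nat \<Rightarrow> 'e \<Rightarrow> real"
  assumes "finite E" "\<And>n e. e \<in> E \<Longrightarrow> \<bar>x n e\<bar> \<le> 1"
  shows "\<exists>r :: nat \<Rightarrow> nat. strict_mono r \<and> (\<forall>e\<in>E. convergent (\<lambda>n. x (r n) e))"
  using assms
proof (induction E rule: finite_induct)
  case empty
  show ?case by (rule exI[of _ id]) (simp add: strict_mono_def)
next
  case (insert a E)
  then obtain r :: "nat \<Rightarrow> nat" where r: "strict_mono r" "\<forall>e\<in>E. convergent (\<lambda>n. x (r n) e)" by auto
  have "\<forall>n. x (r n) a \<in> {-1..1}" using insert.prems by (auto simp: abs_le_iff minus_le_iff)
  then obtain l r' where r': "strict_mono r'" "((\<lambda>n. x (r n) a) \<circ> r') \<longlonglongrightarrow> l"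
    using compact_Icc[of "-1 :: real" 1] unfolding compact_def by metis
  have "convergent (\<lambda>n. x ((r \<circ> r') n) e)" if "e \<in> insert a E" for e
  proof (cases "e = a")
    case True
    then show ?thesis using r'(2) by (auto simp: convergent_def o_def)
  next
    case False
    then have "convergent ((\<lambda>n. x (r n) e) \<circ> r')"
      using r(2) that r'(1) convergent_subseq_convergent by blast
    then show ?thesis by (simp add: o_def)
  qed
  then show ?case using strict_mono_o[OF r(1) r'(1)] by blast
qed

text \<open>On every grid, a nonzero \<open>T\<close> yields a chain whose steps show the sign
  changes of all functions, one each; refining the grid shrinks these chains to a common zero.
  Continuity is required along sequences, the form that dominated convergence delivers.\<close>

theorem borsuk_ulam_product:
  fixes f :: "'s \<Rightarrow> (idx \<Rightarrow> real) \<Rightarrow> real"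
  assumes S: "finite S" "card S = k * d"
    and \<alpha>: "\<And>s. s \<in> S \<Longrightarrow> \<alpha> s \<subseteq> {1..k}"
    and equiv: "\<And>s g p. s \<in> S \<Longrightarrow> g \<subseteq> {1..k} \<Longrightarrow> p \<in> config k d \<Longrightarrow>
      f s (rflip g p) = (- 1) ^ card (g \<inter> \<alpha> s) * f s p"
    and cont: "\<And>s P p. s \<in> S \<Longrightarrow> (\<And>n. P n \<in> config k d) \<Longrightarrow> p \<in> config k d \<Longrightarrow>
      (\<And>e. (\<lambda>n. P n e) \<longlonglongrightarrow> p e) \<Longrightarrow> (\<lambda>n. f s (P n)) \<longlonglongrightarrow> f s p"
    and coeff: "Poly_Mapping.lookup (\<Prod>s\<in>S. \<Sum>i\<in>\<alpha> s. var i) (top_exp k d) = 1"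
  shows "\<exists>p\<in>config k d. \<forall>s\<in>S. f s p = 0"
proof -
  obtain b where b: "bij_betw b {..<k * d} S"
    using ex_bij_betw_nat_finite[OF S(1)] S(2) by (auto simp: atLeast0LessThan)
  have bS: "b j \<in> S" if "j < k * d" for j using b that bij_betwE by blast
  have "(\<Prod>s\<in>S. \<Sum>i\<in>\<alpha> s. var i) = (\<Prod>j<k*d. \<Sum>i\<in>\<alpha> (b j). var i)"
    by (rule prod.reindex_bij_betw[OF b, symmetric])
  also have "\<dots> = (\<Sum>\<phi>\<in>PiE {..<k*d} (\<lambda>j. \<alpha> (b j)). \<Prod>j<k*d. var (\<phi> j))"
    by (rule prod_sum_PiE) (use \<alpha> bS finite_subset in \<open>auto, blast\<close>)
  finally have "(\<Sum>\<phi>\<in>PiE {..<k*d} (\<lambda>j. \<alpha> (b j)). Poly_Mapping.lookup (\<Prod>j<k*d. var (\<phi> j)) (top_exp k d)) = 1"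
    using coeff by (simp add: lookup_sum)
  also have "(\<Sum>\<phi>\<in>PiE {..<k*d} (\<lambda>j. \<alpha> (b j)). Poly_Mapping.lookup (\<Prod>j<k*d. var (\<phi> j)) (top_exp k d)) =
      (\<Sum>\<phi>\<in>PiE {..<k*d} (\<lambda>j. \<alpha> (b j)). of_bool (\<forall>i\<in>{1..k}. card {j. j < k*d \<and> \<phi> j = i} = d))"
    by (intro sum.cong refl lookup_prod_var) (use \<alpha> bS PiE_mem in blast)
  finally have one: "(\<Sum>\<phi>\<in>PiE {..<k*d} (\<lambda>j. \<alpha> (b j)). of_bool (\<forall>i\<in>{1..k}. card {j. j < k*d \<and> \<phi> j = i} = d)) = (1 :: bit)" .
  \<comment> \<open>\<open>x\<close> will be the first face of the chain. The chain has
    \<open>k * d\<close> steps, and each moves a coordinate by less than 1 / (n + 1).\<close>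
  define near where "near n x P Q \<longleftrightarrow>
      (\<forall>e. fac e \<notin> {1..k} \<or> pos e > d \<longrightarrow> x e = 0) \<and> (\<forall>e. \<bar>x e\<bar> \<le> 1) \<and>
      (\<forall>i\<in>{1..k}. \<exists>l\<le>d. \<bar>x (Ix i l)\<bar> = 1) \<and>
      (\<forall>s\<in>S. P s \<in> config k d \<and> Q s \<in> config k d \<and> f s (P s) \<le> 0 \<and> f s (Q s) \<ge> 0 \<and>
        (\<forall>e. \<bar>P s e - x e\<bar> \<le> real (k * d) / real (Suc n)) \<and> (\<forall>e. \<bar>Q s e - x e\<bar> \<le> real (k * d) / real (Suc n)))"
    for n :: nat and x :: "idx \<Rightarrow> real" and P Q :: "'s \<Rightarrow> idx \<Rightarrow> real"
  have "\<exists>x P Q. near n x P Q"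
    for n
  proof -
    interpret cube_grid k d "Suc n" by unfold_locales simp
    define R :: "pt \<Rightarrow> idx \<Rightarrow> real" where "R x e = real_of_int (x e) / real (2 * Suc n)" for x e
    have R_config: "R x \<in> config k d" if "x \<in> X" for x
    proof -
      have "\<exists>l\<le>d. R x (Ix i l) \<noteq> 0" if i: "i \<in> {1..k}" for i
        using X_ext[OF \<open>x \<in> X\<close> i] by (force simp: R_def)
      then show ?thesis by (simp add: config_def)
    qed
    have R_flip: "R (flip g x) = rflip g (R x)" for g x
      by (auto simp: R_def flip_def rflip_def)
    \<comment> \<open>At a zero of the function the sum of the \<open>sg i\<close> preserves
      equivariance. The zero itself is both \<le> 0 and \<ge> 0, so the conclusion drawn from a step
      remains true.\<close>
    define s :: "nat \<Rightarrow> pt \<Rightarrow> bit" where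
      "s j x = (if f (b j) (R x) = 0 then \<Sum>i\<in>\<alpha> (b j). sg i x else of_bool (f (b j) (R x) < 0))" for j x
    have eqv: "equivariant (\<alpha> (b j)) (s j)" if j: "j < k * d" for j
      unfolding equivariant_def
    proof (intro allI impI ballI)
      fix g x assume g: "g \<subseteq> {1..k}" and x: "x \<in> X"
      have fl: "f (b j) (R (flip g x)) = (- 1) ^ card (g \<inter> \<alpha> (b j)) * f (b j) (R x)"
        unfolding R_flip by (rule equiv[OF bS[OF j] g R_config[OF x]])
      have sgf: "(\<Sum>i\<in>\<alpha> (b j). sg i (flip g x)) = (\<Sum>i\<in>\<alpha> (b j). sg i x) + of_nat (card (g \<inter> \<alpha> (b j)))"
        using equivariant_sum_sg[OF \<alpha>[OF bS[OF j]]] g x by (simp add: equivariant_def)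
      have par: "(of_nat c :: bit) = of_bool (odd c)" for c :: nat
        by (cases "even c") (auto elim!: evenE oddE)
      show "s j (flip g x) = s j x + of_nat (card (g \<inter> \<alpha> (b j)))"
        unfolding s_def fl sgf par by (cases "even (card (g \<inter> \<alpha> (b j)))") auto
    qed
    have "T (\<lambda>j. cob (s j)) = 1"
      using T_eq_coefficient[of "\<lambda>j. \<alpha> (b j)" s] \<alpha> bS eqv one by simp
    then have "\<exists>x\<in>dom (k * d). A (\<lambda>j. cob (s j)) (k * d) x \<noteq> 0"
      unfolding T_def by (metis (no_types, lifting) sum.neutral zero_neq_one)
    then obtain z where z: "z \<in> X" "A (\<lambda>j. cob (s j)) (k * d) z \<noteq> 0" by (auto simp: dom_def)
    obtain c where c: "\<And>m. m \<le> k * d \<Longrightarrow> c m \<in> X" "\<And>m. m < k * d \<Longrightarrow> cov (c m) (c (Suc m))"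
      "\<And>m. m < k * d \<Longrightarrow> cob (s m) (c m) (c (Suc m)) \<noteq> 0"
      using A_chain[OF z(2,1)] by blast
    have nearR: "\<bar>R (c m) e - R (c 0) e\<bar> \<le> real (k * d) / real (Suc n)" if "m \<le> k * d" for m e
    proof -
      have "\<bar>c m e - c 0 e\<bar> \<le> int m" using chain_dist[of "k * d" c m e] c(2) that by auto
      then have "real_of_int \<bar>c m e - c 0 e\<bar> \<le> real (k * d)" using that
        by (metis (mono_tags, lifting) le_trans of_int_le_iff of_int_of_nat_eq of_nat_le_iff order_trans)
      moreover have "\<bar>R (c m) e - R (c 0) e\<bar> = real_of_int \<bar>c m e - c 0 e\<bar> / real (2 * Suc n)"
        by (simp add: R_def diff_divide_distrib[symmetric])
      ultimately show ?thesis by (simp add: frac_le)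
    qed
    have "\<exists>P Q. P \<in> config k d \<and> Q \<in> config k d \<and> f s (P) \<le> 0 \<and> f s (Q) \<ge> 0 \<and>
        (\<forall>e. \<bar>P e - R (c 0) e\<bar> \<le> real (k * d) / real (Suc n)) \<and> (\<forall>e. \<bar>Q e - R (c 0) e\<bar> \<le> real (k * d) / real (Suc n))"
      if "s \<in> S" for s
    proof -
      obtain j where j: "j < k * d" "s = b j" using b \<open>s \<in> S\<close> by (auto simp: bij_betw_def)
      note conf = R_config[OF c(1)[of j]] R_config[OF c(1)[of "Suc j"]]
      note nr = nearR[of j] nearR[of "Suc j"]
      have "\<not> (f s (R (c j)) < 0 \<and> f s (R (c (Suc j))) < 0)" "\<not> (f s (R (c j)) > 0 \<and> f s (R (c (Suc j))) > 0)"
        using c(3)[OF j(1)] j(2) by (auto simp: cob_def s_def)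
      then consider "f s (R (c j)) \<le> 0" "f s (R (c (Suc j))) \<ge> 0" | "f s (R (c (Suc j))) \<le> 0" "f s (R (c j)) \<ge> 0"
        by linarith
      then show ?thesis
      proof cases
        case 1
        then show ?thesis using conf nr j(1) by (intro exI[of _ "R (c j)"] exI[of _ "R (c (Suc j))"]) auto
      next
        case 2
        then show ?thesis using conf nr j(1) by (intro exI[of _ "R (c (Suc j))"] exI[of _ "R (c j)"]) auto
      qed
    qed
    then obtain P Q where PQ: "\<forall>s\<in>S. P s \<in> config k d \<and> Q s \<in> config k d \<and> f s (P s) \<le> 0 \<and> f s (Q s) \<ge> 0 \<and>
        (\<forall>e. \<bar>P s e - R (c 0) e\<bar> \<le> real (k * d) / real (Suc n)) \<and> (\<forall>e. \<bar>Q s e - R (c 0) e\<bar> \<le> real (k * d) / real (Suc n))"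
      by metis
    have c0: "c 0 \<in> X" using c(1) by simp
    have "R (c 0) e = 0" if "fac e \<notin> {1..k} \<or> pos e > d" for e
    proof -
      have "e \<notin> E" using that by (auto simp: E_def)
      then show ?thesis using c0 by (simp add: R_def X_def)
    qed
    moreover have "\<bar>R (c 0) e\<bar> \<le> 1" for e
    proof -
      have "\<bar>c 0 e\<bar> \<le> 2 * int (Suc n)" using c0 by (cases "e \<in> E") (auto simp: X_def)
      then have "real_of_int \<bar>c 0 e\<bar> \<le> real (2 * Suc n)" by linarith
      then show ?thesis by (simp add: R_def)
    qed
    moreover have "\<exists>l\<le>d. \<bar>R (c 0) (Ix i l)\<bar> = 1" if i: "i \<in> {1..k}" for i
    proof -
      obtain l where "l \<le> d" "\<bar>c 0 (Ix i l)\<bar> = 2 * int (Suc n)" using X_ext[OF c0 i] by blast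
      then have "real_of_int \<bar>c 0 (Ix i l)\<bar> = real (2 * Suc n)" by linarith
      then show ?thesis using \<open>l \<le> d\<close> by (intro exI[of _ l]) (simp add: R_def)
    qed
    ultimately have "near n (R (c 0)) P Q" unfolding near_def using PQ by blast
    then show ?thesis by blast
  qed
  then obtain x P Q where xPQ: "\<And>n. near n (x n) (P n) (Q n)" by metis
  then have x: "\<And>n e. fac e \<notin> {1..k} \<or> pos e > d \<Longrightarrow> x n e = 0" "\<And>n e. \<bar>x n e\<bar> \<le> 1"
      "\<And>n i. i \<in> {1..k} \<Longrightarrow> \<exists>l\<le>d. \<bar>x n (Ix i l)\<bar> = 1"
    and PQ: "\<And>n s. s \<in> S \<Longrightarrow> P n s \<in> config k d" "\<And>n s. s \<in> S \<Longrightarrow> Q n s \<in> config k d"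
      "\<And>n s. s \<in> S \<Longrightarrow> f s (P n s) \<le> 0" "\<And>n s. s \<in> S \<Longrightarrow> f s (Q n s) \<ge> 0"
      "\<And>n s e. s \<in> S \<Longrightarrow> \<bar>P n s e - x n e\<bar> \<le> real (k * d) / real (Suc n)"
      "\<And>n s e. s \<in> S \<Longrightarrow> \<bar>Q n s e - x n e\<bar> \<le> real (k * d) / real (Suc n)"
    unfolding near_def by blast+
  have finE: "finite {e. fac e \<in> {1..k} \<and> pos e \<le> d}"
  proof (rule finite_subset)
    show "{e. fac e \<in> {1..k} \<and> pos e \<le> d} \<subseteq> (\<lambda>(i, l). Ix i l) ` ({1..k} \<times> {..d})"
    proof
      fix e assume "e \<in> {e. fac e \<in> {1..k} \<and> pos e \<le> d}"
      then show "e \<in> (\<lambda>(i, l). Ix i l) ` ({1..k} \<times> {..d})"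
        by (intro image_eqI[of _ _ "(fac e, pos e)"]) auto
    qed
  qed simp
  obtain r where r: "strict_mono r" "\<And>e. fac e \<in> {1..k} \<and> pos e \<le> d \<Longrightarrow> convergent (\<lambda>n. x (r n) e)"
    using bounded_finite_subseq[OF finE, of x] x(2) by auto
  have "convergent (\<lambda>n. x (r n) e)" for e
    using r(2)[of e] x(1)[of e] by (cases "fac e \<in> {1..k} \<and> pos e \<le> d") (auto simp: convergent_const)
  then obtain p where p: "\<And>e. (\<lambda>n. x (r n) e) \<longlonglongrightarrow> p e" unfolding convergent_def by metis
  have p_config: "p \<in> config k d"
    unfolding config_def
  proof (intro CollectI ballI)
    fix i assume i: "i \<in> {1..k}"
    \<comment> \<open>The position of the extreme coordinate may vary with \<open>n\<close>; the
      lower bound on the sum of absolute values passes to the limit.\<close>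
    have "(\<lambda>n. \<Sum>l\<le>d. \<bar>x (r n) (Ix i l)\<bar>) \<longlonglongrightarrow> (\<Sum>l\<le>d. \<bar>p (Ix i l)\<bar>)"
      by (intro tendsto_intros p)
    moreover have "1 \<le> (\<Sum>l\<le>d. \<bar>x (r n) (Ix i l)\<bar>)" for n
    proof -
      obtain l where "l \<le> d" "\<bar>x (r n) (Ix i l)\<bar> = 1" using x(3)[OF i] by blast
      then show ?thesis using member_le_sum[of l "{..d}" "\<lambda>l. \<bar>x (r n) (Ix i l)\<bar>"] by auto
    qed
    ultimately have "1 \<le> (\<Sum>l\<le>d. \<bar>p (Ix i l)\<bar>)"
      by (intro LIMSEQ_le_const) auto
    then show "\<exists>l\<le>d. p (Ix i l) \<noteq> 0" by (metis (no_types, lifting) abs_zero atMost_iff not_one_le_zero sum.neutral)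
  qed
  have small: "(\<lambda>n. real (k * d) / real (Suc (r n))) \<longlonglongrightarrow> 0"
    using LIMSEQ_subseq_LIMSEQ[OF lim_const_over_n[of "real (k * d)", THEN LIMSEQ_Suc] r(1)] by (simp add: o_def)
  have conv: "(\<lambda>n. h (r n) e) \<longlonglongrightarrow> p e" if "\<And>n. \<bar>h n e - x n e\<bar> \<le> real (k * d) / real (Suc n)" for h e
  proof -
    have "(\<lambda>n. h (r n) e - x (r n) e) \<longlonglongrightarrow> 0"
      by (rule Lim_null_comparison[OF _ small]) (use that in auto)
    from tendsto_add[OF this p[of e]] show ?thesis by simp
  qed
  have "f s p = 0" if s: "s \<in> S" for s
  proof (rule antisym)
    have "(\<lambda>n. f s (P (r n) s)) \<longlonglongrightarrow> f s p"
      by (rule cont[OF s _ p_config]) (use PQ s conv[of "\<lambda>n. P n s"] in auto)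
    then show "f s p \<le> 0" using PQ(3)[OF s] by (intro LIMSEQ_le_const2) auto
    have "(\<lambda>n. f s (Q (r n) s)) \<longlonglongrightarrow> f s p"
      by (rule cont[OF s _ p_config]) (use PQ s conv[of "\<lambda>n. Q n s"] in auto)
    then show "0 \<le> f s p" using PQ(4)[OF s] by (intro LIMSEQ_le_const) auto
  qed
  then show ?thesis using p_config by blast
qed

section \<open>The moment curve and the lower bound\<close>

lemma Rspace_iff: "x \<in> Rspace d \<longleftrightarrow> (\<forall>i\<ge>d. x i = 0)"
  by (simp add: topspace_Euclidean_space)

lemma affine_Rspace: "affine (Rspace d)"
  unfolding affine_def by (auto simp: Rspace_iff scaleR_fun_def)

lemma affine_hyperplane: "affine (hyperplane d u c)"
  unfolding affine_def
proof (intro ballI allI impI)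
  fix x y and a b :: real
  assume xy: "x \<in> hyperplane d u c" "y \<in> hyperplane d u c" and ab: "a + b = 1"
  have "(\<Sum>l<d. u l * (a *\<^sub>R x + b *\<^sub>R y) l) = (\<Sum>l<d. a * (u l * x l) + b * (u l * y l))"
    by (rule sum.cong) (simp_all add: scaleR_fun_def algebra_simps)
  also have "\<dots> = a * (\<Sum>l<d. u l * x l) + b * (\<Sum>l<d. u l * y l)"
    by (simp add: sum.distrib sum_distrib_left)
  also have "\<dots> = (a + b) * c" using xy by (simp add: hyperplane_def distrib_right)
  finally show "a *\<^sub>R x + b *\<^sub>R y \<in> hyperplane d u c"
    using xy ab by (simp add: hyperplane_def Rspace_iff scaleR_fun_def)
qed

definition curve :: "nat \<Rightarrow> real \<Rightarrow> nat \<Rightarrow> real" where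
  "curve d t = (\<lambda>j. if j < d then t ^ Suc j else 0)"

definition hpoly :: "nat \<Rightarrow> (nat \<Rightarrow> real) \<Rightarrow> real \<Rightarrow> real poly" where
  "hpoly d u c = pCons (- c) (\<Sum>j<d. monom (u j) j)"

lemma curve_Rspace [simp]: "curve d t \<in> Rspace d"
  by (simp add: Rspace_iff curve_def)

lemma poly_hpoly: "poly (hpoly d u c) t = (\<Sum>j<d. u j * curve d t j) - c"
  by (simp add: hpoly_def curve_def poly_sum poly_monom sum_distrib_left mult_ac)

lemma coeff_sum_monom: "coeff (\<Sum>j<d. monom (u j) j) i = (if i < d then u i else 0)"
  by (simp add: coeff_sum)

lemma hpoly_nonzero: assumes "normal_vector d u" shows "hpoly d u c \<noteq> 0"
proof
  assume "hpoly d u c = 0"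
  then have z: "(\<Sum>j<d. monom (u j) j) = 0" by (simp add: hpoly_def)
  have "u j = 0" for j
  proof (cases "j < d")
    case True
    then show ?thesis using coeff_sum_monom[of u d j] by (simp add: z)
  next
    case False
    then show ?thesis using assms by (simp add: normal_vector_def Rspace_iff)
  qed
  then have "u = 0" by (auto simp: fun_eq_iff)
  then show False using assms by (simp add: normal_vector_def)
qed

lemma degree_hpoly: "degree (hpoly d u c) \<le> d"
  by (rule degree_le) (auto simp: hpoly_def coeff_pCons coeff_sum_monom split: nat.split)

lemma curve_hyperplane_iff: "curve d t \<in> hyperplane d u c \<longleftrightarrow> poly (hpoly d u c) t = 0"
  by (simp add: hyperplane_def poly_hpoly)

lemma
  assumes "normal_vector d u"
  shows finite_curve_hyperplane: "finite {t. curve d t \<in> hyperplane d u c}"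
    and card_curve_hyperplane: "card {t. curve d t \<in> hyperplane d u c} \<le> d"
  using poly_roots_finite[OF hpoly_nonzero[OF assms]] card_poly_roots_bound[OF hpoly_nonzero[OF assms]]
    degree_hpoly[of d u c] by (auto simp: curve_hyperplane_iff intro: le_trans)

lemma poly_eq_hpoly:
  assumes "degree p \<le> d" shows "p = hpoly d (\<lambda>j. coeff p (Suc j)) (- coeff p 0)"
  by (rule poly_eqI)
    (use assms in \<open>auto simp: hpoly_def coeff_pCons coeff_sum_monom coeff_eq_0 split: nat.split\<close>)

lemma inj_curve: assumes "d > 0" shows "inj (curve d)"
proof (rule injI)
  fix x y assume "curve d x = curve d y"
  then have "curve d x 0 = curve d y 0" by simp
  then show "x = y" using assms by (simp add: curve_def)
qed

text \<open>The monic polynomial with root set \<open>S - {t}\<close> has degree at most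
  \<open>d\<close>, so it is an affine functional along the curve; it vanishes at all the points
  except \<open>curve d t\<close>.\<close>

lemma curve_affine_independent:
  assumes "finite S" "card S \<le> Suc d"
  shows "\<not> affine_dependent (curve d ` S)"
proof
  assume "affine_dependent (curve d ` S)"
  then obtain t where t: "t \<in> S" "curve d t \<in> affine hull (curve d ` S - {curve d t})"
    by (auto simp: affine_dependent_def)
  define p where "p = (\<Prod>s\<in>S - {t}. [:- s, 1:])"
  have "degree p = (\<Sum>s\<in>S - {t}. 1)"
    unfolding p_def by (subst degree_prod_eq_sum_degree) auto
  then have deg: "degree p \<le> d" using assms t by (simp add: card_Diff_singleton)
  let ?u = "\<lambda>j. coeff p (Suc j)" and ?c = "- coeff p 0"
  have mem: "curve d s \<in> hyperplane d ?u ?c \<longleftrightarrow> poly p s = 0" for s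
    unfolding curve_hyperplane_iff using poly_eq_hpoly[OF deg] by simp
  have "curve d ` S - {curve d t} \<subseteq> hyperplane d ?u ?c"
  proof
    fix x assume "x \<in> curve d ` S - {curve d t}"
    then obtain s where s: "s \<in> S - {t}" "x = curve d s" by auto
    then have "poly p s = 0" using assms(1) by (auto simp: p_def poly_prod)
    then show "x \<in> hyperplane d ?u ?c" using mem s(2) by simp
  qed
  then have "affine hull (curve d ` S - {curve d t}) \<subseteq> hyperplane d ?u ?c"
    by (rule hull_minimal) (rule affine_hyperplane)
  then have "poly p t = 0" using t(2) mem by blast
  then show False using assms(1) by (auto simp: p_def poly_prod)
qed

section \<open>Masses on the moment curve and their crossings\<close>

definition curve_measure :: "nat \<Rightarrow> real \<Rightarrow> (nat \<Rightarrow> real) measure" where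
  "curve_measure d s = distr (restrict_space lborel {s..s + 1}) (restrict_space borel (Rspace d)) (curve d)"

lemma measurable_curve [measurable]: "curve d \<in> borel \<rightarrow>\<^sub>M restrict_space borel (Rspace d)"
proof (rule measurable_restrict_space2)
  have "continuous_on UNIV (\<lambda>t. curve d t j)" for j
    by (cases "j < d") (auto simp: curve_def intro!: continuous_intros)
  then show "curve d \<in> borel_measurable borel"
    by (intro borel_measurable_continuous_onI continuous_on_coordinatewise_then_product)
qed auto

lemma borel_measurable_linear:
  "(\<lambda>x :: nat \<Rightarrow> real. \<Sum>l<d. u l * x l) \<in> borel_measurable borel"
  by (intro borel_measurable_continuous_onI continuous_intros continuous_on_product_coordinates)

lemma borel_measurable_linear_restrict [measurable]:
  "(\<lambda>x :: nat \<Rightarrow> real. \<Sum>l<d. u l * x l) \<in> borel_measurable (restrict_space borel A)"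
  by (rule measurable_restrict_space1[OF borel_measurable_linear])

lemma hyperplane_sets: "hyperplane d u c \<in> sets (restrict_space borel (Rspace d))"
proof -
  have "hyperplane d u c = {x \<in> space (restrict_space borel (Rspace d)). (\<Sum>l<d. u l * x l) = c}"
    by (auto simp: hyperplane_def space_restrict_space)
  also have "\<dots> \<in> sets (restrict_space borel (Rspace d))" by measurable
  finally show ?thesis .
qed

lemma halfspace_sets: "halfspace d u c g \<in> sets (restrict_space borel (Rspace d))"
proof -
  let ?M = "restrict_space borel (Rspace d) :: (nat \<Rightarrow> real) measure"
  have "{x \<in> space ?M. (\<Sum>l<d. u l * x l) \<ge> c} \<in> sets ?M" "{x \<in> space ?M. (\<Sum>l<d. u l * x l) \<le> c} \<in> sets ?M"
    by measurable
  then show ?thesis by (cases g) (simp_all add: halfspace_def space_restrict_space)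
qed

lemma measurable_curve_restrict:
  "curve d \<in> restrict_space lborel A \<rightarrow>\<^sub>M restrict_space borel (Rspace d)"
  by (rule measurable_restrict_space1) simp

lemma emeasure_curve_measure:
  assumes "B \<in> sets (restrict_space borel (Rspace d))"
  shows "emeasure (curve_measure d s) B = emeasure lborel (curve d -` B \<inter> {s..s + 1})"
proof -
  have "emeasure (curve_measure d s) B =
      emeasure (restrict_space lborel {s..s + 1}) (curve d -` B \<inter> space (restrict_space lborel {s..s + 1}))"
    unfolding curve_measure_def by (rule emeasure_distr[OF measurable_curve_restrict assms])
  also have "\<dots> = emeasure lborel (curve d -` B \<inter> {s..s + 1})"
    by (subst emeasure_restrict_space) (auto simp: space_restrict_space)
  finally show ?thesis .
qed

lemma emeasure_curve_measure_space: "emeasure (curve_measure d s) (Rspace d) = 1"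
proof -
  have "Rspace d \<in> sets (restrict_space borel (Rspace d))"
    using sets.top[of "restrict_space borel (Rspace d)"] by (simp add: space_restrict_space)
  moreover have "curve d -` Rspace d = UNIV" by auto
  ultimately show ?thesis by (simp add: emeasure_curve_measure)
qed

lemma sets_curve_measure: "sets (curve_measure d s) = sets (restrict_space borel (Rspace d))"
  by (simp add: curve_measure_def)

lemma space_curve_measure: "space (curve_measure d s) = Rspace d"
  by (simp add: curve_measure_def space_restrict_space)

lemma mass_curve_measure: "mass d (curve_measure d s)"
  unfolding mass_def
proof (intro conjI allI impI)
  show "sets (curve_measure d s) = sets (restrict_space borel (Rspace d))" by (rule sets_curve_measure)
  show "finite_measure (curve_measure d s)"
    by (rule finite_measureI) (simp add: space_curve_measure emeasure_curve_measure_space)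
  fix u c assume u: "normal_vector d u"
  have "curve d -` hyperplane d u c \<inter> {s..s + 1} \<subseteq> {t. curve d t \<in> hyperplane d u c}" by auto
  then have "finite (curve d -` hyperplane d u c \<inter> {s..s + 1})"
    using finite_curve_hyperplane[OF u] finite_subset by blast
  then show "emeasure (curve_measure d s) (hyperplane d u c) = 0"
    by (simp add: emeasure_curve_measure[OF hyperplane_sets] emeasure_lborel_countable countable_finite)
qed

text \<open>Every open orthant must contain a piece of the segment, and a time
  \<open>\<tau> G\<close> is chosen in each. Between two such times some \<open>h l\<close> has a
  zero, so distinct orthants have distinct numbers of crossings before their times. These numbers
  lie in 0, ..., \<open>card \<Theta>\<close>, whence the \<open>+ 1\<close>.\<close>

lemma card_crossings:
  assumes I: "finite I" and u: "\<And>l. l \<in> I \<Longrightarrow> normal_vector d (u l)"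
    and eq: "equipartition d I u c (curve_measure d s)"
  shows "2 ^ card I \<le> (\<Sum>l\<in>I. card {t\<in>{s..s + 1}. curve d t \<in> hyperplane d (u l) (c l)}) + 1"
proof -
  define h where "h l t = poly (hpoly d (u l) (c l)) t" for l t
  have h: "h l t = (\<Sum>j<d. u l j * curve d t j) - c l" for l t by (simp add: h_def poly_hpoly)
  have cont: "continuous_on A (h l)" for A l
    unfolding h_def[abs_def] by (intro continuous_intros)
  define Z where "Z l = {t\<in>{s..s + 1}. curve d t \<in> hyperplane d (u l) (c l)}" for l
  define \<Theta> where "\<Theta> = (\<Union>l\<in>I. Z l)"
  have finZ: "finite (Z l)" if "l \<in> I" for l
    by (rule finite_subset[OF _ finite_curve_hyperplane[OF u[OF that], of "c l"]]) (auto simp: Z_def)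
  have fin\<Theta>: "finite \<Theta>" using I finZ by (simp add: \<Theta>_def)
  have Ziff: "t \<in> Z l \<longleftrightarrow> t \<in> {s..s + 1} \<and> h l t = 0" for l t
    by (simp add: Z_def h_def curve_hyperplane_iff)
  have "\<exists>t\<in>{s..s + 1} - \<Theta>. \<forall>l\<in>I. (l \<in> G \<longrightarrow> h l t > 0) \<and> (l \<notin> G \<longrightarrow> h l t < 0)" for G
  proof (rule ccontr)
    assume no: "\<not> ?thesis"
    let ?B = "\<Inter>l\<in>I. halfspace d (u l) (c l) (l \<in> G)"
    have m: "measure (curve_measure d s) ?B = 1 / 2 ^ card I"
      using eq by (simp add: equipartition_def measure_def emeasure_curve_measure_space)
    have "curve d -` ?B \<inter> {s..s + 1} \<subseteq> \<Theta>"
    proof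
      fix t assume t: "t \<in> curve d -` ?B \<inter> {s..s + 1}"
      then have sg: "if l \<in> G then h l t \<ge> 0 else h l t \<le> 0" if "l \<in> I" for l
      proof -
        have "curve d t \<in> halfspace d (u l) (c l) (l \<in> G)" using t that by blast
        then show ?thesis by (auto simp: halfspace_def h split: if_splits)
      qed
      show "t \<in> \<Theta>"
      proof (rule ccontr)
        assume "t \<notin> \<Theta>"
        then have "h l t \<noteq> 0" if "l \<in> I" for l using that t Ziff by (auto simp: \<Theta>_def)
        then have "\<forall>l\<in>I. (l \<in> G \<longrightarrow> h l t > 0) \<and> (l \<notin> G \<longrightarrow> h l t < 0)"
          using sg by (metis less_eq_real_def)
        then show False using no t \<open>t \<notin> \<Theta>\<close> by blast
      qed
    qed
    then have fin: "finite (curve d -` ?B \<inter> {s..s + 1})" using fin\<Theta> finite_subset by blast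
    show False
    \<comment> \<open>For \<open>I = {}\<close> the intersection is \<open>UNIV\<close>, outside the
      sigma-algebra; its measure then defaults to 0 and still contradicts \<open>m\<close>.\<close>
    proof (cases "?B \<in> sets (restrict_space borel (Rspace d))")
      case True
      then have "emeasure (curve_measure d s) ?B = 0"
        using fin by (simp add: emeasure_curve_measure emeasure_lborel_countable countable_finite)
      then show False using m by (simp add: measure_def)
    next
      case False
      then show False using m by (simp add: measure_def emeasure_notin_sets sets_curve_measure)
    qed
  qed
  then obtain \<tau> where \<tau>: "\<And>G. \<tau> G \<in> {s..s + 1} - \<Theta>"
    "\<And>G l. l \<in> I \<Longrightarrow> l \<in> G \<Longrightarrow> h l (\<tau> G) > 0" "\<And>G l. l \<in> I \<Longrightarrow> l \<notin> G \<Longrightarrow> h l (\<tau> G) < 0"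
    by metis
  have sub: "{\<theta>\<in>\<Theta>. \<theta> < \<tau> G} \<subset> {\<theta>\<in>\<Theta>. \<theta> < \<tau> G'}" if G: "G \<in> Pow I" "G' \<in> Pow I" "G \<noteq> G'" "\<tau> G \<le> \<tau> G'" for G G'
  proof -
    obtain l where l: "l \<in> I" "(l \<in> G) \<noteq> (l \<in> G')" using G(1-3) by blast
    have sgn: "h l (\<tau> G) * h l (\<tau> G') < 0"
      using l \<tau>(2,3)[OF l(1)] by (cases "l \<in> G") (simp_all add: mult_less_0_iff)
    obtain x where x: "\<tau> G \<le> x" "x \<le> \<tau> G'" "h l x = 0"
    proof (cases "h l (\<tau> G) < 0")
      case True
      then have "h l (\<tau> G') > 0" using sgn by (simp add: mult_less_0_iff)
      then show ?thesis using that True IVT'[of "h l" "\<tau> G" 0 "\<tau> G'"] G(4) cont by auto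
    next
      case False
      then have "h l (\<tau> G') < 0" "h l (\<tau> G) > 0" using sgn by (auto simp: mult_less_0_iff)
      then show ?thesis using that IVT2'[of "h l" "\<tau> G'" 0 "\<tau> G"] G(4) cont by auto
    qed
    have "x \<in> {s..s + 1}" using x \<tau>(1)[of G] \<tau>(1)[of G'] by auto
    then have x\<Theta>: "x \<in> \<Theta>" using l(1) x(3) Ziff by (auto simp: \<Theta>_def)
    then have "x < \<tau> G'" using x(2) \<tau>(1)[of G'] by (metis DiffE less_eq_real_def)
    then have "x \<in> {\<theta>\<in>\<Theta>. \<theta> < \<tau> G'}" "x \<notin> {\<theta>\<in>\<Theta>. \<theta> < \<tau> G}" using x\<Theta> x(1) by auto
    moreover have "{\<theta>\<in>\<Theta>. \<theta> < \<tau> G} \<subseteq> {\<theta>\<in>\<Theta>. \<theta> < \<tau> G'}" using G(4) by auto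
    ultimately show ?thesis by blast
  qed
  define N where "N G = card {\<theta>\<in>\<Theta>. \<theta> < \<tau> G}" for G
  have "inj_on N (Pow I)"
  proof (rule inj_onI, rule ccontr)
    fix G G' assume G: "G \<in> Pow I" "G' \<in> Pow I" "N G = N G'" "G \<noteq> G'"
    consider "\<tau> G \<le> \<tau> G'" | "\<tau> G' \<le> \<tau> G" by linarith
    then show False
    proof cases
      case 1
      then have "N G < N G'" unfolding N_def using fin\<Theta> sub[OF G(1,2,4)] by (intro psubset_card_mono) auto
      then show ?thesis using G by simp
    next
      case 2
      then have "N G' < N G" unfolding N_def using fin\<Theta> sub[OF G(2,1) G(4)[symmetric]] by (intro psubset_card_mono) auto
      then show ?thesis using G by simp
    qed
  qed
  moreover have "N ` Pow I \<subseteq> {..card \<Theta>}"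
    using fin\<Theta> by (auto simp: N_def intro!: card_mono)
  ultimately have "card (Pow I) \<le> card {..card \<Theta>}" by (metis card_inj_on_le finite_atMost)
  then have "2 ^ card I \<le> card \<Theta> + 1" using I by (simp add: card_Pow)
  also have "card \<Theta> \<le> (\<Sum>l\<in>I. card (Z l))" unfolding \<Theta>_def by (rule card_UN_le[OF I])
  finally show ?thesis by (simp add: Z_def)
qed

theorem lower_bound:
  assumes "admissible_dim m a k d"
  shows "C_bound m a k \<le> k * d"
proof -
  \<comment> \<open>Even starting points keep the closed unit segments disjoint; being nonnegative,
    they also avoid the points that span the affine subspaces, whose parameters are
    negative.\<close>
  define st where "st i j = real (2 * prod_encode (i, j))" for i j
  define neg where "neg i = (\<lambda>j. - real (Suc j)) ` {..<a i}" for i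
  define B where "B i = curve d ` neg i" for i
  have ad: "a i \<le> d" if "i \<in> {1..k}" for i using assms that by (simp add: admissible_dim_def)
  have neg: "finite (neg i)" "card (neg i) = a i" for i
    by (auto simp: neg_def card_image inj_on_def)
  have aff: "affine_subspace d (int (a i) - 1) (affine hull (B i))" if i: "i \<in> {1..k}" for i
    unfolding affine_subspace_def
  proof (intro conjI exI[of _ "B i"])
    show "affine hull (B i) \<subseteq> Rspace d"
      by (rule hull_minimal) (auto simp: B_def affine_Rspace)
    show "\<not> affine_dependent (B i)"
      unfolding B_def by (rule curve_affine_independent) (use neg ad[OF i] in auto)
    have "card (B i) = a i"
    proof (cases "d = 0")
      case True
      then show ?thesis using ad[OF i] neg by (simp add: B_def neg_def)
    next
      case False
      then show ?thesis unfolding B_def using neg inj_curve[of d] by (subst card_image) (auto intro: inj_on_subset)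
    qed
    then show "int (card (B i)) = int (a i) - 1 + 1" by simp
  qed (use neg in \<open>auto simp: B_def\<close>)
  obtain u c where u: "\<And>i. i \<in> {1..k} \<Longrightarrow> normal_vector d (u i)"
    "\<And>i. i \<in> {1..k} \<Longrightarrow> affine hull (B i) \<subseteq> hyperplane d (u i) (c i)"
    "\<And>i j. i \<in> {1..k} \<Longrightarrow> j \<in> {1..m i} \<Longrightarrow> equipartition d {i..k} u c (curve_measure d (st i j))"
    using assms aff mass_curve_measure unfolding admissible_dim_def
    by (elim conjE allE[of _ "\<lambda>i j. curve_measure d (st i j)"] allE[of _ "\<lambda>i. affine hull (B i)"]) blast
  define Z where "Z l = {t. curve d t \<in> hyperplane d (u l) (c l)}" for l
  define Y where "Y l i j = {t\<in>{st i j..st i j + 1}. curve d t \<in> hyperplane d (u l) (c l)}" for l i j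
  define P where "P = Sigma {1..k} (\<lambda>i. {1..m i})"
  have finZ: "finite (Z l)" "card (Z l) \<le> d" if "l \<in> {1..k}" for l
    using finite_curve_hyperplane card_curve_hyperplane u(1)[OF that] by (auto simp: Z_def)
  have Yfin: "finite (Y l i j)" if "l \<in> {1..k}" for l i j
    by (rule finite_subset[OF _ finZ(1)[OF that]]) (auto simp: Y_def Z_def)
  have negZ: "neg l \<subseteq> Z l" if "l \<in> {1..k}" for l
  proof -
    have "B l \<subseteq> hyperplane d (u l) (c l)" using u(2)[OF that] hull_subset[of "B l" affine] by blast
    then show ?thesis by (auto simp: B_def Z_def)
  qed
  have disj: "Y l i j \<inter> Y l i' j' = {}" if "(i, j) \<noteq> (i', j')" for l i j i' j'
  proof -
    have "prod_encode (i, j) \<noteq> prod_encode (i', j')" using that by simp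
    then consider "prod_encode (i, j) + 1 \<le> prod_encode (i', j')" | "prod_encode (i', j') + 1 \<le> prod_encode (i, j)"
      by linarith
    then have "st i j + 2 \<le> st i' j' \<or> st i' j' + 2 \<le> st i j"
      by cases (auto simp: st_def)
    then show ?thesis by (auto simp: Y_def)
  qed
  have le: "a l + (\<Sum>(i, j)\<in>P. card (Y l i j)) \<le> d" if l: "l \<in> {1..k}" for l
  proof -
    let ?U = "\<Union>(i, j)\<in>P. Y l i j"
    have finP: "finite P" by (simp add: P_def)
    have "card ?U = (\<Sum>(i, j)\<in>P. card (Y l i j))"
      using card_UN_disjoint[of P "\<lambda>(i, j). Y l i j"] finP Yfin[OF l] disj
      by (auto simp: case_prod_unfold prod_eq_iff)
    moreover have "neg l \<inter> ?U = {}" by (auto simp: neg_def Y_def st_def)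
    moreover have "finite ?U" using finP Yfin[OF l] by auto
    ultimately have "a l + (\<Sum>(i, j)\<in>P. card (Y l i j)) = card (neg l \<union> ?U)"
      using neg by (simp add: card_Un_disjoint)
    also have "\<dots> \<le> card (Z l)"
      using negZ[OF l] by (intro card_mono finZ(1)[OF l]) (auto simp: Y_def Z_def)
    finally show ?thesis using finZ(2)[OF l] by simp
  qed
  have cr: "2 ^ (k - i + 1) - 1 \<le> (\<Sum>l\<in>{1..k}. card (Y l i j))" if "(i, j) \<in> P" for i j
  proof -
    have ij: "i \<in> {1..k}" "j \<in> {1..m i}" using that by (auto simp: P_def)
    have "2 ^ card {i..k} \<le> (\<Sum>l\<in>{i..k}. card (Y l i j)) + 1"
      unfolding Y_def by (rule card_crossings) (use u(1) u(3)[OF ij] ij in auto)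
    moreover have "(\<Sum>l\<in>{i..k}. card (Y l i j)) \<le> (\<Sum>l\<in>{1..k}. card (Y l i j))"
      by (rule sum_mono2) (use ij in auto)
    ultimately show ?thesis using ij by (simp add: Suc_diff_le)
  qed
  have "C_bound m a k = (\<Sum>l\<in>{1..k}. a l) + (\<Sum>(i, j)\<in>P. 2 ^ (k - i + 1) - 1)"
    by (simp add: C_bound_def P_def sum.Sigma[symmetric] sum.distrib add.commute)
  also have "\<dots> \<le> (\<Sum>l\<in>{1..k}. a l) + (\<Sum>(i, j)\<in>P. \<Sum>l\<in>{1..k}. card (Y l i j))"
    by (intro add_left_mono sum_mono) (use cr in auto)
  also have "(\<Sum>(i, j)\<in>P. \<Sum>l\<in>{1..k}. card (Y l i j)) = (\<Sum>l\<in>{1..k}. \<Sum>(i, j)\<in>P. card (Y l i j))"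
    by (simp add: case_prod_unfold sum.swap[of _ P])
  also have "(\<Sum>l\<in>{1..k}. a l) + \<dots> = (\<Sum>l\<in>{1..k}. a l + (\<Sum>(i, j)\<in>P. card (Y l i j)))"
    by (simp add: sum.distrib)
  also have "\<dots> \<le> (\<Sum>l\<in>{1..k}. d)" by (rule sum_mono) (use le in auto)
  finally show ?thesis by simp
qed

section \<open>Equipartitions and the upper bound\<close>

text \<open>
  In a point \<open>p\<close> of \<^term>\<open>config k d\<close>, the coordinates \<open>Ix l j\<close> with \<open>j < d\<close> are the normal vector of the
  \<open>l\<close>-th hyperplane and \<open>Ix l d\<close> is its constant; a vanishing normal vector is allowed.
\<close>

definition lf :: "nat \<Rightarrow> (idx \<Rightarrow> real) \<Rightarrow> nat \<Rightarrow> (nat \<Rightarrow> real) \<Rightarrow> real" where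
  "lf d p l x = (\<Sum>j<d. p (Ix l j) * x j) - p (Ix l d)"

text \<open>The Fourier coefficient, at the character \<open>\<alpha>\<close>, of the function that
  assigns to each orthant its mass.\<close>

definition sgn_integral :: "nat \<Rightarrow> (nat \<Rightarrow> real) measure \<Rightarrow> nat set \<Rightarrow> (idx \<Rightarrow> real) \<Rightarrow> real" where
  "sgn_integral d \<mu> \<alpha> p = (\<integral>x. (\<Prod>l\<in>\<alpha>. sgn (lf d p l x)) \<partial>\<mu>)"

lemma lf_rflip: "lf d (rflip g p) l x = (if l \<in> g then - lf d p l x else lf d p l x)"
  by (simp add: lf_def rflip_def sum_negf)

lemma sgn_integral_rflip:
  assumes "finite \<alpha>"
  shows "sgn_integral d \<mu> \<alpha> (rflip g p) = (- 1) ^ card (g \<inter> \<alpha>) * sgn_integral d \<mu> \<alpha> p"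
proof -
  have "(\<Prod>l\<in>\<alpha>. sgn (lf d (rflip g p) l x)) = (- 1) ^ card (g \<inter> \<alpha>) * (\<Prod>l\<in>\<alpha>. sgn (lf d p l x))" for x
  proof -
    have "(\<Prod>l\<in>\<alpha>. sgn (lf d (rflip g p) l x)) = (\<Prod>l\<in>\<alpha>. (if l \<in> g then - 1 else 1) * sgn (lf d p l x))"
      by (rule prod.cong) (auto simp: lf_rflip sgn_minus)
    also have "\<dots> = (\<Prod>l\<in>\<alpha>. if l \<in> g then - 1 else 1) * (\<Prod>l\<in>\<alpha>. sgn (lf d p l x))"
      by (rule prod.distrib)
    also have "(\<Prod>l\<in>\<alpha>. if l \<in> g then - 1 else 1) = (- 1 :: real) ^ card (g \<inter> \<alpha>)"
      using assms by (simp add: prod.If_cases Int_commute)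
    finally show ?thesis .
  qed
  then show ?thesis by (simp add: sgn_integral_def)
qed

context
  fixes d :: nat and \<mu> :: "(nat \<Rightarrow> real) measure"
  assumes mass: "mass d \<mu>"
begin

lemma sets_mass: "sets \<mu> = sets (restrict_space borel (Rspace d))"
  using mass by (simp add: mass_def)

lemma space_mass: "space \<mu> = Rspace d"
  using sets_eq_imp_space_eq[OF sets_mass] by (simp add: space_restrict_space)

lemma finite_measure_mass: "finite_measure \<mu>"
  using mass by (simp add: mass_def)

lemma measurable_lf [measurable]: "lf d p l \<in> borel_measurable \<mu>"
proof -
  have "(\<lambda>x. \<Sum>j<d. p (Ix l j) * x j) \<in> borel_measurable (restrict_space borel (Rspace d))"
    by (rule borel_measurable_linear_restrict)
  then have "(\<lambda>x. \<Sum>j<d. p (Ix l j) * x j) \<in> borel_measurable \<mu>"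
    using measurable_cong_sets[OF sets_mass refl] by blast
  then show ?thesis unfolding lf_def[abs_def] by measurable
qed

text \<open>The zeros of \<open>lf\<close> form a hyperplane, or there are none because the normal
  vector vanishes and the constant does not.\<close>

lemma AE_lf_nonzero:
  assumes "\<exists>j\<le>d. p (Ix l j) \<noteq> 0"
  shows "AE x in \<mu>. lf d p l x \<noteq> 0"
proof (cases "\<exists>j<d. p (Ix l j) \<noteq> 0")
  case True
  define u where "u j = (if j < d then p (Ix l j) else 0)" for j
  have "normal_vector d u"
    using True by (auto simp: normal_vector_def Rspace_iff u_def fun_eq_iff)
  then have "emeasure \<mu> (hyperplane d u (p (Ix l d))) = 0" using mass by (simp add: mass_def)
  then have null: "hyperplane d u (p (Ix l d)) \<in> null_sets \<mu>"
    using hyperplane_sets[of d u "p (Ix l d)"] by (simp add: null_sets_def sets_mass)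
  show ?thesis
  proof (rule AE_I'[OF null])
    show "{x \<in> space \<mu>. \<not> lf d p l x \<noteq> 0} \<subseteq> hyperplane d u (p (Ix l d))"
      by (auto simp: space_mass hyperplane_def lf_def u_def)
  qed
next
  case False
  then have "p (Ix l d) \<noteq> 0" using assms by (metis le_neq_implies_less)
  then show ?thesis using False by (simp add: lf_def)
qed

text \<open>The sign is discontinuous only at 0, a value that the limiting \<open>lf\<close> takes
  on a null set; dominated convergence applies.\<close>

lemma tendsto_sgn_integral:
  assumes \<alpha>: "\<alpha> \<subseteq> {1..k}" and p: "p \<in> config k d" and P: "\<And>e. (\<lambda>n. P n e) \<longlonglongrightarrow> p e"
  shows "(\<lambda>n. sgn_integral d \<mu> \<alpha> (P n)) \<longlonglongrightarrow> sgn_integral d \<mu> \<alpha> p"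
proof -
  interpret finite_measure \<mu> by (rule finite_measure_mass)
  have fin: "finite \<alpha>" using \<alpha> finite_subset by blast
  have "AE x in \<mu>. \<forall>l\<in>\<alpha>. lf d p l x \<noteq> 0"
    using fin \<alpha> p by (subst AE_finite_all) (auto intro!: AE_lf_nonzero simp: config_def)
  then have "AE x in \<mu>. (\<lambda>n. \<Prod>l\<in>\<alpha>. sgn (lf d (P n) l x)) \<longlonglongrightarrow> (\<Prod>l\<in>\<alpha>. sgn (lf d p l x))"
  proof eventually_elim
    case (elim x)
    have "(\<lambda>n. lf d (P n) l x) \<longlonglongrightarrow> lf d p l x" for l
      unfolding lf_def by (intro tendsto_intros P)
    then show ?case using elim by (intro tendsto_prod tendsto_sgn) auto
  qed
  moreover have "AE x in \<mu>. norm (\<Prod>l\<in>\<alpha>. sgn (lf d (P n) l x)) \<le> 1" for n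
    by (auto simp: abs_prod abs_sgn_eq intro!: prod_le_1)
  ultimately show ?thesis
    unfolding sgn_integral_def by (intro integral_dominated_convergence[where w = "\<lambda>_. 1"]) auto
qed

text \<open>
  Fourier inversion on the group of sign vectors: the indicator of an orthant is almost everywhere the
  product of the \<open>(1 + \<epsilon> l * sgn (lf l)) / 2\<close>.
\<close>

lemma equipartition_if_sgn_integral_0:
  assumes I: "I \<subseteq> {1..k}" and p: "p \<in> config k d"
    and zero: "\<And>\<alpha>. \<alpha> \<subseteq> I \<Longrightarrow> \<alpha> \<noteq> {} \<Longrightarrow> sgn_integral d \<mu> \<alpha> p = 0"
    and ne: "I \<noteq> {}"
  shows "equipartition d I (\<lambda>l j. if j < d then p (Ix l j) else 0) (\<lambda>l. p (Ix l d)) \<mu>"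
  unfolding equipartition_def
proof
  fix g :: "nat \<Rightarrow> bool"
  interpret finite_measure \<mu> by (rule finite_measure_mass)
  have fin: "finite I" using I finite_subset by blast
  define \<epsilon> where "\<epsilon> l = (if g l then 1 else - 1 :: real)" for l
  let ?H = "\<lambda>l. halfspace d (\<lambda>j. if j < d then p (Ix l j) else 0) (p (Ix l d)) (g l)"
  let ?B = "\<Inter>l\<in>I. ?H l"
  have B: "?B \<in> sets \<mu>"
    unfolding sets_mass using fin ne by (intro sets.finite_INT halfspace_sets)
  have "AE x in \<mu>. \<forall>l\<in>I. lf d p l x \<noteq> 0"
    using fin I p by (subst AE_finite_all) (auto intro!: AE_lf_nonzero simp: config_def)
  then have ae: "AE x in \<mu>. indicator ?B x = (\<Prod>l\<in>I. 1 / 2 + (\<epsilon> l * sgn (lf d p l x)) / 2)"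
  proof (rule AE_mp, intro AE_I2 impI)
    fix x assume x: "x \<in> space \<mu>" and nz: "\<forall>l\<in>I. lf d p l x \<noteq> 0"
    have "indicator (?H l) x = 1 / 2 + (\<epsilon> l * sgn (lf d p l x)) / 2" if "l \<in> I" for l
      using nz that x by (auto simp: indicator_def halfspace_def space_mass lf_def \<epsilon>_def sgn_if)
    then have "(\<Prod>l\<in>I. indicator (?H l) x) = (\<Prod>l\<in>I. 1 / 2 + (\<epsilon> l * sgn (lf d p l x)) / 2)"
      by (intro prod.cong) auto
    moreover have "indicator ?B x = (\<Prod>l\<in>I. indicator (?H l) x :: real)"
      using fin by (auto simp: indicator_def prod_zero_iff)
    ultimately show "indicator ?B x = (\<Prod>l\<in>I. 1 / 2 + (\<epsilon> l * sgn (lf d p l x)) / 2)" by simp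
  qed
  have int: "integrable \<mu> (\<lambda>x. \<Prod>l\<in>\<alpha>. sgn (lf d p l x))" for \<alpha>
    by (rule integrable_const_bound[of _ 1]) (auto simp: abs_prod abs_sgn_eq intro!: prod_le_1)
  have expand: "(\<Prod>l\<in>I. 1 / 2 + (\<epsilon> l * sgn (lf d p l x)) / 2) =
      (\<Sum>\<alpha>\<in>Pow I. (1 / 2) ^ card I * (\<Prod>l\<in>\<alpha>. \<epsilon> l) * (\<Prod>l\<in>\<alpha>. sgn (lf d p l x)))" for x
  proof -
    have "(\<Prod>l\<in>I. 1 / 2 + (\<epsilon> l * sgn (lf d p l x)) / 2) =
        (\<Prod>l\<in>I. 1 / 2 * (\<epsilon> l * sgn (lf d p l x) + 1))"
      by (rule prod.cong) (auto simp: field_simps)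
    also have "\<dots> = (1 / 2) ^ card I * (\<Prod>l\<in>I. \<epsilon> l * sgn (lf d p l x) + 1)"
      by (simp only: prod.distrib prod_constant)
    also have "(\<Prod>l\<in>I. \<epsilon> l * sgn (lf d p l x) + 1) = (\<Sum>\<alpha>\<in>Pow I. \<Prod>l\<in>\<alpha>. \<epsilon> l * sgn (lf d p l x))"
      by (simp add: prod_add[OF fin])
    finally show ?thesis by (simp add: sum_distrib_left prod.distrib mult.assoc)
  qed
  have "measure \<mu> ?B = (\<integral>x. indicator ?B x \<partial>\<mu>)"
    using B by simp
  also have "\<dots> = (\<integral>x. (\<Prod>l\<in>I. 1 / 2 + (\<epsilon> l * sgn (lf d p l x)) / 2) \<partial>\<mu>)"
    by (rule integral_cong_AE) (use B ae in \<open>auto\<close>)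
  also have "\<dots> = (\<Sum>\<alpha>\<in>Pow I. (1 / 2) ^ card I * (\<Prod>l\<in>\<alpha>. \<epsilon> l) * sgn_integral d \<mu> \<alpha> p)"
    unfolding expand by (subst Bochner_Integration.integral_sum) (auto simp: int sgn_integral_def)
  also have "\<dots> = (\<Sum>\<alpha>\<in>{{}}. (1 / 2) ^ card I * (\<Prod>l\<in>\<alpha>. \<epsilon> l) * sgn_integral d \<mu> \<alpha> p)"
    by (rule sum.mono_neutral_right) (use fin zero in auto)
  also have "\<dots> = measure \<mu> (Rspace d) / 2 ^ card I"
    by (simp add: sgn_integral_def space_mass power_divide)
  finally show "measure \<mu> ?B = measure \<mu> (Rspace d) / 2 ^ card I" .
qed

text \<open>A vanishing normal vector would make the sign constant, and the integral plus or minus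
  the total mass.\<close>

lemma normal_if_sgn_integral_0:
  assumes pos: "measure \<mu> (Rspace d) \<noteq> 0" and p: "\<exists>j\<le>d. p (Ix l j) \<noteq> 0"
    and zero: "sgn_integral d \<mu> {l} p = 0"
  shows "normal_vector d (\<lambda>j. if j < d then p (Ix l j) else 0)"
proof -
  have "\<exists>j<d. p (Ix l j) \<noteq> 0"
  proof (rule ccontr)
    assume no: "\<not> ?thesis"
    then have "p (Ix l d) \<noteq> 0" using p by (metis le_neq_implies_less)
    moreover have "sgn_integral d \<mu> {l} p = sgn (- p (Ix l d)) * measure \<mu> (Rspace d)"
      using no by (simp add: sgn_integral_def lf_def space_mass)
    ultimately show False using pos zero by (simp add: sgn_zero_iff)
  qed
  then show ?thesis by (auto simp: normal_vector_def Rspace_iff fun_eq_iff)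
qed

end

section \<open>The system of constraints and admissibility\<close>

lemma equipartition_null:
  assumes "mass d \<mu>" "measure \<mu> (Rspace d) = 0" "finite I" "I \<noteq> {}"
  shows "equipartition d I u c \<mu>"
  unfolding equipartition_def
proof
  fix g :: "nat \<Rightarrow> bool"
  interpret finite_measure \<mu> by (rule finite_measure_mass[OF assms(1)])
  have "measure \<mu> (\<Inter>i\<in>I. halfspace d (u i) (c i) (g i)) \<le> measure \<mu> (space \<mu>)"
    by (rule bounded_measure)
  then show "measure \<mu> (\<Inter>i\<in>I. halfspace d (u i) (c i) (g i)) = measure \<mu> (Rspace d) / 2 ^ card I"
    using assms(2) space_mass[OF assms(1)] by (simp add: measure_le_0_iff)
qed

text \<open>
  The triple \<open>(i, j, \<alpha>)\<close> stands for the sign integral over \<open>\<alpha>\<close> of the \<open>j\<close>-th mass if \<open>j \<le> m i\<close>, and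
  otherwise for the incidence of the \<open>i\<close>-th hyperplane with the point number \<open>j - m i\<close> spanning \<open>A i\<close>.
\<close>

definition constraints :: "(nat \<Rightarrow> nat) \<Rightarrow> (nat \<Rightarrow> nat) \<Rightarrow> nat \<Rightarrow> (nat \<times> nat \<times> nat set) set" where
  "constraints m a k = (SIGMA i:{1..k}. {1..m i} \<times> (Pow {i..k} - {{}}) \<union> {m i<..m i + a i} \<times> {{i}})"

lemma constraints_split:
  fixes h :: "nat set \<Rightarrow> 'a::comm_monoid_mult"
  shows "(\<Prod>s\<in>constraints m a k. h (snd (snd s))) =
    (\<Prod>i\<in>{1..k}. h {i} ^ a i * (\<Prod>\<alpha>\<in>Pow {i..k} - {{}}. h \<alpha>) ^ m i)"
proof -
  have "(\<Prod>s\<in>constraints m a k. h (snd (snd s))) =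
      (\<Prod>i\<in>{1..k}. \<Prod>s\<in>{1..m i} \<times> (Pow {i..k} - {{}}) \<union> {m i<..m i + a i} \<times> {{i}}. h (snd s))"
    unfolding constraints_def by (subst prod.Sigma) (auto simp: case_prod_unfold)
  also have "\<dots> = (\<Prod>i\<in>{1..k}. h {i} ^ a i * (\<Prod>\<alpha>\<in>Pow {i..k} - {{}}. h \<alpha>) ^ m i)"
  proof (rule prod.cong[OF refl])
    fix i
    have "(\<Prod>s\<in>{1..m i} \<times> (Pow {i..k} - {{}}) \<union> {m i<..m i + a i} \<times> {{i}}. h (snd s)) =
        (\<Prod>s\<in>{1..m i} \<times> (Pow {i..k} - {{}}). h (snd s)) * (\<Prod>s\<in>{m i<..m i + a i} \<times> {{i}}. h (snd s))"
      by (rule prod.union_disjoint) auto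
    also have "(\<Prod>s\<in>{1..m i} \<times> (Pow {i..k} - {{}}). h (snd s)) = (\<Prod>\<alpha>\<in>Pow {i..k} - {{}}. h \<alpha>) ^ m i"
      using prod.cartesian_product[of "\<lambda>_ \<alpha>. h \<alpha>" "Pow {i..k} - {{}}" "{1..m i}"] by (simp add: case_prod_unfold)
    also have "(\<Prod>s\<in>{m i<..m i + a i} \<times> {{i}}. h (snd s)) = h {i} ^ a i"
      using prod.cartesian_product[of "\<lambda>_ \<alpha>. h \<alpha>" "{{i}}" "{m i<..m i + a i}"] by (simp add: case_prod_unfold)
    finally show "(\<Prod>s\<in>{1..m i} \<times> (Pow {i..k} - {{}}) \<union> {m i<..m i + a i} \<times> {{i}}. h (snd s)) =
        h {i} ^ a i * (\<Prod>\<alpha>\<in>Pow {i..k} - {{}}. h \<alpha>) ^ m i" by (simp add: mult.commute)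
  qed
  finally show ?thesis .
qed

lemma finite_constraints: "finite (constraints m a k)"
  by (auto simp: constraints_def)

lemma card_constraints: "card (constraints m a k) = C_bound m a k"
proof -
  have "card ({1..m i} \<times> (Pow {i..k} - {{}}) \<union> {m i<..m i + a i} \<times> {{i}}) = m i * (2 ^ (k - i + 1) - 1) + a i"
    if "i \<in> {1..k}" for i
  proof -
    have "card (Pow {i..k} - {{}}) = 2 ^ (k - i + 1) - 1"
      using that by (simp add: card_Diff_subset card_Pow Suc_diff_le)
    moreover have "card ({1..m i} \<times> (Pow {i..k} - {{}}) \<union> {m i<..m i + a i} \<times> {{i}}) =
        card ({1..m i} \<times> (Pow {i..k} - {{}})) + card ({m i<..m i + a i} \<times> {{i}})"
      by (rule card_Un_disjoint) auto
    ultimately show ?thesis by (simp add: card_cartesian_product)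
  qed
  then show ?thesis unfolding constraints_def C_bound_def
    by (subst card_SigmaI) (auto intro!: sum.cong)
qed

theorem admissible_if_coefficient:
  assumes k: "1 \<le> k" and m1: "1 \<le> m 1" and C: "C_bound m a k = k * d" and ad: "\<And>i. i \<in> {1..k} \<Longrightarrow> a i \<le> d"
    and coeff: "Poly_Mapping.lookup (\<Prod>s\<in>constraints m a k. \<Sum>i\<in>snd (snd s). var i) (top_exp k d) = 1"
  shows "admissible_dim m a k d"
  unfolding admissible_dim_def
proof (intro conjI allI impI)
  show "\<forall>i\<in>{1..k}. a i \<le> d" using ad by blast
  fix \<mu>0 :: "nat \<Rightarrow> nat \<Rightarrow> (nat \<Rightarrow> real) measure" and A
  assume mass0: "\<forall>i\<in>{1..k}. \<forall>j\<in>{1..m i}. mass d (\<mu>0 i j)"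
    and A: "\<forall>i\<in>{1..k}. affine_subspace d (int (a i) - 1) (A i)"
  \<comment> \<open>A nonzero first mass is what excludes vanishing normal vectors. If the given one
    is zero, a curve measure takes its place, and \<open>equipartition_null\<close> covers the zero
    mass at the end.\<close>
  define \<mu> where "\<mu> i j = (if i = 1 \<and> j = 1 \<and> measure (\<mu>0 1 1) (Rspace d) = 0 then curve_measure d 0 else \<mu>0 i j)" for i j
  have mass: "mass d (\<mu> i j)" if "i \<in> {1..k}" "j \<in> {1..m i}" for i j
    using mass0 that mass_curve_measure by (simp add: \<mu>_def)
  have pos: "measure (\<mu> 1 1) (Rspace d) \<noteq> 0"
    by (simp add: \<mu>_def measure_def emeasure_curve_measure_space)
  have "\<exists>b. A i = affine hull (b ` {m i<..m i + a i}) \<and> (\<forall>j\<in>{m i<..m i + a i}. b j \<in> Rspace d)" if i: "i \<in> {1..k}" for i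
  proof -
    obtain B where B: "finite B" "card B = a i" "A i = affine hull B" "A i \<subseteq> Rspace d"
      using bspec[OF A i] by (auto simp: affine_subspace_def)
    have "card {m i<..m i + a i} = card B" using B(2) by simp
    then obtain b where "bij_betw b {m i<..m i + a i} B"
      using finite_same_card_bij[of "{m i<..m i + a i}" B] B(1) by auto
    then have "b ` {m i<..m i + a i} = B" by (simp add: bij_betw_def)
    moreover have "B \<subseteq> Rspace d" using B(3,4) hull_subset[of B affine] by blast
    ultimately show ?thesis using B(3) by blast
  qed
  then obtain b where b: "\<And>i. i \<in> {1..k} \<Longrightarrow> A i = affine hull (b i ` {m i<..m i + a i})"
    "\<And>i j. i \<in> {1..k} \<Longrightarrow> j \<in> {m i<..m i + a i} \<Longrightarrow> b i j \<in> Rspace d" by metis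
  define f where "f s p = (case s of (i, j, \<alpha>) \<Rightarrow>
    if j \<le> m i then sgn_integral d (\<mu> i j) \<alpha> p else lf d p i (b i j))" for s p
  have conE: "i \<in> {1..k}" "\<alpha> \<subseteq> {i..k}" "j \<le> m i \<Longrightarrow> j \<in> {1..m i}" "\<not> j \<le> m i \<Longrightarrow> \<alpha> = {i}"
    if "(i, j, \<alpha>) \<in> constraints m a k" for i j \<alpha>
    using that by (auto simp: constraints_def)
  have "\<exists>p\<in>config k d. \<forall>s\<in>constraints m a k. f s p = 0"
  proof (rule borsuk_ulam_product[where \<alpha> = "\<lambda>s. snd (snd s)", OF finite_constraints])
    show "card (constraints m a k) = k * d" by (simp add: card_constraints C)
    fix s assume s: "s \<in> constraints m a k"
    obtain i j \<alpha> where [simp]: "s = (i, j, \<alpha>)" by (cases s)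
    note con = conE[OF s[simplified]]
    have sub: "\<alpha> \<subseteq> {1..k}" using con(1,2) by auto
    then show "snd (snd s) \<subseteq> {1..k}" by simp
    fix p
    show "f s (rflip g p) = (- 1) ^ card (g \<inter> snd (snd s)) * f s p" for g
    proof (cases "j \<le> m i")
      case True
      then show ?thesis using sgn_integral_rflip[OF finite_subset[OF sub finite_atLeastAtMost]] by (simp add: f_def)
    next
      case False
      then show ?thesis using con(4) by (simp add: f_def lf_rflip)
    qed
    show "(\<lambda>n. f s (P n)) \<longlonglongrightarrow> f s p" if "p \<in> config k d" "\<And>e. (\<lambda>n. P n e) \<longlonglongrightarrow> p e" for P
    proof (cases "j \<le> m i")
      case True
      then show ?thesis using tendsto_sgn_integral[OF mass[OF con(1) con(3)] sub that] by (simp add: f_def)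
    next
      case False
      then show ?thesis unfolding f_def lf_def using that(2) by (auto intro!: tendsto_intros)
    qed
  qed (rule coeff)
  then obtain p where p: "p \<in> config k d" "\<And>s. s \<in> constraints m a k \<Longrightarrow> f s p = 0" by blast
  let ?u = "\<lambda>l j. if j < d then p (Ix l j) else 0" and ?c = "\<lambda>l. p (Ix l d)"
  have zero: "sgn_integral d (\<mu> i j) \<alpha> p = 0"
    if "i \<in> {1..k}" "j \<in> {1..m i}" "\<alpha> \<subseteq> {i..k}" "\<alpha> \<noteq> {}" for i j \<alpha>
    using p(2)[of "(i, j, \<alpha>)"] that by (auto simp: constraints_def f_def)
  have inc: "lf d p i (b i j) = 0" if "i \<in> {1..k}" "j \<in> {m i<..m i + a i}" for i j
    using p(2)[of "(i, j, {i})"] that by (auto simp: constraints_def f_def)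
  show "\<exists>u c. (\<forall>i\<in>{1..k}. normal_vector d (u i) \<and> A i \<subseteq> hyperplane d (u i) (c i)) \<and>
        (\<forall>i\<in>{1..k}. \<forall>j\<in>{1..m i}. equipartition d {i..k} u c (\<mu>0 i j))"
  proof (intro exI[of _ ?u] exI[of _ ?c] conjI ballI)
    fix i assume i: "i \<in> {1..k}"
    have one: "1 \<in> {1..k}" "1 \<in> {1..m 1}" using k m1 by auto
    show "normal_vector d (?u i)"
    proof (rule normal_if_sgn_integral_0[OF mass[OF one] pos])
      show "\<exists>j\<le>d. p (Ix i j) \<noteq> 0" using p(1) i by (simp add: config_def)
      show "sgn_integral d (\<mu> 1 1) {i} p = 0" using zero[OF one, of "{i}"] i by simp
    qed
    have "b i j \<in> hyperplane d (?u i) (?c i)" if "j \<in> {m i<..m i + a i}" for j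
      using inc[OF i that] b(2)[OF i that] by (simp add: hyperplane_def lf_def)
    then show "A i \<subseteq> hyperplane d (?u i) (?c i)"
      unfolding b(1)[OF i] by (intro hull_minimal affine_hyperplane) auto
    fix j assume j: "j \<in> {1..m i}"
    have "equipartition d {i..k} ?u ?c (\<mu> i j)"
      by (rule equipartition_if_sgn_integral_0[OF mass[OF i j] _ p(1)]) (use i zero[OF i j] in auto)
    then show "equipartition d {i..k} ?u ?c (\<mu>0 i j)"
      using equipartition_null[of d "\<mu>0 i j" "{i..k}" ?u ?c] mass0 i j
      by (cases "i = 1 \<and> j = 1 \<and> measure (\<mu>0 1 1) (Rspace d) = 0") (auto simp: \<mu>_def)
  qed
qed

section \<open>The coefficient mod 2\<close>

lemma var_power: "var i ^ e = Poly_Mapping.single (Poly_Mapping.single i e) 1"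
proof (induction e)
  case (Suc e)
  then show ?case by (simp add: var_def mult_single single_add[symmetric])
qed simp

text \<open>The largest ideal of polynomials whose coefficient at \<open>\<kappa>\<close> is 0, so
  congruent polynomials agree in that coefficient. For \<open>\<kappa> = top_exp k d\<close> it
  contains each u_i^(d+1), because no multiple of that power has the monomial
  \<open>\<kappa>\<close>.\<close>

lemma char2_ideal_annihilator:
  "char2_ideal {p :: mpoly2. \<forall>r. Poly_Mapping.lookup (p * r) \<kappa> = 0}"
proof
  show "(1 :: mpoly2) + 1 = 0"
    by (rule poly_mapping_eqI) (simp only: lookup_add bit_add_self lookup_zero)
qed (auto simp: algebra_simps lookup_add)

lemma coefficient_one:
  assumes k: "1 \<le> k" and t: "1 \<le> t"
    and mono: "\<And>i j. 1 \<le> i \<Longrightarrow> i \<le> j \<Longrightarrow> j \<le> k \<Longrightarrow> a i \<le> a j"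
    and small: "\<And>i. 1 \<le> i \<Longrightarrow> i < k \<Longrightarrow> a i + t \<le> 2 ^ q"
    and m1: "m 1 + a 1 + t = 2 ^ Suc q"
    and mi: "\<And>i. 2 \<le> i \<Longrightarrow> i \<le> k \<Longrightarrow> m i + a i + 2 ^ q = 2 ^ q * 2 ^ (i - 2) + t + 2 * a (i - 1)"
    and d: "d + t = 2 ^ (q + k - 1) + 2 ^ q"
  shows "Poly_Mapping.lookup (\<Prod>s\<in>constraints m a k. \<Sum>i\<in>snd (snd s). var i) (top_exp k d) = 1"
proof -
  let ?J = "{p :: mpoly2. \<forall>r. Poly_Mapping.lookup (p * r) (top_exp k d) = 0}"
  \<comment> \<open>Reversing the variables turns the final segments \<open>{i..k}\<close> into
    initial ones, which makes the products over subsets the nested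
    \<open>dick v (Suc (k - i))\<close>.\<close>
  define v where "v l = var (k - l)" for l
  interpret char2_ideal ?J by (rule char2_ideal_annihilator)
  have vJ: "v l ^ Suc d \<in> ?J" if l: "l < k" for l
  proof -
    have "top_exp k d \<notin> Poly_Mapping.keys (v l ^ Suc d * r)" for r
    proof
      assume "top_exp k d \<in> Poly_Mapping.keys (v l ^ Suc d * r)"
      then obtain b where "top_exp k d = Poly_Mapping.single (k - l) (Suc d) + b"
        using keys_mult[of "v l ^ Suc d" r] by (auto simp: v_def var_power simp del: power_Suc)
      then have "Poly_Mapping.lookup (top_exp k d) (k - l) \<ge> Suc d" by (simp add: lookup_add)
      then show False by (simp add: lookup_top_exp split: if_splits)
    qed
    then show ?thesis by (simp add: in_keys_iff del: power_Suc)
  qed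
  have dick: "(\<Prod>\<alpha>\<in>Pow {i..k} - {{}}. \<Sum>i\<in>\<alpha>. var i) = dick v (Suc (k - i))" if i: "i \<in> {1..k}" for i
  proof -
    let ?r = "\<lambda>l. k - l"
    have inv: "?r ` ?r ` \<alpha> = \<alpha>" if "\<alpha> \<subseteq> {..k}" for \<alpha>
    proof -
      have "(\<lambda>l. k - (k - l)) ` \<alpha> = id ` \<alpha>" by (rule image_cong) (use that in auto)
      then show ?thesis by (simp add: image_image)
    qed
    show ?thesis
      unfolding dick_eq_prod
    proof (intro prod.reindex_bij_witness[of _ "image ?r" "image ?r"])
      fix \<alpha> assume \<alpha>: "\<alpha> \<in> Pow {i..k} - {{}}"
      then have le: "\<alpha> \<subseteq> {..k}" by auto
      show "?r ` ?r ` \<alpha> = \<alpha>" by (rule inv[OF le])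
      have "k - l < Suc (k - i)" if "l \<in> \<alpha>" for l
        using \<alpha> that by (auto simp: subset_iff less_Suc_eq_le intro: diff_le_mono2)
      then show "?r ` \<alpha> \<in> Pow {..<Suc (k - i)} - {{}}" using \<alpha> by blast
      have rr: "k - (k - l) = l" if "l \<in> \<alpha>" for l using le that by auto
      moreover have "inj_on ?r \<alpha>" by (rule inj_on_inverseI[of _ ?r]) (rule rr)
      ultimately show "(\<Sum>l\<in>?r ` \<alpha>. v l) = (\<Sum>i\<in>\<alpha>. var i)" by (simp add: v_def sum.reindex)
    next
      fix \<beta> assume \<beta>: "\<beta> \<in> Pow {..<Suc (k - i)} - {{}}"
      then have "\<beta> \<subseteq> {..k}" by auto
      then show "?r ` ?r ` \<beta> = \<beta>" by (rule inv)
      show "?r ` \<beta> \<in> Pow {i..k} - {{}}" using \<beta> i by auto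
    qed
  qed
  have "(\<Prod>s\<in>constraints m a k. \<Sum>i\<in>snd (snd s). var i) =
      (\<Prod>i\<in>{1..k}. var i ^ a i * dick v (Suc (k - i)) ^ m i)"
    using dick by (subst constraints_split[where h = "\<lambda>\<alpha>. \<Sum>i\<in>\<alpha>. var i"]) (auto intro!: prod.cong)
  also have "\<dots> = (\<Prod>j<k. v j ^ a (k - j) * dick v (Suc j) ^ m (k - j))"
    by (rule prod.reindex_bij_witness[of _ "\<lambda>j. k - j" "\<lambda>i. k - i"]) (auto simp: v_def)
  finally have P: "(\<Prod>s\<in>constraints m a k. \<Sum>i\<in>snd (snd s). var i) =
      (\<Prod>j<k. v j ^ a (k - j) * dick v (Suc j) ^ m (k - j))" .
  have "(\<Prod>j<k. v j ^ a (k - j) * dick v (Suc j) ^ m (k - j)) + (\<Prod>j<k. v j ^ d) \<in> ?J"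
  proof (rule dick_prod_cong[where t = t and q = q])
    show "m (k - (k - 1)) + a (k - (k - 1)) + t = 2 ^ Suc q" using m1 k by simp
    show "m (k - j) + a (k - j) + 2 ^ q = 2 ^ q * 2 ^ (k - j - 2) + t + 2 * a (k - Suc j)" if "j < k - 1" for j
      using mi[of "k - j"] that by simp
    show "a (k - j) \<le> a (k - i)" if "i \<le> j" "j < k" for i j using mono[of "k - j" "k - i"] that by simp
    show "a (k - j) + t \<le> 2 ^ q" if "0 < j" "j < k" for j using small[of "k - j"] that by simp
  qed (use k t d vJ in auto)
  then have "Poly_Mapping.lookup (((\<Prod>s\<in>constraints m a k. \<Sum>i\<in>snd (snd s). var i) + (\<Prod>j<k. v j ^ d)) * 1) (top_exp k d) = 0"
    unfolding P by blast
  moreover have "(\<Prod>j<k. v j ^ d) = Poly_Mapping.single (top_exp k d) 1"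
  proof -
    have "(\<Prod>j<k. v j ^ d) = (\<Prod>i\<in>{1..k}. var i ^ d)"
      by (rule prod.reindex_bij_witness[of _ "\<lambda>i. k - i" "\<lambda>j. k - j"]) (auto simp: v_def)
    also have "\<dots> = Poly_Mapping.single (top_exp k d) 1"
      unfolding var_power top_exp_def by (rule prod_single)
    finally show ?thesis .
  qed
  ultimately have "Poly_Mapping.lookup (\<Prod>s\<in>constraints m a k. \<Sum>i\<in>snd (snd s). var i) (top_exp k d) + 1 = 0"
    by (simp add: lookup_add)
  then show ?thesis by (cases "Poly_Mapping.lookup (\<Prod>s\<in>constraints m a k. \<Sum>i\<in>snd (snd s). var i) (top_exp k d)") auto
qed

text \<open>All a_i cancel: a_i enters through m_i, through m_(i+1) and directly, with the weights
  -(2^(k-i+1) - 1), 2 * (2^(k-i) - 1) and 1.\<close>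

lemma C_bound_eq:
  assumes k: "1 \<le> k"
    and m1: "m 1 + a 1 + t = 2 ^ Suc q"
    and mi: "\<And>i. 2 \<le> i \<Longrightarrow> i \<le> k \<Longrightarrow> m i + a i + 2 ^ q = 2 ^ q * 2 ^ (i - 2) + t + 2 * a (i - 1)"
    and d: "d + t = 2 ^ (q + k - 1) + 2 ^ q"
  shows "C_bound m a k = k * d"
proof -
  define Q K :: int where "Q = 2 ^ q" and "K = 2 ^ k"
  have m1': "int (m 1) = 2 * Q - int t - int (a 1)"
    using arg_cong[OF m1, of int] by (simp add: Q_def)
  have mi': "int (m (Suc n)) = Q * 2 ^ (n - 1) - Q + int t + 2 * int (a n) - int (a (Suc n))" if "1 \<le> n" "Suc n \<le> k" for n
    using arg_cong[OF mi[of "Suc n"], of int] that by (simp add: Q_def)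
  \<comment> \<open>The partial sums are doubled to avoid halving \<open>K\<close>. The last summand
    is the share of \<open>a n\<close> that m_(n+1) will cancel; it is 0 at
    \<open>n = k\<close>.\<close>
  have S: "2 * (\<Sum>i=1..n. int (m i) * (2 ^ (k - i + 1) - 1) + int (a i)) =
      2 * (2 * Q - int t) * (K - 1) + (int n - 1) * Q * K - Q * (2 ^ n - 2)
      - 2 * (Q - int t) * (K - 2 ^ (k - n + 1) - (int n - 1)) - 2 * int (a n) * (2 ^ (k - n + 1) - 2)"
    if "1 \<le> n" "n \<le> k" for n
    using that
  proof (induction n rule: nat_induct_at_least)
    case base
    have "(2 :: int) ^ (k - 1 + 1) = K" using k by (simp add: K_def)
    then have "2 * (\<Sum>i=1..1. int (m i) * (2 ^ (k - i + 1) - 1) + int (a i)) = 2 * (int (m 1) * (K - 1) + int (a 1))"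
      by simp
    also have "\<dots> = 2 * (2 * Q - int t) * (K - 1) + (int 1 - 1) * Q * K - Q * (2 ^ 1 - 2)
        - 2 * (Q - int t) * (K - 2 ^ (k - 1 + 1) - (int 1 - 1)) - 2 * int (a 1) * (2 ^ (k - 1 + 1) - 2)"
      unfolding m1' \<open>(2 :: int) ^ (k - 1 + 1) = K\<close> by (simp add: algebra_simps)
    finally show ?case .
  next
    case (Suc n)
    define w :: int where "w = 2 ^ (k - Suc n)"
    define z :: int where "z = 2 ^ (n - 1)"
    have z: "(2 :: int) ^ n = 2 * z" using Suc.hyps by (cases n) (auto simp: z_def)
    have w: "(2 :: int) ^ (k - n + 1) = 4 * w" "(2 :: int) ^ (k - Suc n + 1) = 2 * w"
    proof -
      have "k - n = Suc (k - Suc n)" using Suc.prems by simp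
      then show "(2 :: int) ^ (k - n + 1) = 4 * w" by (simp add: w_def)
    qed (simp add: w_def)
    have zw: "K = 4 * (z * w)"
    proof -
      have "(2 :: int) ^ ((n - 1) + (k - Suc n) + 2) = 4 * (z * w)"
        unfolding power_add z_def w_def by simp
      moreover have "(n - 1) + (k - Suc n) + 2 = k" using Suc.hyps Suc.prems by simp
      ultimately show ?thesis by (simp only: K_def)
    qed
    have m: "int (m (Suc n)) = Q * z - Q + int t + 2 * int (a n) - int (a (Suc n))"
      using mi'[of n] Suc.hyps Suc.prems by (simp add: z_def)
    have IH: "2 * (\<Sum>i=1..n. int (m i) * (2 ^ (k - i + 1) - 1) + int (a i)) =
      2 * (2 * Q - int t) * (K - 1) + (int n - 1) * Q * K - Q * (2 * z - 2)
      - 2 * (Q - int t) * (K - 4 * w - (int n - 1)) - 2 * int (a n) * (4 * w - 2)"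
      using Suc.IH Suc.prems unfolding w z by simp
    have "2 * (\<Sum>i=1..Suc n. int (m i) * (2 ^ (k - i + 1) - 1) + int (a i)) =
        2 * (\<Sum>i=1..n. int (m i) * (2 ^ (k - i + 1) - 1) + int (a i)) +
        2 * (int (m (Suc n)) * (2 * w - 1) + int (a (Suc n)))"
      using w(2) by simp
    also have "\<dots> = 2 * (2 * Q - int t) * (K - 1) + (int (Suc n) - 1) * Q * K - Q * (4 * z - 2)
      - 2 * (Q - int t) * (K - 2 * w - (int (Suc n) - 1)) - 2 * int (a (Suc n)) * (2 * w - 2)"
      unfolding IH m by (simp add: zw algebra_simps)
    finally show ?case unfolding w using z by simp
  qed
  have "int (C_bound m a k) = (\<Sum>i=1..k. int (m i) * (2 ^ (k - i + 1) - 1) + int (a i))"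
    by (simp add: C_bound_def of_nat_diff)
  also have "2 * \<dots> = 2 * (2 * Q - int t) * (K - 1) + (int k - 1) * Q * K - Q * (K - 2)
      - 2 * (Q - int t) * (K - 2 - (int k - 1))"
    using S[of k] k by (simp add: K_def)
  also have "\<dots> = int k * (Q * K + 2 * Q - 2 * int t)" by (simp add: algebra_simps)
  also have "Q * K + 2 * Q - 2 * int t = 2 * int d"
  proof -
    have "2 * (2 :: int) ^ (q + k - 1) = Q * K"
      using k by (cases k) (auto simp: Q_def K_def power_add)
    then show ?thesis using arg_cong[OF d, of int] by (simp add: Q_def)
  qed
  finally have "int (C_bound m a k) = int (k * d)" by simp
  then show ?thesis by (simp only: of_nat_eq_iff)
qed

section \<open>The value of the minimum dimension\<close>

lemma Delta_eqI:
  assumes "1 \<le> k" "admissible_dim m a k d" "C_bound m a k = k * d"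
  shows "Delta m a k = enat d"
  unfolding Delta_def
proof (rule antisym)
  show "(INF d \<in> {d. admissible_dim m a k d}. enat d) \<le> enat d"
    by (rule INF_lower) (use assms in simp)
  show "enat d \<le> (INF d \<in> {d. admissible_dim m a k d}. enat d)"
  proof (rule INF_greatest)
    fix d' assume "d' \<in> {d. admissible_dim m a k d}"
    then have "k * d \<le> k * d'" using lower_bound[of m a k d'] assms(3) by simp
    then show "enat d \<le> enat d'" using assms(1) by simp
  qed
qed

text \<open>The hypotheses avoid subtraction: as equations between naturals, \<open>m1\<close> and
  \<open>mi\<close> also express that all m_i are nonnegative.\<close>

lemma Delta_eq:
  assumes k: "2 \<le> k" and t: "1 \<le> t" "t \<le> 2 ^ q"
    and mono: "\<And>i. 1 \<le> i \<Longrightarrow> i < k \<Longrightarrow> a i \<le> a (Suc i)"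
    and small: "a (k - 1) + t \<le> 2 ^ q"
    and m1: "m 1 + a 1 + t = 2 ^ Suc q"
    and mi: "\<And>i. 2 \<le> i \<Longrightarrow> i \<le> k \<Longrightarrow> m i + a i + 2 ^ q = 2 ^ q * 2 ^ (i - 2) + t + 2 * a (i - 1)"
  shows "Delta m a k = enat (2 ^ q * (2 ^ (k - 1) + 1) - t)"
    and "C_bound m a k = k * (2 ^ q * (2 ^ (k - 1) + 1) - t)"
proof -
  define d where "d = 2 ^ q * (2 ^ (k - 1) + 1) - t"
  have d: "d + t = 2 ^ (q + k - 1) + 2 ^ q"
  proof -
    have "(2 :: nat) ^ (q + k - 1) = 2 ^ q * 2 ^ (k - 1)" using k by (simp flip: power_add)
    then show ?thesis using t by (simp add: d_def)
  qed
  have mono': "a i \<le> a j" if "1 \<le> i" "i \<le> j" "j \<le> k" for i j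
    using that(2,3)
  proof (induction j rule: dec_induct)
    case (step j)
    then show ?case using mono[of j] that(1) by simp
  qed simp
  have small': "a i + t \<le> 2 ^ q" if "1 \<le> i" "i < k" for i
  proof -
    have "i \<le> k - 1" using that by simp
    then show ?thesis using mono'[of i "k - 1"] that(1) small by simp
  qed
  have "k \<ge> 1" using k by simp
  show C: "C_bound m a k = k * (2 ^ q * (2 ^ (k - 1) + 1) - t)"
    unfolding d_def[symmetric] by (rule C_bound_eq[OF \<open>k \<ge> 1\<close> m1 mi d])
  \<comment> \<open>Nonnegativity of m_k enters here: \<open>mi\<close> at \<open>k\<close> and
    a_(k-1) \<le> 2^q - t bound a_k by 2^(q+k-2) + 2^q - t.\<close>
  have "a k \<le> d"
  proof -
    have "m k + a k + 2 ^ q = 2 ^ q * 2 ^ (k - 2) + t + 2 * a (k - 1)" using mi[of k] k by simp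
    moreover have "(2 :: nat) ^ (q + k - 1) = 2 * (2 ^ q * 2 ^ (k - 2))"
      using k by (simp flip: power_add power_Suc)
    ultimately show ?thesis using small d by linarith
  qed
  then have ad: "a i \<le> d" if "i \<in> {1..k}" for i using mono'[of i k] that by simp
  have "1 \<le> m 1" using m1 small'[of 1] k t by simp
  then have "admissible_dim m a k d"
    using C coefficient_one[OF \<open>k \<ge> 1\<close> t(1) mono' small' m1 mi d] ad
    by (intro admissible_if_coefficient[OF \<open>k \<ge> 1\<close>]) (simp_all add: d_def)
  then show "Delta m a k = enat (2 ^ q * (2 ^ (k - 1) + 1) - t)"
    using Delta_eqI[OF \<open>k \<ge> 1\<close>] C by (simp add: d_def)
qed

text \<open>As 1 \<le> t \<le> 2^q, the leading binary digit of 2^(q+1) - t stands at position q,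
  with remainder 2^q - t.\<close>

lemma U_bound_eq:
  assumes "1 \<le> k" "1 \<le> t" "t \<le> 2 ^ q"
  shows "U_bound (2 ^ (q + 1) - t) k = 2 ^ q * (2 ^ (k - 1) + 1) - t"
proof -
  have "floor_log (2 ^ (q + 1) - t) = q"
    by (rule floor_log_eqI) (use assms in auto)
  moreover have "(2 :: nat) ^ (q + k - 1) = 2 ^ q * 2 ^ (k - 1)" using assms by (simp flip: power_add)
  ultimately show ?thesis using assms by (simp add: U_bound_def)
qed

text \<open>\<open>m\<close> is integer-valued so that its formulas involve no truncated subtraction
  and \<open>m k \<ge> 0\<close> is a genuine hypothesis.\<close>

theorem theorem6p2:
  fixes k q t :: nat
  assumes "k \<ge> 2" and "1 \<le> t" and "t \<le> 2 ^ q"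
  shows
    "(\<forall>(a :: nat \<Rightarrow> nat) (m :: nat \<Rightarrow> int).
        (\<forall>i\<in>{1..<k}. a i \<le> a (i + 1)) \<longrightarrow>
        a 2 \<le> 2 * a 1 + t \<longrightarrow>
        int (a (k - 1)) \<le> 2 ^ q - int t \<longrightarrow>
        m 1 = 2 ^ (q + 1) - int t - int (a 1) \<longrightarrow>
        (\<forall>i\<in>{2..k}. m i = 2 ^ q * (2 ^ (i - 2) - 1) + int t + 2 * int (a (i - 1)) - int (a i)) \<longrightarrow>
        m k \<ge> 0 \<longrightarrow>
        m 1 \<ge> 1 \<and> (\<forall>i\<in>{1..k}. m i \<ge> 0) \<and>
        Delta (\<lambda>i. nat (m i)) a k = enat (2 ^ q * (2 ^ (k - 1) + 1) - t) \<and>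
        enat k * Delta (\<lambda>i. nat (m i)) a k = enat (C_bound (\<lambda>i. nat (m i)) a k) \<and>
        (a 1 = 0 \<longrightarrow> Delta (\<lambda>i. nat (m i)) a k = enat (U_bound (nat (m 1)) k))) \<and>
     Delta (\<lambda>i. if i = 1 then 2 ^ (q + 1) - t else 2 ^ q * (2 ^ (i - 2) - 1) + t) (\<lambda>_. 0) k
       = enat (U_bound (2 ^ (q + 1) - t) k)"
proof (intro conjI allI impI)
  fix a :: "nat \<Rightarrow> nat" and m :: "nat \<Rightarrow> int"
  assume mono: "\<forall>i\<in>{1..<k}. a i \<le> a (i + 1)" and a2: "a 2 \<le> 2 * a 1 + t"
    and small: "int (a (k - 1)) \<le> 2 ^ q - int t" and m1: "m 1 = 2 ^ (q + 1) - int t - int (a 1)"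
    and mi: "\<forall>i\<in>{2..k}. m i = 2 ^ q * (2 ^ (i - 2) - 1) + int t + 2 * int (a (i - 1)) - int (a i)"
    and mk: "m k \<ge> 0"
  have small': "int (a i) \<le> 2 ^ q - int t" if "1 \<le> i" "i < k" for i
  proof -
    have "i \<le> k - 1" using that by simp
    then have "a i \<le> a (k - 1)"
    proof (induction i rule: inc_induct)
      case (step j)
      then show ?case using mono that by (cases "1 \<le> j") (auto intro: le_trans)
    qed simp
    then show ?thesis using small by linarith
  qed
  have q1: "(2 :: int) ^ q \<ge> 1" by simp
  have "m 1 = 2 * 2 ^ q - int t - int (a 1)" using m1 by simp
  moreover have "int (a 1) \<le> 2 ^ q - int t" using small'[of 1] assms(1) by simp
  ultimately show m1': "m 1 \<ge> 1" using q1 by linarith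
  \<comment> \<open>Condition (ii) settles i = 2. For 3 \<le> i < k the term 2^q * (2^(i-2) - 1) is
    at least 2^q, which exceeds a_i by (iii).\<close>
  have m0: "m i \<ge> 0" if i: "i \<in> {1..k}" for i
  proof -
    consider "i = 1" | "i = k" | "i = 2" "i < k" | "3 \<le> i" "i < k" using i by force
    then show ?thesis
    proof cases
      case 3
      then show ?thesis using bspec[OF mi, of 2] a2 by simp
    next
      case 4
      have "(2 :: int) ^ 1 \<le> 2 ^ (i - 2)" by (rule power_increasing) (use 4 in auto)
      then have "(2 :: int) ^ q * 1 \<le> 2 ^ q * (2 ^ (i - 2) - 1)" by (intro mult_left_mono) auto
      moreover have "m i = 2 ^ q * (2 ^ (i - 2) - 1) + int t + 2 * int (a (i - 1)) - int (a i)"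
        using bspec[OF mi, of i] 4 by simp
      moreover have "int (a i) \<le> 2 ^ q - int t" using small'[of i] 4 by simp
      ultimately show ?thesis by linarith
    qed (use m1' mk in auto)
  qed
  then show "\<forall>i\<in>{1..k}. m i \<ge> 0" by blast
  have n1: "nat (m 1) + a 1 + t = 2 ^ Suc q"
  proof -
    have "int (nat (m 1) + a 1 + t) = int (2 ^ Suc q)" using m1 m1' by simp
    then show ?thesis by (simp only: of_nat_eq_iff)
  qed
  have ni: "nat (m i) + a i + 2 ^ q = 2 ^ q * 2 ^ (i - 2) + t + 2 * a (i - 1)" if "2 \<le> i" "i \<le> k" for i
  proof -
    have "int (nat (m i) + a i + 2 ^ q) = int (2 ^ q * 2 ^ (i - 2) + t + 2 * a (i - 1))"
      using bspec[OF mi, of i] m0[of i] that by (simp add: algebra_simps)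
    then show ?thesis by (simp only: of_nat_eq_iff)
  qed
  have "int (a (k - 1) + t) \<le> int (2 ^ q)" using small by simp
  then have "a (k - 1) + t \<le> 2 ^ q" by (simp only: of_nat_le_iff)
  note D = Delta_eq[of k t q a "\<lambda>i. nat (m i)", OF assms _ this n1 ni]
  show D1: "Delta (\<lambda>i. nat (m i)) a k = enat (2 ^ q * (2 ^ (k - 1) + 1) - t)"
    by (rule D(1)) (use mono in auto)
  have "C_bound (\<lambda>i. nat (m i)) a k = k * (2 ^ q * (2 ^ (k - 1) + 1) - t)"
    by (rule D(2)) (use mono in auto)
  then show "enat k * Delta (\<lambda>i. nat (m i)) a k = enat (C_bound (\<lambda>i. nat (m i)) a k)"
    by (simp only: D1 times_enat_simps)
  assume "a 1 = 0"
  then have "nat (m 1) = 2 ^ (q + 1) - t" using n1 by simp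
  then show "Delta (\<lambda>i. nat (m i)) a k = enat (U_bound (nat (m 1)) k)"
    using U_bound_eq[of k t q] assms D1 by simp
next
  let ?m = "\<lambda>i :: nat. if i = 1 then 2 ^ (q + 1) - t else 2 ^ q * (2 ^ (i - 2) - 1) + t"
  have "Delta ?m (\<lambda>_. 0) k = enat (2 ^ q * (2 ^ (k - 1) + 1) - t)"
  proof (rule Delta_eq(1)[OF assms])
    show "?m 1 + 0 + t = 2 ^ Suc q" using assms by simp
    show "?m i + 0 + 2 ^ q = 2 ^ q * 2 ^ (i - 2) + t + 2 * 0" if "2 \<le> i" "i \<le> k" for i
    proof -
      have "(2 :: nat) ^ q * (2 ^ (i - 2) - 1) + 2 ^ q = 2 ^ q * 2 ^ (i - 2)"
        by (simp add: diff_mult_distrib2)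
      then show ?thesis using that by simp
    qed
  qed (use assms in auto)
  then show "Delta ?m (\<lambda>_. 0) k = enat (U_bound (2 ^ (q + 1) - t) k)"
    using U_bound_eq[of k t q] assms by simp
qed

end
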